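(* Let $d\ge2$ and let $\mathbb P=\mathbb P^\zeta$ be the Boolean model with supercritical intensity $\zeta>\zeta_c$. For $\omega\in\Omega_0$ let $$\delta(\omega):=\mathrm{dist}\big(0,\mathbb R^d\setminus\mathcal C_\infty(\omega)\big)=\mathrm{dist}\big(0,\partial\mathcal C_\infty(\omega)\big).$$ Then there exist constants $c,C,\varepsilon_0>0$ such that for all $0<\varepsilon<\varepsilon_0$, $$c\,\varepsilon\le\mathbb P_0(\delta<\varepsilon)\le C\,\varepsilon .$$ Consequently, for $\chi>0$, $$\mathbb E_0[\delta^{-\chi}]<\infty\iff\chi\in(0,1).$$
   Context: $\Omega$ is the set of locally finite subsets of $\mathbb R^d$ and $\mathbb P^\zeta$ is the law on $\Omega$ of the homogeneous Poisson point process of intensity $\zeta>0$. $\mathcal C(\omega)=\bigcup_{y\in\omega}B_{1/2}(y)$ with $B_r(y)$ open balls. $\zeta_c\in(0,\infty)$ is the critical intensity, above which $\mathcal C(\omega)$ almost surely has an unbounded connected component, which is then a.s. unique and is denoted $\mathcal C_\infty(\omega)$. $\Omega_0=\{\omega:\mathcal C_\infty(\omega)\text{ exists and }0\in\mathcal C_\infty(\omega)\}$, which has positive probability, $\mathbb P_0=\mathbb P(\cdot\mid\Omega_0)$, and $\mathbb E_0$ is its expectation. *)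

theory Defs
  imports "HOL-Probability.Probability"
begin

definition configurations :: "'a::euclidean_space set set" where
  "configurations = {\<omega>. \<forall>B. bounded B \<longrightarrow> finite (\<omega> \<inter> B)}"

definition configuration_space :: "'a::euclidean_space set measure" where
  "configuration_space =
     sigma configurations
       {{\<omega> \<in> configurations. card (\<omega> \<inter> B) = n} | B n. B \<in> sets borel \<and> bounded B}"

text \<open>
  The probability mass function is written out because \<open>poisson_pmf\<close> does not cover the
  degenerate rate 0, which occurs for Lebesgue-null \<open>B\<close>; here \<open>0 ^ 0 = 1\<close> gives the Dirac mass
  at 0.  The conditions determine \<open>P\<close> uniquely.
\<close>

definition poisson_process_law :: "real \<Rightarrow> 'a::euclidean_space set measure \<Rightarrow> bool" where
  "poisson_process_law \<zeta> P \<longleftrightarrow>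
     prob_space P \<and>
     space P = configurations \<and>
     sets P = sets configuration_space \<and>
     (\<forall>B n. B \<in> sets borel \<and> bounded B \<longrightarrow>
        measure P {\<omega> \<in> space P. card (\<omega> \<inter> B) = n} =
          (\<zeta> * measure lborel B) ^ n / fact n * exp (- (\<zeta> * measure lborel B))) \<and>
     (\<forall>(B :: nat \<Rightarrow> 'a set) I.
        finite I \<and> disjoint_family_on B I \<and> (\<forall>i\<in>I. B i \<in> sets borel \<and> bounded (B i)) \<longrightarrow>
        prob_space.indep_vars P (\<lambda>_. count_space UNIV) (\<lambda>i \<omega>. card (\<omega> \<inter> B i)) I)"

definition boolean_model :: "'a::euclidean_space set \<Rightarrow> 'a set" where
  "boolean_model \<omega> = (\<Union>y\<in>\<omega>. ball y (1 / 2))"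

definition unbounded_components :: "'a::euclidean_space set \<Rightarrow> 'a set set" where
  "unbounded_components \<omega> = {K \<in> components (boolean_model \<omega>). \<not> bounded K}"

text \<open>
  The percolation threshold is the supremum of the intensities without percolation.  It is
  extended-real valued so that the supremum always makes sense; the type argument carries the
  dimension.
\<close>

definition critical_intensity :: "'a::euclidean_space itself \<Rightarrow> ennreal" where
  "critical_intensity _ =
     Sup {ennreal \<zeta> | \<zeta>. 0 < \<zeta> \<and>
       (\<exists>P :: 'a set measure. poisson_process_law \<zeta> P \<and>
          (AE \<omega> in P. unbounded_components \<omega> = {}))}"

text \<open>Meaningful only if there is exactly one unbounded component.\<close>

definition infinite_cluster :: "'a::euclidean_space set \<Rightarrow> 'a set" where
  "infinite_cluster \<omega> = (THE K. K \<in> unbounded_components \<omega>)"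

definition Omega0 :: "'a::euclidean_space set set" where
  "Omega0 = {\<omega> \<in> configurations.
     (\<exists>!K. K \<in> unbounded_components \<omega>) \<and> 0 \<in> infinite_cluster \<omega>}"

text \<open>The conditional law given \<open>Omega0\<close>.\<close>

definition P0 :: "'a::euclidean_space set measure \<Rightarrow> 'a set measure" where
  "P0 P = uniform_measure P Omega0"

text \<open>
  Used only on \<open>Omega0\<close>, where the cluster is an open set containing 0, so that the distance is
  positive as soon as the complement is nonempty.  For the null event of an empty complement
  \<open>infdist\<close> returns 0 by convention.
\<close>

definition boundary_dist :: "'a::euclidean_space set \<Rightarrow> real" where
  "boundary_dist \<omega> = infdist 0 (- infinite_cluster \<omega>)"

end

theory Submission
  imports Defs
begin

text \<open>
Everything hinges on the Poisson points near the sphere of radius \<open>1/2\<close> about the origin.  If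
\<open>0\<close> belongs to the infinite cluster, it is covered by a ball \<open>B_{1/2}(y)\<close> of that cluster.  If,
moreover, a point of the complement lies at distance less than \<open>\<epsilon>\<close> from \<open>0\<close>, then
\<open>1/2 - \<epsilon> < |y| < 1/2\<close>.  A shell of thickness \<open>\<epsilon>\<close> has volume of order \<open>\<epsilon>\<close>, so that it contains a
Poisson point with probability at most \<open>C \<epsilon>\<close>.  This is the upper bound
(\<open>small_distance_upper_bound\<close>); the configurations whose cluster is the whole space form a null
set (\<open>full_cover_null\<close>).

For the lower bound, suppose that exactly one point \<open>y\<close> lies in this shell and that no other point
has norm at most \<open>3/4\<close>.  The point at distance \<open>1/2 - |y| < \<epsilon>\<close> from the origin in the direction
opposite to \<open>y\<close> is then not covered, and it remains to make sure that \<open>y\<close> belongs to a unique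
unbounded cluster (\<open>Omega0_if_lone_point\<close>).  To this end the annulus between the radii \<open>3/4\<close> and
\<open>R\<close> is filled densely with points, so that it joins \<open>y\<close> to all unbounded clusters of the
configuration outside the ball of radius \<open>R\<close>, provided that these clusters all come close to the
ball.  The three requirements concern disjoint regions and are therefore independent; only the
first one depends on \<open>\<epsilon>\<close>, and it has probability of order \<open>\<epsilon>\<close>
(\<open>small_distance_lower_bound\<close>).

What is needed is thus a radius \<open>R\<close> for which, with positive probability, the configuration outside
the ball has an unbounded cluster and all its unbounded clusters come close to the ball
(\<open>clusters_near_ball_possible\<close>).  Above the critical intensity there is an unbounded cluster with
positive probability.  If almost surely there are at most two of them, a large ball meets all of
them, and it can be removed.  That three different unbounded clusters do not occur is the
Burton--Keane argument (\<open>three_clusters_null\<close>): otherwise, removing the points in a ball and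
refilling it densely creates, with positive probability, a trifurcation, namely a ball whose points
are connected and whose removal leaves three unbounded clusters next to it.  By stationarity the
expected number of trifurcations among \<open>n^d\<close> disjoint balls in a box of side proportional to \<open>n\<close>
is proportional to \<open>n^d\<close>.  On the other hand this number is at most the number of Poisson points in
a layer around the boundary of the box (\<open>card_trifurcation_balls_le\<close>), whose expectation is of
order \<open>n^(d-1)\<close>.

Stationarity and the independence of disjoint regions come from the void events \<open>X \<inter> B = {}\<close>: they
form an intersection-stable generator of the sigma-algebra, and their probabilities depend only on
the volume of \<open>B\<close> and factorize over disjoint sets.  Connection events are expressed through the
hits of countably many open sets, which makes them measurable.

Finally, two-sided linear bounds for the probability of small values of a random variable decide
which of its negative moments are finite, by a dyadic decomposition.
\<close>

section \<open>Clusters of the link graph\<close>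

text \<open>
Open balls of radius \<open>1/2\<close> overlap exactly when their centres have distance less than 1.
\<close>

definition link :: "'a::metric_space set \<Rightarrow> ('a \<times> 'a) set" where
  "link A = {(x, y). x \<in> A \<and> y \<in> A \<and> dist x y < 1}"

definition linked :: "'a::metric_space set \<Rightarrow> 'a \<Rightarrow> 'a \<Rightarrow> bool" where
  "linked A x y \<longleftrightarrow> x \<in> A \<and> y \<in> A \<and> (x, y) \<in> (link A)\<^sup>*"

definition percolates :: "'a::metric_space set \<Rightarrow> 'a \<Rightarrow> bool" where
  "percolates A x \<longleftrightarrow> infinite {y. linked A x y}"

abbreviation one_cluster :: "'a::metric_space set \<Rightarrow> bool" where
  "one_cluster A \<equiv> \<forall>x y. percolates A x \<longrightarrow> percolates A y \<longrightarrow> linked A x y"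

lemma linked_refl [simp]: "linked A x x \<longleftrightarrow> x \<in> A"
  by (auto simp: linked_def)

lemma linked_in: "linked A x y \<Longrightarrow> x \<in> A \<and> y \<in> A"
  by (auto simp: linked_def)

lemma linked_sym: "linked A x y \<Longrightarrow> linked A y x"
proof -
  assume "linked A x y"
  moreover have "sym (link A)" by (auto simp: sym_def link_def dist_commute)
  ultimately show ?thesis
    unfolding linked_def by (meson sym_rtrancl symD)
qed

lemma linked_trans: "linked A x y \<Longrightarrow> linked A y z \<Longrightarrow> linked A x z"
  unfolding linked_def by auto

lemma linked_step: "x \<in> A \<Longrightarrow> y \<in> A \<Longrightarrow> dist x y < 1 \<Longrightarrow> linked A x y"
  unfolding linked_def link_def by auto

lemma linked_mono: "linked A x y \<Longrightarrow> A \<subseteq> B \<Longrightarrow> linked B x y"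
proof -
  assume "linked A x y" "A \<subseteq> B"
  moreover from \<open>A \<subseteq> B\<close> have "(link A)\<^sup>* \<subseteq> (link B)\<^sup>*"
    by (intro rtrancl_mono) (auto simp: link_def)
  ultimately show ?thesis unfolding linked_def by auto
qed

lemma linked_induct [consumes 1, case_names refl step]:
  assumes "linked A x y" "x \<in> A \<Longrightarrow> Q x"
    "\<And>y z. linked A x y \<Longrightarrow> z \<in> A \<Longrightarrow> dist y z < 1 \<Longrightarrow> Q y \<Longrightarrow> Q z"
  shows "Q y"
proof -
  have xA: "x \<in> A" using assms(1) by (simp add: linked_def)
  have "(x, y) \<in> (link A)\<^sup>*" using assms(1) by (simp add: linked_def)
  then show ?thesis
  proof (induction rule: rtrancl_induct)
    case base then show ?case using assms(2) xA by blast
  next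
    case (step y z)
    then have "y \<in> A" "z \<in> A" "dist y z < 1" by (auto simp: link_def)
    with step xA show ?case by (intro assms(3)[of y z]) (auto simp: linked_def)
  qed
qed

lemma percolates_in: "percolates A x \<Longrightarrow> x \<in> A"
proof (rule ccontr)
  assume "percolates A x" "x \<notin> A"
  then have "{y. linked A x y} = {}" by (auto dest: linked_in)
  with \<open>percolates A x\<close> show False by (simp add: percolates_def)
qed

lemma percolates_linked: "percolates A x \<Longrightarrow> linked A x y \<Longrightarrow> percolates A y"
proof -
  assume a: "percolates A x" "linked A x y"
  then have "{z. linked A x z} = {z. linked A y z}"
    by (meson linked_trans linked_sym)
  with a show ?thesis by (simp add: percolates_def)
qed

lemma percolates_mono: "percolates A x \<Longrightarrow> A \<subseteq> B \<Longrightarrow> percolates B x"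
  unfolding percolates_def
  by (rule infinite_super) (auto intro: linked_mono)

text \<open>
All arguments about paths that cross the boundary of a set \<open>U\<close> use only the part of the path up to
the first step out of \<open>U\<close>.
\<close>

lemma linked_first_exit:
  assumes "linked A x y" "x \<in> U" "y \<notin> U"
  obtains u v where "linked (A \<inter> U) x u" "v \<in> A - U" "dist u v < 1"
proof -
  have "linked (A \<inter> U) x y \<or> (\<exists>u v. linked (A \<inter> U) x u \<and> v \<in> A - U \<and> dist u v < 1)"
    using assms(1)
  proof (induction rule: linked_induct)
    case refl then show ?case using assms(2) by simp
  next
    case (step y z)
    show ?case
    proof (cases "z \<in> U \<and> linked (A \<inter> U) x y")
      case True
      then have "linked (A \<inter> U) y z" using step by (intro linked_step) (auto dest: linked_in)
      then show ?thesis using True linked_trans by blast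
    next
      case False
      then show ?thesis using step by blast
    qed
  qed
  then show ?thesis using that assms(3) by (auto dest: linked_in)
qed

text \<open>
A set that contains no point of the cluster of \<open>x\<close> can be deleted without affecting that cluster.
\<close>

lemma linked_avoid:
  assumes "linked A x y" "\<And>w. w \<in> T \<Longrightarrow> \<not> linked A x w"
  shows "linked (A - T) x y"
  using assms(1)
proof (induction rule: linked_induct)
  case refl then show ?case using assms(2) by force
next
  case (step y z)
  have "linked A x z" using step linked_in[OF step(1)] by (blast intro: linked_trans linked_step)
  then have "z \<notin> T" using assms(2) by blast
  then have "linked (A - T) y z" using step by (intro linked_step) (auto dest: linked_in)
  then show ?case using step linked_trans by blast
qed

section \<open>Counting trifurcations\<close>

text \<open>
The combinatorial core of the Burton--Keane argument, by induction on \<open>S\<close>.  Delete a point \<open>x\<close> from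
\<open>S\<close> and from all classes.  Compatibility is preserved, and a triple survives unless \<open>{x}\<close> is one of
its classes.  Two different compatible triples cannot both have the class \<open>{x}\<close>, so that at most
one triple is lost.  The alternative of disjointness accounts for triples that belong to different
clusters.
\<close>

lemma card_compatible_tripartitions_le:
  fixes P :: "'i \<Rightarrow> nat \<Rightarrow> 's set"
  assumes "finite S" "finite I"
    and "\<And>i c. i \<in> I \<Longrightarrow> c < 3 \<Longrightarrow> P i c \<noteq> {} \<and> P i c \<subseteq> S"
    and "\<And>i c d. i \<in> I \<Longrightarrow> c < 3 \<Longrightarrow> d < 3 \<Longrightarrow> c \<noteq> d \<Longrightarrow> P i c \<inter> P i d = {}"
    and "\<And>i j. i \<in> I \<Longrightarrow> j \<in> I \<Longrightarrow> i \<noteq> j \<Longrightarrow>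
      (\<forall>c<3. \<forall>d<3. P i c \<inter> P j d = {}) \<or>
      (\<exists>a<3. \<exists>b<3. \<forall>c<3. (c \<noteq> b \<longrightarrow> P j c \<subseteq> P i a) \<and> (c \<noteq> a \<longrightarrow> P i c \<subseteq> P j b))"
  shows "card I \<le> card S"
  using assms
proof (induction S arbitrary: I P rule: finite_induct)
  case empty
  then have "I = {}" by (metis all_not_in_conv subset_empty zero_less_numeral)
  then show ?case by simp
next
  case (insert x S)
  define J where "J = {i \<in> I. \<exists>c<3. P i c = {x}}"
  have other: "\<exists>d<3. d \<noteq> c \<and> d \<noteq> e" if "c < 3" "e < 3" for c e :: nat
    using that by presburger
  (* J collects the triples that deleting x would destroy; two of them would exclude each
     other. *)
  have J1: "i = j" if ij: "i \<in> J" "j \<in> J" for i j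
  proof (rule ccontr)
    assume ne: "i \<noteq> j"
    obtain c d where c: "c < 3" "P i c = {x}" and d: "d < 3" "P j d = {x}" and I: "i \<in> I" "j \<in> I"
      using ij by (auto simp: J_def)
    have "x \<in> P i c \<inter> P j d" using c d by simp
    then have "\<not> (\<forall>c<3. \<forall>d<3. P i c \<inter> P j d = {})" using c(1) d(1) by blast
    with insert.prems(4)[OF I ne]
    obtain a b where ab: "a < 3" "b < 3"
      and ab': "\<forall>c<3. (c \<noteq> b \<longrightarrow> P j c \<subseteq> P i a) \<and> (c \<noteq> a \<longrightarrow> P i c \<subseteq> P j b)" by blast
    have ab3: "P j c \<subseteq> P i a" if "c < 3" "c \<noteq> b" for c using ab' that by blast
    have ab4: "P i c \<subseteq> P j b" if "c < 3" "c \<noteq> a" for c using ab' that by blast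
    obtain e where e: "e < 3" "e \<noteq> d" "e \<noteq> b" using other d ab by blast
    have 1: "P j e \<subseteq> P i a" "P j e \<noteq> {}" "P j e \<inter> {x} = {}"
      using ab3[OF e(1,3)] insert.prems(2)[OF I(2) e(1)] insert.prems(3)[OF I(2) e(1) d(1) e(2)] d
      by auto
    show False
    proof (cases "b = d")
      case False
      then have "{x} \<subseteq> P i a" using ab3[of d] d by auto
      then have "a = c" using insert.prems(3)[OF I(1) ab(1) c(1)] c by auto
      with 1 c show False by auto
    next
      case True
      have "a \<noteq> c" using 1 c by auto
      then have "a \<noteq> c \<and> P i c \<subseteq> P j b" using ab4[of c] c by auto
      obtain e' where e': "e' < 3" "e' \<noteq> c" "e' \<noteq> a" using other c ab by blast
      then have "P i e' \<subseteq> {x}" using ab4[of e'] True d by auto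
      moreover have "P i e' \<noteq> {}" "P i e' \<inter> {x} = {}"
        using insert.prems(2)[OF I(1) e'(1)] insert.prems(3)[OF I(1) e'(1) c(1) e'(2)] c by auto
      ultimately show False by auto
    qed
  qed
  have finJ: "finite J" using insert.prems(1) by (simp add: J_def)
  have cJ: "card J \<le> 1" using J1 finJ by (simp add: card_le_Suc0_iff_eq)
  have "card (I - J) \<le> card S"
  proof (rule insert.IH[where P = "\<lambda>i c. P i c - {x}"])
    show "finite (I - J)" using insert.prems by simp
  next
    fix i c assume "i \<in> I - J" "c < (3::nat)"
    then show "P i c - {x} \<noteq> {} \<and> P i c - {x} \<subseteq> S"
      using insert.prems(2)[of i c] by (auto simp: J_def)
  next
    fix i c d assume "i \<in> I - J" "c < (3::nat)" "d < (3::nat)" "c \<noteq> d"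
    then show "(P i c - {x}) \<inter> (P i d - {x}) = {}"
      using insert.prems(3)[of i c d] by auto
  next
    fix i j assume "i \<in> I - J" "j \<in> I - J" "i \<noteq> j"
    then have "(\<forall>c<3. \<forall>d<3. P i c \<inter> P j d = {}) \<or>
      (\<exists>a<3. \<exists>b<3. \<forall>c<3. (c \<noteq> b \<longrightarrow> P j c \<subseteq> P i a) \<and> (c \<noteq> a \<longrightarrow> P i c \<subseteq> P j b))"
      using insert.prems(4)[of i j] by auto
    then show "(\<forall>c<3. \<forall>d<3. (P i c - {x}) \<inter> (P j d - {x}) = {}) \<or>
      (\<exists>a<3. \<exists>b<3. \<forall>c<3. (c \<noteq> b \<longrightarrow> P j c - {x} \<subseteq> P i a - {x}) \<and>
         (c \<noteq> a \<longrightarrow> P i c - {x} \<subseteq> P j b - {x}))"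
    proof (elim disjE exE conjE)
      assume "\<forall>c<3. \<forall>d<3. P i c \<inter> P j d = {}"
      then show ?thesis by (intro disjI1) blast
    next
      fix a b assume ab: "a < 3" "b < 3"
        "\<forall>c<3. (c \<noteq> b \<longrightarrow> P j c \<subseteq> P i a) \<and> (c \<noteq> a \<longrightarrow> P i c \<subseteq> P j b)"
      have "\<forall>c<3. (c \<noteq> b \<longrightarrow> P j c - {x} \<subseteq> P i a - {x}) \<and>
         (c \<noteq> a \<longrightarrow> P i c - {x} \<subseteq> P j b - {x})"
        using ab(3) by (meson Diff_mono subset_refl)
      with ab(1,2) show ?thesis
        by (intro disjI2) (rule exI[of _ a], rule conjI, assumption, rule exI[of _ b], rule conjI, assumption+)
    qed
  qed
  moreover have "card I = card (I - J) + card J"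
    using insert.prems(1) finJ by (metis (no_types, lifting) J_def card_Diff_subset card_mono
        le_add_diff_inverse2 mem_Collect_eq subsetI)
  ultimately show ?case using cJ insert.hyps by simp
qed

text \<open>
Removing \<open>T i\<close> separates the three points \<open>s i 0\<close>, \<open>s i 1\<close>, \<open>s i 2\<close> of \<open>S\<close>.  Divide the points of \<open>S\<close>
in the cluster of \<open>T i\<close> into those that remain linked to \<open>s i 0\<close>, those that remain linked to
\<open>s i 1\<close>, and the rest.  For \<open>i \<noteq> j\<close> in the same cluster, the connected set \<open>T j\<close> lies in one class
of \<open>i\<close>, and \<open>T i\<close> lies in one class of \<open>j\<close>.  Every point in one of the other classes of \<open>j\<close> is
linked to \<open>T j\<close> by a path that avoids \<open>T i\<close>, and hence belongs to the same class of \<open>i\<close> as \<open>T j\<close>.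
So the tripartitions are compatible.
\<close>

lemma card_trifurcations_le:
  fixes A :: "'a::metric_space set" and T :: "'i \<Rightarrow> 'a set"
  assumes fin: "finite S" "finite I" and SA: "S \<subseteq> A"
    and TA: "\<And>i. i \<in> I \<Longrightarrow> T i \<subseteq> A" "\<And>i. i \<in> I \<Longrightarrow> T i \<inter> S = {}"
    and disj: "\<And>i j. i \<in> I \<Longrightarrow> j \<in> I \<Longrightarrow> i \<noteq> j \<Longrightarrow> T i \<inter> T j = {}"
    and t: "\<And>i. i \<in> I \<Longrightarrow> t i \<in> T i"
    and Tconn: "\<And>i x y. i \<in> I \<Longrightarrow> x \<in> T i \<Longrightarrow> y \<in> T i \<Longrightarrow> linked (T i) x y"
    and s: "\<And>i c. i \<in> I \<Longrightarrow> c < (3::nat) \<Longrightarrow> s i c \<in> S \<and> linked A (t i) (s i c)"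
    and sep: "\<And>i c d. i \<in> I \<Longrightarrow> c < 3 \<Longrightarrow> d < 3 \<Longrightarrow> c \<noteq> d \<Longrightarrow>
                \<not> linked (A - T i) (s i c) (s i d)"
  shows "card I \<le> card S"
proof -
  define cls where "cls i x = (if linked (A - T i) (s i 0) x then 0
      else if linked (A - T i) (s i 1) x then 1 else 2 :: nat)" for i x
  define P where "P i c = {x \<in> S. linked A (t i) x \<and> cls i x = c}" for i c
  have cls3: "cls i x < 3" for i x by (simp add: cls_def)
  have scls: "cls i (s i c) = c" if "i \<in> I" "c < 3" for i c
  proof -
    have "s i c \<in> A - T i" using s[OF that] SA TA(2)[OF that(1)] by auto
    moreover have "c = 0 \<or> c = 1 \<or> c = 2" using that by auto
    ultimately show ?thesis using sep[OF that(1)] by (auto simp: cls_def)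
  qed
  have cls_eq: "cls i x = cls i y" if "linked (A - T i) x y" for i x y
  proof -
    have "linked (A - T i) z x \<longleftrightarrow> linked (A - T i) z y" for z
      using that by (meson linked_trans linked_sym)
    then show ?thesis by (simp add: cls_def)
  qed
  (* A point whose class at j is not the class of T i reaches T j by a path around T i: up to
     its first visit to T j the path stays in its branch at j, and this branch does not contain
     T i. *)
  have key: "linked (A - T i) x (t j)"
    if ij: "i \<in> I" "j \<in> I" "i \<noteq> j" and x: "x \<in> P j c" "c \<noteq> cls j (t i)" for i j x c
  proof -
    have x': "x \<in> S" "linked A x (t j)" "cls j x = c" using x linked_sym[of A "t j" x] by (auto simp: P_def)
    have xT: "x \<in> - T j" using TA(2)[OF ij(2)] x'(1) by auto
    have tT: "t j \<notin> - T j" using t[OF ij(2)] by simp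
    obtain u v where uv: "linked (A \<inter> - T j) x u" "v \<in> A - - T j" "dist u v < 1"
      by (rule linked_first_exit[OF x'(2) xT tT])
    have D: "A \<inter> - T j = A - T j" by (rule Diff_eq[symmetric])
    have "\<not> linked (A - T j) x w" if w: "w \<in> T i" for w
    proof
      assume "linked (A - T j) x w"
      moreover have "linked (A - T j) w (t i)"
        by (rule linked_mono[OF Tconn[OF ij(1) w t[OF ij(1)]]]) (use TA(1)[OF ij(1)] disj[OF ij] in auto)
      ultimately have "cls j x = cls j (t i)" using cls_eq linked_trans by blast
      with x' x show False by simp
    qed
    then have "linked (A - T j - T i) x u" using uv(1) D linked_avoid[of "A - T j" x u "T i"] by simp
    then have 1: "linked (A - T i) x u" by (rule linked_mono) auto
    have "v \<in> T j" using uv by auto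
    then have "linked (A - T i) v (t j)"
      by (intro linked_mono[OF Tconn[OF ij(2) _ t[OF ij(2)]]]) (use TA(1)[OF ij(2)] disj[OF ij] in auto)
    moreover from this have "linked (A - T i) u v" using 1 uv(3) by (meson linked_in linked_step)
    ultimately show ?thesis using 1 linked_trans by blast
  qed
  show ?thesis
  proof (rule card_compatible_tripartitions_le[OF fin, of P])
    fix i c assume "i \<in> I" "c < (3::nat)"
    then have "s i c \<in> P i c" using s[of i c] scls[of i c] by (simp add: P_def)
    then show "P i c \<noteq> {} \<and> P i c \<subseteq> S" by (auto simp: P_def)
  next
    fix i j assume ij: "i \<in> I" "j \<in> I" "i \<noteq> j"
    show "(\<forall>c<3. \<forall>d<3. P i c \<inter> P j d = {}) \<or>
      (\<exists>a<3. \<exists>b<3. \<forall>c<3. (c \<noteq> b \<longrightarrow> P j c \<subseteq> P i a) \<and> (c \<noteq> a \<longrightarrow> P i c \<subseteq> P j b))"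
    proof (cases "linked A (t i) (t j)")
      case False
      then have "\<forall>c<3. \<forall>d<3. P i c \<inter> P j d = {}"
        unfolding P_def by (blast intro: linked_sym linked_trans)
      then show ?thesis ..
    next
      case True
      have *: "P j c \<subseteq> P i (cls i (t j))" if "i \<in> I" "j \<in> I" "i \<noteq> j" "c \<noteq> cls j (t i)"
        "linked A (t i) (t j)" for i j c
      proof
        fix x assume x: "x \<in> P j c"
        have "cls i x = cls i (t j)" using key[OF that(1-3) x that(4)] by (rule cls_eq)
        then show "x \<in> P i (cls i (t j))" using x linked_trans[OF that(5), of x] by (simp add: P_def)
      qed
      show ?thesis
        using *[OF ij _ True] *[OF ij(2,1) ij(3)[symmetric] _ linked_sym[OF True]] cls3 by blast
    qed
  qed (auto simp: P_def)
qed

section \<open>Clusters and components of the Boolean model\<close>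

definition cluster_hull :: "'a::euclidean_space set \<Rightarrow> 'a \<Rightarrow> 'a set" where
  "cluster_hull X x = (\<Union>y\<in>{y. linked X x y}. ball y (1 / 2))"

lemma dist_less_1_if_balls_meet:
  fixes x y :: "'a::metric_space"
  assumes "w \<in> ball x (1 / 2)" "w \<in> ball y (1 / 2)"
  shows "dist x y < 1"
  using assms dist_triangle_less_add[of x w "1/2" y "1/2"] by (simp add: dist_commute)

text \<open>
The balls around the cluster of \<open>x\<close> and the balls around all other points of \<open>A\<close> form two disjoint
open sets, and a connected set cannot meet both.
\<close>

lemma linked_if_connected:
  fixes A :: "'a::euclidean_space set"
  assumes S: "connected S" "S \<subseteq> boolean_model A" and xy: "x \<in> A" "y \<in> A"
    and meet: "ball x (1 / 2) \<inter> S \<noteq> {}" "ball y (1 / 2) \<inter> S \<noteq> {}"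
  shows "linked A x y"
proof (rule ccontr)
  assume n: "\<not> linked A x y"
  define U where "U = (\<Union>z\<in>{z. linked A x z}. ball z (1 / 2))"
  define V where "V = (\<Union>z\<in>{z \<in> A. \<not> linked A x z}. ball z (1 / 2))"
  have "open U" "open V" by (auto simp: U_def V_def)
  have "U \<inter> V = {}"
  proof (rule ccontr)
    assume "U \<inter> V \<noteq> {}"
    then obtain w z z' where w: "linked A x z" "w \<in> ball z (1 / 2)"
      "z' \<in> A" "\<not> linked A x z'" "w \<in> ball z' (1 / 2)"
      by (auto simp: U_def V_def)
    then have "linked A z z'"
      using linked_in[OF w(1)] dist_less_1_if_balls_meet by (blast intro: linked_step)
    with w show False using linked_trans by blast
  qed
  moreover have "S \<subseteq> U \<union> V"
  proof
    fix w assume "w \<in> S"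
    then obtain z where "z \<in> A" "w \<in> ball z (1 / 2)" using S(2) by (auto simp: boolean_model_def)
    then show "w \<in> U \<union> V" by (cases "linked A x z") (auto simp: U_def V_def)
  qed
  ultimately have "U \<inter> S = {} \<or> V \<inter> S = {}"
    using connectedD[OF S(1) \<open>open U\<close> \<open>open V\<close>] by blast
  moreover have "ball x (1 / 2) \<subseteq> U" "ball y (1 / 2) \<subseteq> V"
    using n xy linked_refl[of A x] unfolding U_def V_def by blast+
  ultimately show False using meet by blast
qed

lemma connected_cluster_hull: "connected (cluster_hull X x)"
proof -
  define H where "H = cluster_hull X x"
  have sub: "ball y (1 / 2) \<subseteq> H" if "linked X x y" for y
    using that unfolding H_def cluster_hull_def by blast
  have in_ball: "connected_component H y p" if "linked X x y" "p \<in> ball y (1 / 2)" for y p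
    unfolding connected_component_def
    by (rule exI[of _ "ball y (1 / 2)"]) (use sub[OF that(1)] that in auto)
  have c: "connected_component H x y" if "linked X x y" for y
    using that
  proof (induction rule: linked_induct)
    case refl
    then show ?case using sub[of x] by (intro connected_component_refl) auto
  next
    case (step y z)
    have xz: "linked X x z"
      using step linked_in[OF step(1)] by (blast intro: linked_trans linked_step)
    have "midpoint y z \<in> ball y (1 / 2)" "midpoint y z \<in> ball z (1 / 2)"
      using step(3) by (auto simp: dist_midpoint)
    then have "connected_component H y (midpoint y z)" "connected_component H z (midpoint y z)"
      using in_ball[OF step(1)] in_ball[OF xz] by auto
    then show ?case using step.IH
      by (meson connected_component_sym connected_component_trans)
  qed
  have x: "connected_component H x p" if p: "p \<in> H" for p
  proof -
    obtain y where "linked X x y" "p \<in> ball y (1 / 2)" using p by (auto simp: H_def cluster_hull_def)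
    then show ?thesis using c in_ball connected_component_trans by blast
  qed
  then show ?thesis
    unfolding connected_iff_connected_component H_def[symmetric]
    by (meson connected_component_sym connected_component_trans)
qed

lemma cluster_hull_subset: "cluster_hull X x \<subseteq> boolean_model X"
  by (auto simp: cluster_hull_def boolean_model_def dest: linked_in)

lemma in_cluster_hull: "x \<in> X \<Longrightarrow> x \<in> cluster_hull X x"
  unfolding cluster_hull_def by (intro UN_I[of x]) auto

lemma open_cluster_hull: "open (cluster_hull X x)"
  by (auto simp: cluster_hull_def)

lemma connected_subset_cluster_hull:
  assumes "connected S" "S \<subseteq> boolean_model X" "x \<in> X" "ball x (1 / 2) \<inter> S \<noteq> {}"
  shows "S \<subseteq> cluster_hull X x"
proof
  fix p assume p: "p \<in> S"
  then obtain z where z: "z \<in> X" "p \<in> ball z (1 / 2)" using assms(2) by (auto simp: boolean_model_def)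
  then have "linked X x z" using assms p by (intro linked_if_connected[of S]) auto
  then show "p \<in> cluster_hull X x" using z unfolding cluster_hull_def by blast
qed

text \<open>
This turns statements on the topology of the Boolean model into statements on the link graph.
\<close>

lemma component_eq_cluster_hull:
  assumes "x \<in> X"
  shows "connected_component_set (boolean_model X) x = cluster_hull X x"
proof
  have x: "x \<in> boolean_model X" using assms by (force simp: boolean_model_def)
  show "connected_component_set (boolean_model X) x \<subseteq> cluster_hull X x"
  proof (rule connected_subset_cluster_hull[OF _ _ assms])
    have "x \<in> ball x (1 / 2) \<inter> connected_component_set (boolean_model X) x" using x by simp
    then show "ball x (1 / 2) \<inter> connected_component_set (boolean_model X) x \<noteq> {}" by blast
  qed (simp_all add: connected_component_subset)
  show "cluster_hull X x \<subseteq> connected_component_set (boolean_model X) x"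
    by (intro connected_component_maximal in_cluster_hull assms connected_cluster_hull cluster_hull_subset)
qed

lemma components_boolean_model: "components (boolean_model X) = cluster_hull X ` X"
proof (intro equalityI subsetI)
  fix K assume "K \<in> components (boolean_model X)"
  then obtain p where p: "p \<in> boolean_model X" "K = connected_component_set (boolean_model X) p"
    by (auto simp: components_iff)
  then obtain x where x: "x \<in> X" "p \<in> ball x (1 / 2)" by (auto simp: boolean_model_def)
  have "p \<in> cluster_hull X x" unfolding cluster_hull_def using x by (intro UN_I[of x]) auto
  then have "p \<in> connected_component_set (boolean_model X) x"
    using component_eq_cluster_hull[OF x(1)] by simp
  then have "K = cluster_hull X x"
    using p x connected_component_eq component_eq_cluster_hull by metis
  then show "K \<in> cluster_hull X ` X" using x by simp
next
  fix K assume "K \<in> cluster_hull X ` X"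
  then obtain x where x: "x \<in> X" "K = cluster_hull X x" by auto
  then have "x \<in> boolean_model X" by (force simp: boolean_model_def)
  then show "K \<in> components (boolean_model X)"
    using x component_eq_cluster_hull unfolding components_def by blast
qed

lemma finite_config_Int: "X \<in> configurations \<Longrightarrow> bounded B \<Longrightarrow> finite (X \<inter> B)"
  by (simp add: configurations_def)

lemma config_subset: "X \<in> configurations \<Longrightarrow> Y \<subseteq> X \<Longrightarrow> Y \<in> configurations"
  unfolding configurations_def by (simp, meson finite_subset Int_mono subset_refl)

text \<open>
A bounded cluster is finite because configurations are locally finite.
\<close>

lemma unbounded_cluster_hull_iff:
  assumes "X \<in> configurations"
  shows "\<not> bounded (cluster_hull X x) \<longleftrightarrow> percolates X x"
proof
  assume "\<not> bounded (cluster_hull X x)"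
  then show "percolates X x"
    unfolding percolates_def cluster_hull_def by (auto intro!: bounded_UN)
next
  assume p: "percolates X x"
  show "\<not> bounded (cluster_hull X x)"
  proof
    assume b: "bounded (cluster_hull X x)"
    have "{y. linked X x y} \<subseteq> X \<inter> cluster_hull X x"
      by (force simp: cluster_hull_def dest: linked_in)
    then show False using p finite_config_Int[OF assms b] finite_subset
      unfolding percolates_def by blast
  qed
qed

lemma cluster_hull_eq_iff:
  assumes "x \<in> X" "y \<in> X"
  shows "cluster_hull X x = cluster_hull X y \<longleftrightarrow> linked X x y"
proof
  assume e: "cluster_hull X x = cluster_hull X y"
  show "linked X x y"
    by (rule linked_if_connected[OF connected_cluster_hull cluster_hull_subset assms, where x1 = x])
      (use in_cluster_hull[OF assms(1)] in_cluster_hull[OF assms(2)] e in \<open>force+\<close>)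
next
  assume "linked X x y"
  then have "{z. linked X x z} = {z. linked X y z}" by (meson linked_sym linked_trans)
  then show "cluster_hull X x = cluster_hull X y" by (simp add: cluster_hull_def)
qed

lemma unbounded_components_eq:
  assumes "X \<in> configurations"
  shows "unbounded_components X = cluster_hull X ` {x. percolates X x}"
  unfolding unbounded_components_def components_boolean_model
  using unbounded_cluster_hull_iff[OF assms] percolates_in by blast

lemma unique_component_iff:
  assumes "X \<in> configurations"
  shows "(\<exists>!K. K \<in> unbounded_components X) \<longleftrightarrow>
    (\<exists>x. percolates X x) \<and> one_cluster X"
proof -
  have "cluster_hull X x = cluster_hull X y \<longleftrightarrow> linked X x y" if "percolates X x" "percolates X y" for x y
    using that by (intro cluster_hull_eq_iff percolates_in)
  moreover have "(\<exists>!K. K \<in> h ` S) \<longleftrightarrow> (\<exists>x. x \<in> S) \<and> (\<forall>x\<in>S. \<forall>y\<in>S. h x = h y)"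
    for h :: "'a \<Rightarrow> 'a set" and S
  proof (rule iffI)
    assume "\<exists>!K. K \<in> h ` S"
    then obtain K where K: "K \<in> h ` S" "\<And>K'. K' \<in> h ` S \<Longrightarrow> K' = K" by (elim ex1E) metis
    show "(\<exists>x. x \<in> S) \<and> (\<forall>x\<in>S. \<forall>y\<in>S. h x = h y)"
      using K(1) K(2)[OF imageI] by auto
  next
    assume "(\<exists>x. x \<in> S) \<and> (\<forall>x\<in>S. \<forall>y\<in>S. h x = h y)"
    then obtain x where "x \<in> S" "\<forall>y\<in>S. h y = h x" by blast
    then show "\<exists>!K. K \<in> h ` S" by (intro ex1I[of _ "h x"]) blast+
  qed
  ultimately show ?thesis unfolding unbounded_components_eq[OF assms] by simp
qed

lemma infinite_cluster_eq:
  assumes "X \<in> configurations" "\<exists>!K. K \<in> unbounded_components X" "percolates X x"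
  shows "infinite_cluster X = cluster_hull X x"
  unfolding infinite_cluster_def using assms unbounded_components_eq
  by (intro the1_equality) auto

lemma Omega0_iff:
  "X \<in> Omega0 \<longleftrightarrow> X \<in> configurations \<and>
     one_cluster X \<and>
     (\<exists>x\<in>ball 0 (1 / 2). percolates X x)"
proof
  assume o: "X \<in> Omega0"
  then have c: "X \<in> configurations" and u: "\<exists>!K. K \<in> unbounded_components X"
    and 0: "0 \<in> infinite_cluster X" by (auto simp: Omega0_def)
  note u' = u[unfolded unique_component_iff[OF c]]
  obtain x where x: "percolates X x" using u' by blast
  have "0 \<in> cluster_hull X x" using 0 infinite_cluster_eq[OF c u x] by simp
  then obtain y where "linked X x y" "0 \<in> ball y (1 / 2)" by (auto simp: cluster_hull_def)
  then have "percolates X y" "y \<in> ball 0 (1 / 2)" using percolates_linked x by (auto simp: dist_commute)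
  then show "X \<in> configurations \<and>
     one_cluster X \<and>
     (\<exists>x\<in>ball 0 (1 / 2). percolates X x)"
    using c u' by blast
next
  assume r: "X \<in> configurations \<and>
     one_cluster X \<and>
     (\<exists>x\<in>ball 0 (1 / 2). percolates X x)"
  then obtain x where x: "x \<in> ball 0 (1 / 2)" "percolates X x" by blast
  have c: "X \<in> configurations" using r by blast
  have u: "\<exists>!K. K \<in> unbounded_components X"
    unfolding unique_component_iff[OF c] using r by blast
  have "0 \<in> ball x (1 / 2)" "linked X x x" using x percolates_in[OF x(2)] by (auto simp: dist_commute)
  then have "0 \<in> cluster_hull X x" unfolding cluster_hull_def by blast
  then show "X \<in> Omega0" using c u infinite_cluster_eq[OF c u x(2)] by (simp add: Omega0_def)
qed

lemma Omega0_cluster: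
  assumes "X \<in> Omega0"
  obtains x where "percolates X x" "x \<in> ball 0 (1 / 2)" "infinite_cluster X = cluster_hull X x"
proof -
  have "X \<in> configurations" "\<exists>!K. K \<in> unbounded_components X" using assms by (auto simp: Omega0_def)
  moreover obtain x where "x \<in> ball 0 (1 / 2)" "percolates X x" using assms Omega0_iff by blast
  ultimately show ?thesis using that[of x] infinite_cluster_eq[of X x] by simp
qed

abbreviation near_boundary :: "real \<Rightarrow> 'a::euclidean_space set set" where
  "near_boundary \<epsilon> \<equiv> {X \<in> Omega0. boundary_dist X < \<epsilon>}"

abbreviation near_boundary_pos :: "real \<Rightarrow> 'a::euclidean_space set set" where
  "near_boundary_pos \<epsilon> \<equiv> {X \<in> Omega0. 0 < boundary_dist X \<and> boundary_dist X < \<epsilon>}"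

lemma infdist_Compl_eq_infdist_frontier:
  fixes K :: "'a::euclidean_space set"
  assumes "open K" "a \<in> K"
  shows "infdist a (- K) = infdist a (frontier K)"
proof (cases "K = UNIV")
  case True then show ?thesis by simp
next
  case False
  then have ne: "- K \<noteq> {}" "frontier K \<noteq> {}"
    using assms frontier_eq_empty[of K] by auto
  have sub: "frontier K \<subseteq> - K"
    using assms(1) by (auto simp: frontier_def interior_open)
  show ?thesis
  proof (rule antisym)
    show "infdist a (- K) \<le> infdist a (frontier K)" by (rule infdist_mono[OF sub ne(2)])
    have "infdist a (frontier K) \<le> dist a z" if z: "z \<in> - K" for z
    proof -
      have "closed_segment a z \<inter> frontier K \<noteq> {}"
        using z assms by (intro connected_Int_frontier) auto
      then obtain w where w: "w \<in> closed_segment a z" "w \<in> frontier K" by auto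
      then have "dist a w \<le> dist a z"
        using dist_in_closed_segment[OF w(1)] by (simp add: dist_commute)
      then show ?thesis using infdist_le[OF w(2), of a] by linarith
    qed
    then show "infdist a (frontier K) \<le> infdist a (- K)"
      unfolding infdist_notempty[OF ne(1)] by (intro cINF_greatest ne(1)) auto
  qed
qed

lemma Omega0_boundary_dist_frontier:
  assumes "X \<in> Omega0"
  shows "boundary_dist X = infdist 0 (frontier (infinite_cluster X))"
proof -
  obtain x where x: "infinite_cluster X = cluster_hull X x" using Omega0_cluster[OF assms] by blast
  have "0 \<in> infinite_cluster X" using assms by (simp add: Omega0_def)
  then show ?thesis unfolding boundary_dist_def x
    by (intro infdist_Compl_eq_infdist_frontier open_cluster_hull)
qed

lemma distance_less_iff:
  assumes "infinite_cluster X \<noteq> UNIV"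
  shows "boundary_dist X < \<epsilon> \<longleftrightarrow> (\<exists>z. z \<notin> infinite_cluster X \<and> norm z < \<epsilon>)"
proof -
  have ne: "- infinite_cluster X \<noteq> {}" using assms by auto
  show ?thesis unfolding boundary_dist_def infdist_notempty[OF ne]
    by (subst cINF_less_iff) (use ne in \<open>auto intro!: bdd_belowI[of _ 0]\<close>)
qed

lemma boundary_dist_pos:
  assumes "X \<in> Omega0" "infinite_cluster X \<noteq> UNIV"
  shows "0 < boundary_dist X"
proof -
  obtain x where x: "infinite_cluster X = cluster_hull X x" using Omega0_cluster[OF assms(1)] by blast
  have "0 \<in> infinite_cluster X" using assms by (simp add: Omega0_def)
  moreover have "closed (- infinite_cluster X)" using open_cluster_hull x by auto
  ultimately have "infdist 0 (- infinite_cluster X) \<noteq> 0"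
    using in_closed_iff_infdist_zero[of "- infinite_cluster X" 0] assms(2) by auto
  then show ?thesis unfolding boundary_dist_def using infdist_nonneg[of 0 "- infinite_cluster X"] by linarith
qed

lemma cball_subset_cluster_iff:
  assumes "X \<in> Omega0" "0 \<le> r"
  shows "cball 0 r \<subseteq> infinite_cluster X \<longleftrightarrow> cball 0 r \<subseteq> boolean_model X"
proof -
  obtain x where x: "percolates X x" "x \<in> ball 0 (1 / 2)" "infinite_cluster X = cluster_hull X x"
    using Omega0_cluster[OF assms(1)] by blast
  have "0 \<in> ball x (1 / 2) \<inter> cball 0 r" using x(2) assms(2) by (simp add: dist_commute)
  then have "ball x (1 / 2) \<inter> cball 0 r \<noteq> {}" by blast
  then show ?thesis
    using connected_subset_cluster_hull[of "cball 0 r" X x] percolates_in[OF x(1)]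
      cluster_hull_subset[of X x] x(3) convex_connected[OF convex_cball]
    by blast
qed

text \<open>
If \<open>z\<close> is outside the cluster with \<open>|z| < \<epsilon>\<close>, then the point \<open>x\<close> whose ball covers the origin
satisfies \<open>1/2 \<le> |x - z| < |x| + \<epsilon>\<close>.
\<close>

lemma point_near_boundary:
  assumes "X \<in> Omega0" "infinite_cluster X \<noteq> UNIV" "boundary_dist X < \<epsilon>"
  shows "X \<inter> (ball 0 (1 / 2) - cball 0 (1 / 2 - \<epsilon>)) \<noteq> {}"
proof -
  obtain x where x: "percolates X x" "x \<in> ball 0 (1 / 2)" "infinite_cluster X = cluster_hull X x"
    using Omega0_cluster[OF assms(1)] by blast
  obtain z where z: "z \<notin> infinite_cluster X" "norm z < \<epsilon>"
    using assms(2,3) distance_less_iff by blast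
  have "linked X x x" using percolates_in[OF x(1)] by simp
  then have "z \<notin> ball x (1 / 2)" using z(1) x(3) by (auto simp: cluster_hull_def)
  then have "1 / 2 \<le> norm x + norm z"
    using norm_triangle_ineq4[of x z] by (simp add: dist_norm)
  then show ?thesis using x z percolates_in[OF x(1)] by auto
qed

section \<open>Removing and refilling a ball\<close>

lemma linked_outside_touches:
  fixes X :: "'a::real_normed_vector set"
  assumes "linked X y x" "y \<notin> ball 0 R" "x \<in> ball 0 R"
  obtains u where "linked (X - ball 0 R) y u" "norm u < R + 1"
proof -
  have "y \<in> - ball 0 R" "x \<notin> - ball 0 R" using assms by auto
  then obtain u v where uv: "linked (X \<inter> - ball 0 R) y u" "v \<in> X - - ball 0 R" "dist u v < 1"
    using linked_first_exit[OF assms(1)] by metis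
  have "norm u \<le> norm v + dist u v" using norm_triangle_sub[of u v] by (simp add: dist_norm)
  moreover have "norm v < R" using uv by auto
  ultimately have "norm u < R + 1" using uv(3) by linarith
  moreover have "linked (X - ball 0 R) y u" using uv(1) by (simp add: Diff_eq)
  ultimately show ?thesis using that by blast
qed

text \<open>
Each remaining point of the cluster is still linked, outside the ball, to a point at distance less
than 1 from the ball.  There are only finitely many such points, so that one of them is linked to
infinitely many others.
\<close>

lemma percolates_outside_ball:
  assumes X: "X \<in> configurations" and x: "percolates X x" "x \<in> ball 0 R"
  obtains y where "percolates (X - ball 0 R) y" "norm y < R + 1" "linked X x y"
proof -
  define D where "D = {y. linked X x y} - ball 0 R"
  have "{y. linked X x y} \<subseteq> D \<union> (X \<inter> ball 0 R)" by (auto simp: D_def dest: linked_in)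
  moreover have "finite (X \<inter> ball 0 R)" by (rule finite_config_Int[OF X]) simp
  ultimately have infD: "infinite D" using x(1) unfolding percolates_def
    by (meson finite_Un finite_subset)
  have "\<exists>u. linked (X - ball 0 R) y u \<and> norm u < R + 1" if "y \<in> D" for y
    using linked_outside_touches[of X y x R] linked_sym[of X x y] that x(2) unfolding D_def by blast
  then obtain u where u: "\<And>y. y \<in> D \<Longrightarrow> linked (X - ball 0 R) y (u y) \<and> norm (u y) < R + 1"
    by metis
  have "u ` D \<subseteq> X \<inter> ball 0 (R + 1)" using u by (auto dest: linked_in)
  then have "finite (u ` D)" using finite_config_Int[OF X bounded_ball] finite_subset by blast
  then obtain a where a: "a \<in> D" "infinite {b \<in> D. u b = u a}"
    using pigeonhole_infinite[OF infD] by blast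
  have "{b \<in> D. u b = u a} \<subseteq> {b. linked (X - ball 0 R) (u a) b}"
    using u linked_sym by fastforce
  then have "percolates (X - ball 0 R) (u a)"
    using a(2) infinite_super unfolding percolates_def by blast
  moreover have "linked X x (u a)"
  proof (rule linked_trans[of X x a])
    show "linked X x a" using a(1) by (simp add: D_def)
    show "linked X a (u a)" using u[OF a(1)] linked_mono[of "X - ball 0 R" a "u a" X] by blast
  qed
  ultimately show ?thesis using that u[OF a(1)] by blast
qed

text \<open>
An infinite cluster either has a point in the ball, where all points are linked to each other, or it
avoids the ball.  In the second case it comes within the radius \<open>r\<close>, where it touches a point in
the ball.
\<close>

lemma unique_cluster_after_filling:
  fixes X :: "'a::euclidean_space set"
  assumes conn: "\<And>x y. x \<in> X \<inter> ball 0 R \<Longrightarrow> y \<in> X \<inter> ball 0 R \<Longrightarrow> linked X x y"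
    and t: "t \<in> X \<inter> ball 0 R"
    and adj: "\<And>v. v \<in> X - ball 0 R \<Longrightarrow> norm v < r \<Longrightarrow> \<exists>p\<in>X \<inter> ball 0 R. dist v p < 1"
    and ex: "\<exists>x. percolates (X - ball 0 R) x"
    and near: "\<And>x. percolates (X - ball 0 R) x \<Longrightarrow>
      \<exists>y. norm y < r \<and> linked (X - ball 0 R) x y"
  shows "percolates X t" "\<And>x. percolates X x \<Longrightarrow> linked X x t"
proof -
  have *: "linked X x t" if px: "percolates (X - ball 0 R) x" for x
  proof -
    obtain y where y: "norm y < r" "linked (X - ball 0 R) x y" using near[OF px] by blast
    obtain p where p: "p \<in> X \<inter> ball 0 R" "dist y p < 1" using adj[of y] y linked_in by blast
    have "linked X x y" using y(2) linked_mono by blast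
    moreover have "linked X y p" using linked_in[OF y(2)] p by (intro linked_step) auto
    ultimately show ?thesis using conn[OF p(1) t] linked_trans by blast
  qed
  show "percolates X t" using ex * percolates_mono percolates_linked by (metis Diff_subset)
  show "linked X x t" if px: "percolates X x" for x
  proof (cases "\<exists>z\<in>ball 0 R. linked X x z")
    case True
    then show ?thesis using conn t linked_in linked_trans by (metis IntI)
  next
    case False
    then have "{y. linked X x y} \<subseteq> {y. linked (X - ball 0 R) x y}"
      using linked_avoid by blast
    then have "percolates (X - ball 0 R) x" using px infinite_super unfolding percolates_def by blast
    then show ?thesis by (rule *)
  qed
qed

definition three_clusters :: "'a::metric_space set \<Rightarrow> 'a set \<Rightarrow> bool" where
  "three_clusters A U \<longleftrightarrow> (\<exists>x y z. x \<in> U \<and> y \<in> U \<and> z \<in> U \<and>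
     percolates A x \<and> percolates A y \<and> percolates A z \<and>
     \<not> linked A x y \<and> \<not> linked A y z \<and> \<not> linked A x z)"

text \<open>
Each of the three unbounded clusters next to a trifurcation ball inside the box \<open>Q\<close> has to leave
\<open>Q\<close>, and steps of length less than 1 cannot jump over \<open>Q' - Q\<close>.  So each of them contains a point
of the layer, and \<open>card_trifurcations_le\<close> applies.
\<close>

lemma card_trifurcation_balls_le:
  assumes X: "X \<in> configurations" and I: "finite I"
    and disj: "\<And>v w. v \<in> I \<Longrightarrow> w \<in> I \<Longrightarrow> v \<noteq> w \<Longrightarrow> ball v R \<inter> ball w R = {}"
    and conn: "\<And>v x y. v \<in> I \<Longrightarrow> x \<in> X \<inter> ball v R \<Longrightarrow> y \<in> X \<inter> ball v R \<Longrightarrow>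
      linked (X \<inter> ball v R) x y"
    and adj: "\<And>v x. v \<in> I \<Longrightarrow> x \<in> X - ball v R \<Longrightarrow> dist v x < r \<Longrightarrow>
      \<exists>p\<in>X \<inter> ball v R. dist x p < 1"
    and three: "\<And>v. v \<in> I \<Longrightarrow> three_clusters (X - ball v R) (ball v r)"
    and Q: "\<And>v. v \<in> I \<Longrightarrow> ball v R \<subseteq> Q" "bounded Q"
    and Q': "\<And>u w. u \<in> Q \<Longrightarrow> dist u w < 1 \<Longrightarrow> w \<in> Q'" "bounded Q'"
  shows "card I \<le> card (X \<inter> (Q' - Q))"
proof -
  have ex: "\<exists>t\<in>X \<inter> ball v R. \<exists>s. \<forall>c<3::nat. s c \<in> X \<inter> (Q' - Q) \<and> linked X t (s c) \<and>
     (\<forall>d<3. c \<noteq> d \<longrightarrow> \<not> linked (X - ball v R) (s c) (s d))" if v: "v \<in> I" for v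
  proof -
    let ?O = "X - ball v R"
    obtain x y z where xyz: "x \<in> ball v r" "y \<in> ball v r" "z \<in> ball v r"
     "percolates ?O x" "percolates ?O y" "percolates ?O z"
     "\<not> linked ?O x y" "\<not> linked ?O y z" "\<not> linked ?O x z"
      using three[OF v] unfolding three_clusters_def by blast
    have pt: "\<exists>p\<in>X \<inter> ball v R. dist x p < 1" if "x \<in> ball v r" "percolates ?O x" for x
      using adj[OF v, of x] percolates_in[OF that(2)] that(1) by auto
    obtain t where t: "t \<in> X \<inter> ball v R" using pt[of x] xyz by blast
    have *: "\<exists>s\<in>X \<inter> (Q' - Q). linked X t s \<and> linked ?O x s"
      if x: "x \<in> ball v r" "percolates ?O x" for x
    proof -
      obtain p where p: "p \<in> X \<inter> ball v R" "dist x p < 1" using pt[OF x] by blast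
      have xin: "x \<in> ?O" using percolates_in[OF x(2)] .
      have "linked X t p" using linked_mono[OF conn[OF v t p(1)]] by blast
      moreover have "linked X p x" using p xin by (intro linked_step) (auto simp: dist_commute)
      ultimately have tx: "linked X t x" by (rule linked_trans)
      have "\<exists>s\<in>Q' - Q. linked ?O x s"
      proof (cases "x \<in> Q")
        case False
        have "p \<in> Q" using p Q(1)[OF v] by auto
        then have "x \<in> Q'" using Q'(1)[of p x] p by (simp add: dist_commute)
        then show ?thesis using False xin by (intro bexI[of _ x]) auto
      next
        case True
        have "\<exists>y. linked ?O x y \<and> y \<notin> Q"
        proof (rule ccontr)
          assume "\<not> ?thesis"
          then have "{y. linked ?O x y} \<subseteq> X \<inter> Q" by (auto dest: linked_in)
          then show False using x(2) finite_config_Int[OF X Q(2)] finite_subset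
            unfolding percolates_def by blast
        qed
        then obtain y where y: "linked ?O x y" "y \<notin> Q" by blast
        obtain u w where uw: "linked (?O \<inter> Q) x u" "w \<in> ?O - Q" "dist u w < 1"
          by (rule linked_first_exit[OF y(1) True y(2)])
        have u: "u \<in> Q" "u \<in> ?O" using linked_in[OF uw(1)] by auto
        have "linked ?O x u" by (rule linked_mono[OF uw(1)]) auto
        moreover have "linked ?O u w" using u uw by (intro linked_step) auto
        ultimately have "linked ?O x w" by (rule linked_trans)
        moreover have "w \<in> Q' - Q" using Q'(1)[OF u(1) uw(3)] uw(2) by auto
        ultimately show ?thesis by blast
      qed
      then obtain s where s: "s \<in> Q' - Q" "linked ?O x s" by blast
      have "linked X x s" by (rule linked_mono[OF s(2)]) auto
      then show ?thesis using s tx linked_trans linked_in by (metis IntI)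
    qed
    obtain a where a: "a \<in> X \<inter> (Q' - Q)" "linked X t a" "linked ?O x a" using *[of x] xyz by blast
    obtain b where b: "b \<in> X \<inter> (Q' - Q)" "linked X t b" "linked ?O y b" using *[of y] xyz by blast
    obtain e where e: "e \<in> X \<inter> (Q' - Q)" "linked X t e" "linked ?O z e" using *[of z] xyz by blast
    have n: "\<not> linked ?O a b" "\<not> linked ?O b e" "\<not> linked ?O a e"
      using a b e xyz(7-9) by (meson linked_sym linked_trans)+
    then have n': "\<not> linked ?O b a" "\<not> linked ?O e b" "\<not> linked ?O e a"
      using linked_sym by blast+
    define s where "s c = (if c = 0 then a else if c = 1 then b else e)" for c :: nat
    have "\<forall>c<3::nat. s c \<in> X \<inter> (Q' - Q) \<and> linked X t (s c) \<and>
     (\<forall>d<3. c \<noteq> d \<longrightarrow> \<not> linked ?O (s c) (s d))"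
      using a b e n n' by (simp add: s_def)
    then show ?thesis using t by blast
  qed
  then obtain t where t: "\<And>v. v \<in> I \<Longrightarrow> t v \<in> X \<inter> ball v R \<and> (\<exists>s. \<forall>c<3::nat. s c \<in> X \<inter> (Q' - Q) \<and> linked X (t v) (s c) \<and>
     (\<forall>d<3. c \<noteq> d \<longrightarrow> \<not> linked (X - ball v R) (s c) (s d)))" by metis
  then obtain s where s: "\<And>v. v \<in> I \<Longrightarrow> \<forall>c<3::nat. s v c \<in> X \<inter> (Q' - Q) \<and> linked X (t v) (s v c) \<and>
     (\<forall>d<3. c \<noteq> d \<longrightarrow> \<not> linked (X - ball v R) (s v c) (s v d))" by metis
  show ?thesis
  proof (rule card_trifurcations_le[where A = X and T = "\<lambda>v. X \<inter> ball v R" and t = t and s = s])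
    show "finite (X \<inter> (Q' - Q))" using finite_config_Int[OF X] Q'(2) bounded_diff by blast
    show "X \<inter> ball v R \<inter> (X \<inter> (Q' - Q)) = {}" if "v \<in> I" for v using Q(1)[OF that] by auto
    show "X \<inter> ball v R \<inter> (X \<inter> ball w R) = {}" if "v \<in> I" "w \<in> I" "v \<noteq> w" for v w
      using disj[OF that] by auto
    show "linked (X \<inter> ball v R) x y" if "v \<in> I" "x \<in> X \<inter> ball v R" "y \<in> X \<inter> ball v R" for v x y
      using conn that .
    show "\<not> linked (X - X \<inter> ball v R) (s v c) (s v d)" if "v \<in> I" "c < 3" "d < 3" "c \<noteq> d" for v c d
    proof -
      have "X - X \<inter> ball v R = X - ball v R" by auto
      then show ?thesis using s[OF that(1)] that by simp
    qed
  qed (use I t s in auto)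
qed

section \<open>Void events\<close>

text \<open>
An enumeration of some countable basis of the topology.  Existential statements on points of a
configuration become countable unions over the members of the basis that the configuration hits.
\<close>

definition base :: "nat \<Rightarrow> 'a::euclidean_space set" where
  "base = (SOME f. topological_basis (range f))"

lemma topological_basis_base: "topological_basis (range (base :: nat \<Rightarrow> 'a::euclidean_space set))"
proof -
  obtain B :: "'a set set" where B: "countable B" "topological_basis B" using ex_countable_basis by blast
  have "B \<noteq> {}"
  proof
    assume "B = {}"
    then show False using topological_basisE[OF B(2) open_UNIV UNIV_I] by blast
  qed
  then have "range (from_nat_into B) = B" using B(1) by (simp add: range_from_nat_into)
  then have "\<exists>f :: nat \<Rightarrow> 'a set. topological_basis (range f)" using B(2) by metis
  then show ?thesis unfolding base_def by (rule someI_ex)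
qed

lemma open_base [simp]: "open (base i)"
  using topological_basis_open[OF topological_basis_base] by blast

lemma borel_base [measurable, simp]: "base i \<in> sets borel"
  by (simp add: borel_open)

lemma ex_base: "open U \<Longrightarrow> x \<in> U \<Longrightarrow> \<exists>i. x \<in> base i \<and> base i \<subseteq> U"
  using topological_basisE[OF topological_basis_base] by (metis rangeE)

definition void :: "'a::euclidean_space set \<Rightarrow> 'a set set" where
  "void B = {X \<in> configurations. X \<inter> B = {}}"

text \<open>
An intersection-stable generator of the events that depend only on the points in \<open>D\<close>.
\<close>

definition voids :: "'a::euclidean_space set \<Rightarrow> 'a set set set" where
  "voids D = {void B | B. B \<in> sets borel \<and> bounded B \<and> B \<subseteq> D}"

lemma voidsI: "B \<in> sets borel \<Longrightarrow> bounded B \<Longrightarrow> B \<subseteq> D \<Longrightarrow> void B \<in> voids D"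
  unfolding voids_def by blast

lemma void_Int: "void B \<inter> void C = void (B \<union> C)"
  by (auto simp: void_def)

lemma voids_subset_Pow: "voids D \<subseteq> Pow configurations"
  by (auto simp: voids_def void_def)

lemma Int_stable_voids: "Int_stable (voids D)"
  unfolding Int_stable_def voids_def
proof safe
  fix B C :: "'a set" assume "B \<in> sets borel" "bounded B" "B \<subseteq> D" "C \<in> sets borel" "bounded C" "C \<subseteq> D"
  then show "\<exists>E. void B \<inter> void C = void E \<and> E \<in> sets borel \<and> bounded E \<and> E \<subseteq> D"
    by (intro exI[of _ "B \<union> C"]) (auto simp: void_Int)
qed

abbreviation base_families :: "'a::euclidean_space set set set" where
  "base_families \<equiv> {F. finite F \<and> F \<subseteq> range base}"

lemma separate_by_base:
  fixes S :: "'a::euclidean_space set"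
  assumes "finite S"
  shows "\<exists>f. (\<forall>x\<in>S. x \<in> base (f x)) \<and>
    (\<forall>x\<in>S. \<forall>y\<in>S. x \<noteq> y \<longrightarrow> base (f x) \<inter> base (f y) = ({} :: 'a set))"
proof -
  have "uniform_discrete S" using uniform_discrete_finite_iff[of S] assms by simp
  then obtain e where e: "e > 0" "\<And>x y. x \<in> S \<Longrightarrow> y \<in> S \<Longrightarrow> dist x y < e \<Longrightarrow> x = y"
    unfolding uniform_discrete_def by blast
  have "\<forall>x. \<exists>i. x \<in> base i \<and> base i \<subseteq> ball x (e / 2)" using e(1) by (auto intro!: ex_base)
  then obtain f :: "'a \<Rightarrow> nat" where f: "\<And>x. x \<in> base (f x)" "\<And>x. base (f x) \<subseteq> ball x (e / 2)" by metis
  have "base (f x) \<inter> base (f y) = ({} :: 'a set)" if "x \<in> S" "y \<in> S" "x \<noteq> y" for x y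
  proof (rule ccontr)
    assume "base (f x) \<inter> base (f y) \<noteq> ({} :: 'a set)"
    then obtain w :: 'a where "w \<in> base (f x)" "w \<in> base (f y)" by blast
    then have "w \<in> ball x (e / 2)" "w \<in> ball y (e / 2)" using f(2)[of x] f(2)[of y] by blast+
    then have "dist x y < e" using dist_triangle_less_add[of x w "e/2" y "e/2"] by (simp add: dist_commute)
    then show False using e that by blast
  qed
  then show ?thesis using f(1) by (intro exI[of _ f]) blast
qed

text \<open>
Distinct points are separated by disjoint members of a basis, so that the number of points in a set
is determined by which subsets are hit.
\<close>

lemma card_ge_iff_base_sets:
  fixes X :: "'a::euclidean_space set"
  assumes fin: "finite (X \<inter> B)"
  shows "k \<le> card (X \<inter> B) \<longleftrightarrow> (\<exists>F\<in>base_families.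
    card F = k \<and> disjoint F \<and> (\<forall>b\<in>F. X \<inter> (B \<inter> b) \<noteq> {}))" (is "_ \<longleftrightarrow> (\<exists>F\<in>_. ?Q F)")
proof
  assume "k \<le> card (X \<inter> B)"
  then obtain S where S: "S \<subseteq> X \<inter> B" "card S = k" "finite S"
    by (metis fin obtain_subset_with_card_n)
  obtain f :: "'a \<Rightarrow> nat" where f': "\<forall>x\<in>S. x \<in> base (f x)"
    "\<forall>x\<in>S. \<forall>y\<in>S. x \<noteq> y \<longrightarrow> base (f x) \<inter> base (f y) = ({} :: 'a set)"
    using separate_by_base[OF S(3)] by blast
  have f: "x \<in> S \<Longrightarrow> x \<in> base (f x)"
    "x \<in> S \<Longrightarrow> y \<in> S \<Longrightarrow> x \<noteq> y \<Longrightarrow> base (f x) \<inter> base (f y) = ({} :: 'a set)" for x y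
    using f' by blast+
  define F where "F = (\<lambda>x. base (f x) :: 'a set) ` S"
  have "inj_on (\<lambda>x. base (f x) :: 'a set) S"
    using f by (intro inj_onI) (metis disjoint_iff)
  then have 1: "card F = k" using S by (simp add: F_def card_image)
  have 2: "disjoint F"
  proof (rule pairwiseI)
    fix b c assume "b \<in> F" "c \<in> F" "b \<noteq> c"
    then obtain x y where xy: "x \<in> S" "b = base (f x)" "y \<in> S" "c = base (f y)" unfolding F_def by blast
    then have "x \<noteq> y" using \<open>b \<noteq> c\<close> by blast
    then show "disjnt b c" using f(2)[OF xy(1,3)] xy by (simp add: disjnt_def)
  qed
  have 3: "\<forall>b\<in>F. X \<inter> (B \<inter> b) \<noteq> {}"
  proof
    fix b assume "b \<in> F"
    then obtain x where "x \<in> S" "b = base (f x)" unfolding F_def by blast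
    then have "x \<in> X \<inter> (B \<inter> b)" using f(1) S(1) by blast
    then show "X \<inter> (B \<inter> b) \<noteq> {}" by blast
  qed
  have 4: "F \<in> base_families" using S(3) unfolding F_def by blast
  show "\<exists>F\<in>base_families. ?Q F"
    by (rule bexI[OF _ 4], intro conjI 1 2 3)
next
  assume "\<exists>F\<in>base_families. ?Q F"
  then obtain F where F': "?Q F"
    by (rule bexE)
  have F: "card F = k" "disjoint F" "b \<in> F \<Longrightarrow> X \<inter> (B \<inter> b) \<noteq> {}" for b using F' by simp_all
  define p where "p b = (SOME x. x \<in> X \<inter> (B \<inter> b))" for b
  have p: "p b \<in> X \<inter> (B \<inter> b)" if "b \<in> F" for b
    unfolding p_def some_in_eq by (rule F(3)[OF that])
  have "inj_on p F"
  proof (rule inj_onI, rule ccontr)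
    fix b c assume bc: "b \<in> F" "c \<in> F" "p b = p c" "b \<noteq> c"
    have "b \<inter> c = {}" using F(2) bc unfolding pairwise_def disjnt_def by blast
    moreover have "p b \<in> b" "p b \<in> c" using p[OF bc(1)] p[OF bc(2)] bc(3) by auto
    ultimately show False by blast
  qed
  then show "k \<le> card (X \<inter> B)" using card_inj_on_le[of p F "X \<inter> B"] p F(1) fin by blast
qed

lemma countable_base_families:
  "countable {F. finite F \<and> F \<subseteq> range (base :: nat \<Rightarrow> 'a::euclidean_space set)}"
  by (intro countable_Collect_finite_subset) simp

lemma card_event_in_void_sigma:
  fixes B D :: "'a::euclidean_space set"
  assumes B: "B \<in> sets borel" "bounded B" "B \<subseteq> D"
  shows "{X \<in> configurations. card (X \<inter> B) = n} \<in> sigma_sets configurations (voids D)"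
proof -
  define M where "M = sigma configurations (voids D)"
  have M: "space M = configurations" "sets M = sigma_sets configurations (voids D)"
    unfolding M_def using voids_subset_Pow[of D] by (simp_all add: space_measure_of sets_measure_of)
  have v: "{X \<in> configurations. X \<inter> (B \<inter> b) \<noteq> {}} \<in> sets M" if "b \<in> range base" for b
  proof -
    have "B \<inter> b \<in> sets borel" using that B by auto
    moreover have "bounded (B \<inter> b)" using B(2) by (rule bounded_subset) auto
    ultimately have "void (B \<inter> b) \<in> sets M" unfolding M
      using B by (intro sigma_sets.Basic voidsI) auto
    then have "space M - void (B \<inter> b) \<in> sets M" by (rule sets.compl_sets)
    also have "space M - void (B \<inter> b) = {X \<in> configurations. X \<inter> (B \<inter> b) \<noteq> {}}"
      by (auto simp: M void_def)
    finally show ?thesis .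
  qed
  have ge: "{X \<in> configurations. k \<le> card (X \<inter> B)} \<in> sets M" for k
  proof -
    have "{X \<in> space M. \<exists>F\<in>base_families.
        card F = k \<and> disjoint F \<and> (\<forall>b\<in>F. X \<inter> (B \<inter> b) \<noteq> {})} \<in> sets M"
    proof (rule sets.sets_Collect_countable_Ex'[OF _ countable_base_families])
      fix F :: "'a set set" assume F: "F \<in> base_families"
      have "{X \<in> space M. \<forall>b\<in>F. X \<inter> (B \<inter> b) \<noteq> {}} \<in> sets M"
        using F v by (intro sets.sets_Collect_finite_All) (auto simp: M)
      then show "{X \<in> space M. card F = k \<and> disjoint F \<and> (\<forall>b\<in>F. X \<inter> (B \<inter> b) \<noteq> {})} \<in> sets M"
        by (intro sets.sets_Collect_conj sets.sets_Collect_const)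
    qed
    also have "{X \<in> space M. \<exists>F\<in>base_families.
        card F = k \<and> disjoint F \<and> (\<forall>b\<in>F. X \<inter> (B \<inter> b) \<noteq> {})} = {X \<in> configurations. k \<le> card (X \<inter> B)}"
      unfolding M using card_ge_iff_base_sets[OF finite_config_Int[OF _ B(2)]]
      by (intro Collect_cong conj_cong refl) blast
    finally show ?thesis .
  qed
  have "{X \<in> configurations. card (X \<inter> B) = n} =
    {X \<in> configurations. n \<le> card (X \<inter> B)} - {X \<in> configurations. Suc n \<le> card (X \<inter> B)}" by auto
  then show ?thesis unfolding M(2)[symmetric] using ge by auto
qed

lemma void_eq_card: "bounded B \<Longrightarrow> void B = {X \<in> configurations. card (X \<inter> B) = 0}"
  by (auto simp: void_def finite_config_Int)

lemma space_configuration_space [simp]: "space configuration_space = configurations"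
  unfolding configuration_space_def by (intro space_measure_of) auto

text \<open>
The void events, unlike the counting events, are stable under intersections.  A law on
configurations is therefore determined by its void probabilities, which is Renyi's theorem.
\<close>

lemma sets_configuration_space:
  "sets (configuration_space :: 'a::euclidean_space set measure) = sigma_sets configurations (voids UNIV)"
proof -
  define G where "G = {{X \<in> configurations. card (X \<inter> B) = n} | (B :: 'a set) n. B \<in> sets borel \<and> bounded B}"
  have "sets (configuration_space :: 'a set measure) = sigma_sets configurations G"
    unfolding configuration_space_def G_def by (intro sets_measure_of) auto
  also have "sigma_sets configurations G = sigma_sets configurations (voids UNIV)"
  proof (rule sigma_sets_eqI)
    fix A assume "A \<in> G"
    then obtain B n where "B \<in> sets borel" "bounded B" "A = {X \<in> configurations. card (X \<inter> B) = n}"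
      by (auto simp: G_def)
    then show "A \<in> sigma_sets configurations (voids UNIV)" using card_event_in_void_sigma[of B UNIV n] by simp
  next
    fix A assume "A \<in> voids (UNIV :: 'a set)"
    then obtain B where "B \<in> sets borel" "bounded B" "A = void B" by (auto simp: voids_def)
    then have "A \<in> G" unfolding G_def by (auto simp: void_eq_card)
    then show "A \<in> sigma_sets configurations G" by (rule sigma_sets.Basic)
  qed
  finally show ?thesis .
qed

lemma voids_mono: "D \<subseteq> E \<Longrightarrow> voids D \<subseteq> voids E"
  unfolding voids_def by blast

lemma void_sigma_subset: "sigma_sets configurations (voids D) \<subseteq> sets configuration_space"
  unfolding sets_configuration_space by (intro sigma_sets_mono') (rule voids_mono, simp)

abbreviation config_pred :: "('a::euclidean_space set \<Rightarrow> bool) \<Rightarrow> bool" where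
  "config_pred \<equiv> Measurable.pred configuration_space"

lemma pred_hits [measurable]:
  assumes [measurable]: "B \<in> sets borel"
  shows "config_pred (\<lambda>X. X \<inter> B \<noteq> {})"
proof -
  let ?W = "\<lambda>n. B \<inter> ball 0 (real n)"
  have "config_pred (\<lambda>X. X \<inter> ?W n \<noteq> {})" for n
  proof -
    have "bounded (?W n)" by (rule bounded_subset[of "ball 0 (real n)"]) auto
    then have "void (?W n) \<in> sets configuration_space"
      unfolding sets_configuration_space by (intro sigma_sets.Basic voidsI) auto
    then have "space configuration_space - void (?W n) \<in> sets configuration_space"
      by (rule sets.compl_sets)
    moreover have "space configuration_space - void (?W n) =
      {X \<in> space configuration_space. X \<inter> ?W n \<noteq> {}}"
      by (auto simp: void_def)
    ultimately show ?thesis unfolding pred_def by simp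
  qed
  then have "config_pred (\<lambda>X. \<exists>n. X \<inter> ?W n \<noteq> {})"
    by measurable
  also have "(\<lambda>X. \<exists>n. X \<inter> ?W n \<noteq> {}) = (\<lambda>X. X \<inter> B \<noteq> {})"
  proof (intro ext iffI)
    fix X :: "'a set" assume "X \<inter> B \<noteq> {}"
    then obtain x where "x \<in> X \<inter> B" by blast
    moreover obtain n where "norm x < real n" using reals_Archimedean2 by blast
    ultimately show "\<exists>n. X \<inter> ?W n \<noteq> {}" by (intro exI[of _ n]) auto
  qed auto
  finally show ?thesis .
qed

lemma pred_misses [measurable]:
  assumes [measurable]: "B \<in> sets borel"
  shows "config_pred (\<lambda>X. X \<inter> B = {})"
proof -
  have "config_pred (\<lambda>X. \<not> (X \<inter> B \<noteq> {}))" by measurable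
  then show ?thesis by simp
qed

lemma pred_configI:
  "config_pred Q \<Longrightarrow> {X \<in> configurations. Q X} \<in> sets configuration_space"
  unfolding pred_def by simp

lemma pred_config_cong:
  assumes "config_pred Q" "\<And>X. X \<in> configurations \<Longrightarrow> Q' X \<longleftrightarrow> Q X"
  shows "config_pred Q'"
proof -
  have "config_pred Q' \<longleftrightarrow> config_pred Q"
    by (rule measurable_cong) (simp add: assms(2))
  then show ?thesis using assms(1) by simp
qed

section \<open>Measurability of connection events\<close>

text \<open>
Two members of the basis are related if both are hit and any choice of points in them is adjacent.
\<close>

definition base_link :: "'a::euclidean_space set \<Rightarrow> (nat \<times> nat) set" where
  "base_link X = {(i, j). X \<inter> base i \<noteq> {} \<and> X \<inter> base j \<noteq> {} \<and> (\<forall>x\<in>base i. \<forall>y\<in>base j. dist x (y :: 'a) < 1)}"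

definition joined :: "'a::euclidean_space set \<Rightarrow> 'a set \<Rightarrow> 'a set \<Rightarrow> bool" where
  "joined X U V \<longleftrightarrow> (\<exists>x\<in>U. \<exists>y\<in>V. linked X x y)"

definition perc_in :: "'a::euclidean_space set \<Rightarrow> 'a set \<Rightarrow> bool" where
  "perc_in X U \<longleftrightarrow> (\<exists>x\<in>U. percolates X x)"

text \<open>
Every point of a configuration is the only one in some basis set, and for such a set \<open>perc_in\<close> and
\<open>joined\<close> are statements on that point.  This gives measurable quantification over the points of a
configuration.
\<close>

definition single :: "'a::euclidean_space set \<Rightarrow> nat \<Rightarrow> bool" where
  "single X i \<longleftrightarrow> (\<exists>x. X \<inter> base i = {x})"

lemma linked_if_base_links:
  assumes "(i, j) \<in> (base_link X)\<^sup>*" "x \<in> X \<inter> base i"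
  shows "\<exists>y\<in>X \<inter> base j. linked X x y"
  using assms(1)
proof (induction rule: rtrancl_induct)
  case base
  then show ?case using assms(2) by (intro bexI[of _ x]) auto
next
  case (step j k)
  then obtain y where y: "y \<in> X \<inter> base j" "linked X x y" by blast
  obtain z where z: "z \<in> X \<inter> base k" using step by (auto simp: base_link_def)
  have "dist y z < 1" using step y z by (auto simp: base_link_def)
  then have "linked X y z" using y z by (intro linked_step) auto
  then show ?case using y z linked_trans by blast
qed

text \<open>
The last basis set of the chain has to be allowed arbitrarily small, since it must consist of
neighbours of the next point of the path.
\<close>

lemma base_links_if_linked:
  assumes "linked X x y" and U: "open U" "x \<in> U" and V: "open V" "y \<in> V"
  shows "\<exists>i j. x \<in> base i \<and> base i \<subseteq> U \<and> y \<in> base j \<and> base j \<subseteq> V \<and> (i, j) \<in> (base_link X)\<^sup>*"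
  using assms(1) V
proof (induction arbitrary: V rule: linked_induct)
  case refl
  obtain i where "x \<in> base i" "base i \<subseteq> U \<inter> V" using ex_base[of "U \<inter> V" x] U refl by auto
  then show ?case by (intro exI[of _ i]) auto
next
  case (step y z)
  (* Half of the slack in dist y z < 1 is left to each of the two neighbourhoods. *)
  define e where "e = (1 - dist y z) / 2"
  have e: "e > 0" using step by (simp add: e_def)
  obtain i j where ij: "x \<in> base i" "base i \<subseteq> U" "y \<in> base j" "base j \<subseteq> ball y e" "(i, j) \<in> (base_link X)\<^sup>*"
    using step.IH[of "ball y e"] e by auto
  obtain k where k: "z \<in> base k" "base k \<subseteq> V \<inter> ball z e"
    using ex_base[of "V \<inter> ball z e" z] step.prems e by auto
  have "dist u v < 1" if "u \<in> base j" "v \<in> base k" for u v :: 'a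
  proof -
    have "dist y u < e" "dist z v < e" using that ij k by auto
    then show ?thesis using dist_triangle[of u v y] dist_triangle[of y v z] unfolding e_def
      by (simp add: dist_commute field_simps)
  qed
  moreover have "y \<in> X" "z \<in> X" using step linked_in by blast+
  ultimately have "(j, k) \<in> base_link X" using ij k by (auto simp: base_link_def)
  then show ?case using ij k by (intro exI[of _ i] exI[of _ k]) (auto intro: rtrancl_into_rtrancl)
qed

lemma joined_iff_base_links:
  assumes "open U" "open V"
  shows "joined X U V \<longleftrightarrow>
    (\<exists>i j. base i \<subseteq> U \<and> base j \<subseteq> V \<and> X \<inter> base i \<noteq> {} \<and> (\<exists>n. (i, j) \<in> base_link X ^^ n))"
proof
  assume "joined X U V"
  then obtain x y where xy: "x \<in> U" "y \<in> V" "linked X x y" unfolding joined_def by blast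
  obtain i j where ij: "x \<in> base i" "base i \<subseteq> U" "base j \<subseteq> V" "(i, j) \<in> (base_link X)\<^sup>*"
    using base_links_if_linked[OF xy(3) assms(1) xy(1) assms(2) xy(2)] by blast
  moreover have "X \<inter> base i \<noteq> {}" using ij(1) linked_in[OF xy(3)] by blast
  ultimately show "\<exists>i j. base i \<subseteq> U \<and> base j \<subseteq> V \<and> X \<inter> base i \<noteq> {} \<and> (\<exists>n. (i, j) \<in> base_link X ^^ n)"
    unfolding rtrancl_power by blast
next
  assume "\<exists>i j. base i \<subseteq> U \<and> base j \<subseteq> V \<and> X \<inter> base i \<noteq> {} \<and> (\<exists>n. (i, j) \<in> base_link X ^^ n)"
  then obtain i j x where *: "base i \<subseteq> U" "base j \<subseteq> V" "x \<in> X \<inter> base i" "(i, j) \<in> (base_link X)\<^sup>*"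
    unfolding rtrancl_power by blast
  obtain y where "y \<in> X \<inter> base j" "linked X x y" using linked_if_base_links[OF *(4,3)] by blast
  then show "joined X U V" using * unfolding joined_def by blast
qed

lemma pred_base_link_power [measurable]:
  "config_pred (\<lambda>X :: 'a::euclidean_space set. (i, j) \<in> base_link X ^^ n)"
proof (induction n arbitrary: j)
  case 0
  then show ?case by simp
next
  case (Suc n)
  note Suc [measurable]
  have "config_pred (\<lambda>X :: 'a set. \<exists>k. (i, k) \<in> base_link X ^^ n \<and>
    X \<inter> base k \<noteq> {} \<and> X \<inter> base j \<noteq> {} \<and> (\<forall>x\<in>base k. \<forall>y\<in>base j. dist x (y :: 'a) < 1))"
    by (intro pred_intros_countable pred_intros_logic Suc pred_hits) auto
  then show ?case
    by (rule pred_config_cong) (auto simp: base_link_def)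
qed

lemma pred_joined:
  assumes "open U" "open V"
  shows "config_pred (\<lambda>X. joined X U V)"
  unfolding joined_iff_base_links[OF assms]
  by (intro pred_intros_countable pred_intros_logic pred_base_link_power pred_hits) auto

text \<open>
In a bounded set the quantifiers can be exchanged: if points of \<open>W\<close> are linked to points of
arbitrarily large norm, then one of the finitely many points in \<open>W\<close> has an infinite cluster.
\<close>

lemma pred_perc_in:
  assumes "open U"
  shows "config_pred (\<lambda>X. perc_in X U)"
proof -
  have b: "config_pred (\<lambda>X. perc_in X W)" if W: "open W" "bounded W" for W :: "'a set"
  proof (rule pred_config_cong)
    show "config_pred (\<lambda>X. \<forall>n. joined X W (- cball 0 (real n)))"
      by (intro pred_intros_countable pred_joined W) auto
    fix X :: "'a set" assume X: "X \<in> configurations"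
    show "perc_in X W \<longleftrightarrow> (\<forall>n. joined X W (- cball 0 (real n)))"
    proof
      assume "perc_in X W"
      then obtain x where x: "x \<in> W" "percolates X x" by (auto simp: perc_in_def)
      have "\<exists>y\<in>- cball 0 (real n). linked X x y" for n
      proof (rule ccontr)
        assume "\<not> ?thesis"
        then have "{y. linked X x y} \<subseteq> X \<inter> cball 0 (real n)" by (auto dest: linked_in)
        then show False using x(2) finite_config_Int[OF X bounded_cball] finite_subset
          unfolding percolates_def by blast
      qed
      then show "\<forall>n. joined X W (- cball 0 (real n))" using x(1) unfolding joined_def by blast
    next
      assume a: "\<forall>n. joined X W (- cball 0 (real n))"
      show "perc_in X W"
      proof (rule ccontr)
        assume n: "\<not> perc_in X W"
        have "finite (\<Union>x\<in>X \<inter> W. {y. linked X x y})"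
          using n finite_config_Int[OF X W(2)] by (auto simp: perc_in_def percolates_def)
        then have "bounded (\<Union>x\<in>X \<inter> W. {y. linked X x y})" by (rule finite_imp_bounded)
        then obtain r where r: "\<And>z. z \<in> (\<Union>x\<in>X \<inter> W. {y. linked X x y}) \<Longrightarrow> norm z \<le> r"
          unfolding bounded_iff by blast
        obtain n :: nat where "r < real n" using reals_Archimedean2 by blast
        moreover obtain x y where "x \<in> W" "y \<in> - cball 0 (real n)" "linked X x y"
          using a unfolding joined_def by blast
        moreover from this have "norm y \<le> r" by (intro r) (auto dest: linked_in)
        ultimately show False by simp
      qed
    qed
  qed
  show ?thesis
  proof (rule pred_config_cong)
    show "config_pred (\<lambda>X. \<exists>n. perc_in X (U \<inter> ball 0 (real n)))"
      using assms by (intro pred_intros_countable b) auto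
    fix X :: "'a set"
    show "perc_in X U \<longleftrightarrow> (\<exists>n. perc_in X (U \<inter> ball 0 (real n)))"
    proof
      assume "perc_in X U"
      then obtain x where x: "x \<in> U" "percolates X x" by (auto simp: perc_in_def)
      obtain n where "norm x < real n" using reals_Archimedean2 by blast
      then have "x \<in> U \<inter> ball 0 (real n)" using x by simp
      then show "\<exists>n. perc_in X (U \<inter> ball 0 (real n))" using x(2) unfolding perc_in_def by blast
    qed (auto simp: perc_in_def)
  qed
qed

lemma single_iff:
  fixes X :: "'a::euclidean_space set"
  shows "single X i \<longleftrightarrow> X \<inter> base i \<noteq> {} \<and>
    (\<forall>j k. base j \<inter> base k = ({} :: 'a set) \<longrightarrow> X \<inter> (base i \<inter> base j) = {} \<or> X \<inter> (base i \<inter> base k) = {})"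
proof
  assume "single X i"
  then obtain x where x: "X \<inter> base i = {x}" unfolding single_def by (rule exE)
  have eq: "X \<inter> (base i \<inter> W) = {x} \<inter> W" for W using x by (simp add: Int_assoc[symmetric])
  show "X \<inter> base i \<noteq> {} \<and>
    (\<forall>j k. base j \<inter> base k = ({} :: 'a set) \<longrightarrow> X \<inter> (base i \<inter> base j) = {} \<or> X \<inter> (base i \<inter> base k) = {})"
    unfolding eq x by auto
next
  assume a: "X \<inter> base i \<noteq> {} \<and>
    (\<forall>j k. base j \<inter> base k = ({} :: 'a set) \<longrightarrow> X \<inter> (base i \<inter> base j) = {} \<or> X \<inter> (base i \<inter> base k) = {})"
  then have a1: "X \<inter> base i \<noteq> {}" and a2: "\<And>j k. base j \<inter> base k = ({} :: 'a set) \<Longrightarrow>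
    X \<inter> (base i \<inter> base j) = {} \<or> X \<inter> (base i \<inter> base k) = {}" by simp_all
  obtain x where x: "x \<in> X \<inter> base i" using a1 by (meson ex_in_conv)
  have "y = x" if y: "y \<in> X \<inter> base i" for y
  proof (rule ccontr)
    assume "y \<noteq> x"
    moreover obtain f :: "'a \<Rightarrow> nat" where "\<forall>z\<in>{x, y}. z \<in> base (f z)"
      "\<forall>z\<in>{x, y}. \<forall>w\<in>{x, y}. z \<noteq> w \<longrightarrow> base (f z) \<inter> base (f w) = ({} :: 'a set)"
      using separate_by_base[of "{x, y}"] by blast
    ultimately have "x \<in> base (f x)" "y \<in> base (f y)" "base (f x) \<inter> base (f y) = ({} :: 'a set)" by auto
    moreover from this have "x \<in> X \<inter> (base i \<inter> base (f x))" "y \<in> X \<inter> (base i \<inter> base (f y))"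
      using x y by simp_all
    ultimately show False using a2[of "f x" "f y"] by auto
  qed
  then have "X \<inter> base i = {x}" using x by blast
  then show "single X i" unfolding single_def by (rule exI)
qed

lemma pred_single: "config_pred (\<lambda>X :: 'a::euclidean_space set. single X i)"
  unfolding single_iff
  by (intro pred_intros_countable pred_intros_logic pred_hits pred_misses) auto

lemma ex_single:
  assumes "X \<in> configurations" "x \<in> X" "open U" "x \<in> U"
  obtains i where "single X i" "X \<inter> base i = {x}" "base i \<subseteq> U"
proof -
  define F where "F = X \<inter> ball x 1 - {x}"
  have "finite F" using finite_config_Int[OF assms(1) bounded_ball] by (simp add: F_def)
  then have "open (U \<inter> ball x 1 - F)" using assms(3) by (intro open_Diff finite_imp_closed) auto
  moreover have "x \<in> U \<inter> ball x 1 - F" using assms by (auto simp: F_def)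
  ultimately obtain i where i: "x \<in> base i" "base i \<subseteq> U \<inter> ball x 1 - F" using ex_base by blast
  then have "X \<inter> base i = {x}" using assms(2) by (auto simp: F_def)
  then show ?thesis using that i unfolding single_def by blast
qed

lemma perc_in_single:
  assumes "X \<inter> base i = {x}"
  shows "perc_in X (base i) \<longleftrightarrow> percolates X x"
proof -
  have "x \<in> base i" "\<And>y. y \<in> X \<Longrightarrow> y \<in> base i \<Longrightarrow> y = x" using assms by blast+
  then show ?thesis unfolding perc_in_def using percolates_in by metis
qed

lemma joined_single_left:
  assumes "X \<inter> base i = {x}"
  shows "joined X (base i) V \<longleftrightarrow> (\<exists>y\<in>V. linked X x y)"
proof -
  have "x \<in> base i" "\<And>y. y \<in> X \<Longrightarrow> y \<in> base i \<Longrightarrow> y = x" using assms by blast+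
  then show ?thesis unfolding joined_def using linked_in by metis
qed

lemma joined_single:
  assumes "X \<inter> base i = {x}" "X \<inter> base j = {y}"
  shows "joined X (base i) (base j) \<longleftrightarrow> linked X x y"
proof -
  have "y \<in> base j" "\<And>z. z \<in> X \<Longrightarrow> z \<in> base j \<Longrightarrow> z = y" using assms by blast+
  then show ?thesis unfolding joined_single_left[OF assms(1)] using linked_in by metis
qed

lemma pred_unique_percolating:
  "config_pred (\<lambda>X::'a::euclidean_space set. one_cluster X)"
proof (rule pred_config_cong)
  show "config_pred (\<lambda>X::'a set. \<forall>i j. single X i \<and> single X j \<and>
    perc_in X (base i) \<and> perc_in X (base j) \<longrightarrow> joined X (base i) (base j))"
    by (intro pred_intros_countable pred_intros_logic pred_single pred_perc_in pred_joined) auto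
  fix X :: "'a set" assume X: "X \<in> configurations"
  show "one_cluster X \<longleftrightarrow>
    (\<forall>i j. single X i \<and> single X j \<and> perc_in X (base i) \<and> perc_in X (base j) \<longrightarrow> joined X (base i) (base j))"
    (is "_ \<longleftrightarrow> ?R")
  proof (intro iffI allI impI; (elim conjE)?)
    fix i j assume "one_cluster X"
      "single X i" "single X j" "perc_in X (base i)" "perc_in X (base j)"
    then show "joined X (base i) (base j)" unfolding joined_def perc_in_def by blast
  next
    fix x y assume a: ?R and xy: "percolates X x" "percolates X y"
    obtain i where i: "single X i" "X \<inter> base i = {x}" by (rule ex_single[OF X percolates_in[OF xy(1)] open_UNIV UNIV_I])
    obtain j where j: "single X j" "X \<inter> base j = {y}" by (rule ex_single[OF X percolates_in[OF xy(2)] open_UNIV UNIV_I])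
    show "linked X x y"
      using a i j xy perc_in_single[OF i(2)] perc_in_single[OF j(2)] joined_single[OF i(2) j(2)] by blast
  qed
qed

lemma pred_percolating_near:
  fixes V :: "'a::euclidean_space set"
  assumes V: "open V"
  shows "config_pred (\<lambda>X. \<forall>x. percolates X x \<longrightarrow> (\<exists>y\<in>V. linked X x y))"
proof (rule pred_config_cong)
  show "config_pred (\<lambda>X::'a set. \<forall>i. single X i \<and> perc_in X (base i) \<longrightarrow> joined X (base i) V)"
    by (intro pred_intros_countable pred_intros_logic pred_single pred_perc_in pred_joined V) auto
  fix X :: "'a set" assume X: "X \<in> configurations"
  show "(\<forall>x. percolates X x \<longrightarrow> (\<exists>y\<in>V. linked X x y)) \<longleftrightarrow>
    (\<forall>i. single X i \<and> perc_in X (base i) \<longrightarrow> joined X (base i) V)"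
    (is "?L \<longleftrightarrow> ?R")
  proof (intro iffI allI impI; (elim conjE)?)
    fix i assume ?L "single X i" "perc_in X (base i)"
    then show "joined X (base i) V" unfolding joined_def perc_in_def by blast
  next
    fix x assume a: ?R and x: "percolates X x"
    obtain i where i: "single X i" "X \<inter> base i = {x}" by (rule ex_single[OF X percolates_in[OF x] open_UNIV UNIV_I])
    show "\<exists>y\<in>V. linked X x y"
      using a i x perc_in_single[OF i(2)] joined_single_left[OF i(2)] by blast
  qed
qed

lemma pred_three_clusters:
  fixes U :: "'a::euclidean_space set"
  assumes U: "open U"
  shows "config_pred (\<lambda>X. three_clusters X U)"
proof (rule pred_config_cong)
  define Q where "Q = (\<lambda>(X :: 'a set) i j k. base i \<subseteq> U \<and> base j \<subseteq> U \<and> base k \<subseteq> U \<and>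
    single X i \<and> single X j \<and> single X k \<and>
    perc_in X (base i) \<and> perc_in X (base j) \<and> perc_in X (base k) \<and>
    \<not> joined X (base i) (base j) \<and> \<not> joined X (base j) (base k) \<and> \<not> joined X (base i) (base k))"
  show "config_pred (\<lambda>X::'a set. \<exists>i j k. Q X i j k)"
    unfolding Q_def
    by (intro pred_intros_countable pred_intros_logic pred_single pred_perc_in pred_joined) auto
  fix X :: "'a set" assume X: "X \<in> configurations"
  show "three_clusters X U \<longleftrightarrow> (\<exists>i j k. Q X i j k)"
  proof
    assume "three_clusters X U"
    then obtain x y z where xyz: "x \<in> U" "y \<in> U" "z \<in> U"
      and p: "percolates X x" "percolates X y" "percolates X z"
      and n: "\<not> linked X x y" "\<not> linked X y z" "\<not> linked X x z" unfolding three_clusters_def by blast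
    obtain i where i: "single X i" "X \<inter> base i = {x}" "base i \<subseteq> U"
      by (rule ex_single[OF X percolates_in[OF p(1)] U xyz(1)])
    obtain j where j: "single X j" "X \<inter> base j = {y}" "base j \<subseteq> U"
      by (rule ex_single[OF X percolates_in[OF p(2)] U xyz(2)])
    obtain k where k: "single X k" "X \<inter> base k = {z}" "base k \<subseteq> U"
      by (rule ex_single[OF X percolates_in[OF p(3)] U xyz(3)])
    have "Q X i j k" unfolding Q_def
      using i j k p n by (simp add: perc_in_single joined_single)
    then show "\<exists>i j k. Q X i j k" by blast
  next
    assume "\<exists>i j k. Q X i j k"
    then obtain i j k where q: "Q X i j k" by blast
    then obtain x y z where s: "X \<inter> base i = {x}" "X \<inter> base j = {y}" "X \<inter> base k = {z}"
      unfolding Q_def single_def by (elim conjE exE)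
    then have "x \<in> base i" "y \<in> base j" "z \<in> base k" by auto
    then have "x \<in> U" "y \<in> U" "z \<in> U" using q unfolding Q_def by auto
    moreover have "percolates X x" "percolates X y" "percolates X z"
      "\<not> linked X x y" "\<not> linked X y z" "\<not> linked X x z"
      using q s unfolding Q_def by (simp_all add: perc_in_single joined_single)
    ultimately show "three_clusters X U" unfolding three_clusters_def by blast
  qed
qed

text \<open>
A compact set is covered if and only if finitely many basis sets are hit such that every choice of
points in them already gives a cover.
\<close>

lemma pred_covers:
  fixes K :: "'a::euclidean_space set"
  assumes K: "compact K"
  shows "config_pred (\<lambda>X. K \<subseteq> boolean_model X)"
proof (rule pred_config_cong)
  define Q where "Q F \<longleftrightarrow> (\<forall>u\<in>K. \<exists>i\<in>F. \<forall>y\<in>base i. dist u y < 1 / 2)" for F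
  have "{X \<in> space configuration_space. \<exists>F\<in>{F. finite F}. Q F \<and> (\<forall>i\<in>F. X \<inter> base i \<noteq> {})}
      \<in> sets (configuration_space :: 'a set measure)"
  proof (rule sets.sets_Collect_countable_Ex')
    show "countable {F :: nat set. finite F}" using countable_Collect_finite by simp
    fix F :: "nat set" assume "F \<in> {F. finite F}"
    then have "{X \<in> space configuration_space. \<forall>i\<in>F. X \<inter> base i \<noteq> {}} \<in> sets (configuration_space :: 'a set measure)"
      using pred_hits[OF borel_base] unfolding pred_def by (intro sets.sets_Collect_finite_All) auto
    then show "{X \<in> space configuration_space. Q F \<and> (\<forall>i\<in>F. X \<inter> base i \<noteq> {})} \<in> sets (configuration_space :: 'a set measure)"
      by (intro sets.sets_Collect_conj sets.sets_Collect_const)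
  qed
  then show "config_pred (\<lambda>X :: 'a set. \<exists>F\<in>{F. finite F}. Q F \<and> (\<forall>i\<in>F. X \<inter> base i \<noteq> {}))"
    unfolding pred_def by simp
  fix X :: "'a set"
  show "K \<subseteq> boolean_model X \<longleftrightarrow> (\<exists>F\<in>{F. finite F}. Q F \<and> (\<forall>i\<in>F. X \<inter> base i \<noteq> {}))"
  proof
    assume sub: "K \<subseteq> boolean_model X"
    have "\<exists>e i. e > 0 \<and> X \<inter> base i \<noteq> {} \<and> (\<forall>u'\<in>ball u e. \<forall>y'\<in>base i. dist u' y' < 1 / 2)" if uK: "u \<in> K" for u
    proof -
      obtain y where y: "y \<in> X" "dist y u < 1 / 2" using subsetD[OF sub uK] by (auto simp: boolean_model_def)
      define e where "e = (1 / 2 - dist y u) / 2"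
      have e: "e > 0" using y by (simp add: e_def)
      obtain i where i: "y \<in> base i" "base i \<subseteq> ball y e" using ex_base[of "ball y e" y] e by auto
      have "dist u' y' < 1 / 2" if "u' \<in> ball u e" "y' \<in> base i" for u' y'
      proof -
        have "dist u u' < e" "dist y y' < e" using that i by auto
        then show ?thesis using dist_triangle[of u' y' u] dist_triangle[of u y' y] unfolding e_def
          by (simp add: dist_commute field_simps)
      qed
      then show ?thesis using e i y by blast
    qed
    then obtain e i where ei: "\<And>u. u \<in> K \<Longrightarrow> e u > 0 \<and> X \<inter> base (i u) \<noteq> {} \<and>
      (\<forall>u'\<in>ball u (e u). \<forall>y'\<in>base (i u). dist u' y' < 1 / 2)" by metis
    have "K \<subseteq> (\<Union>u\<in>K. ball u (e u))" using ei by (intro subsetI UN_I) auto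
    then obtain C where C: "C \<subseteq> K" "finite C" "K \<subseteq> (\<Union>u\<in>C. ball u (e u))"
      using compactE_image[OF K, of K "\<lambda>u. ball u (e u)"] by (metis open_ball)
    show "\<exists>F\<in>{F. finite F}. Q F \<and> (\<forall>i\<in>F. X \<inter> base i \<noteq> {})"
    proof (intro bexI[of _ "i ` C"] conjI)
      show "Q (i ` C)" unfolding Q_def
      proof
        fix u assume "u \<in> K"
        then obtain c where "c \<in> C" "u \<in> ball c (e c)" using C(3) by blast
        moreover from this have "\<forall>y\<in>base (i c). dist u y < 1 / 2" using ei[of c] C(1) by auto
        ultimately show "\<exists>i\<in>i ` C. \<forall>y\<in>base i. dist u y < 1 / 2" by auto
      qed
      show "\<forall>i\<in>i ` C. X \<inter> base i \<noteq> {}" using ei C(1) by auto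
    qed (use C(2) in auto)
  next
    assume "\<exists>F\<in>{F. finite F}. Q F \<and> (\<forall>i\<in>F. X \<inter> base i \<noteq> {})"
    then obtain F where F: "Q F" "\<forall>i\<in>F. X \<inter> base i \<noteq> {}" by (elim bexE conjE)
    show "K \<subseteq> boolean_model X"
    proof
      fix u assume "u \<in> K"
      then obtain i where i: "i \<in> F" "\<forall>y\<in>base i. dist u y < 1 / 2" using F(1) unfolding Q_def by blast
      then obtain y where "y \<in> X" "y \<in> base i" using F(2) by blast
      then show "u \<in> boolean_model X" using i(2) unfolding boolean_model_def by (auto simp: dist_commute)
    qed
  qed
qed

lemma Omega0_measurable: "Omega0 \<in> sets (configuration_space :: 'a::euclidean_space set measure)"
proof -
  let ?A = "{X \<in> configurations. one_cluster X \<and> perc_in X (ball (0::'a) (1 / 2))}"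
  have "?A \<in> sets configuration_space"
    by (intro pred_configI pred_intros_logic pred_unique_percolating pred_perc_in) auto
  also have "?A = Omega0"
    unfolding perc_in_def by (intro set_eqI) (simp only: Omega0_iff mem_Collect_eq)
  finally show ?thesis .
qed

lemma infinite_cluster_eq_UNIV_iff:
  fixes X :: "'a::euclidean_space set"
  assumes "X \<in> Omega0"
  shows "infinite_cluster X = UNIV \<longleftrightarrow> (\<forall>n. cball 0 (real n) \<subseteq> boolean_model X)"
proof -
  have "infinite_cluster X = UNIV" if "\<forall>n. cball 0 (real n) \<subseteq> infinite_cluster X"
  proof -
    have "x \<in> infinite_cluster X" for x :: 'a
    proof -
      obtain n where "norm x \<le> real n" using real_arch_simple by blast
      then have "x \<in> cball 0 (real n)" by simp
      then show ?thesis using that by blast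
    qed
    then show ?thesis by blast
  qed
  then have "infinite_cluster X = UNIV \<longleftrightarrow> (\<forall>n. cball 0 (real n) \<subseteq> infinite_cluster X)" by auto
  then show ?thesis using cball_subset_cluster_iff[OF assms] by simp
qed

text \<open>
The distance is at least \<open>\<epsilon>\<close> if and only if all closed balls of smaller radius are covered, apart
from the case of a cluster without complement, where the distance is 0.
\<close>

lemma near_boundary_measurable:
  "near_boundary \<epsilon> \<in> sets (configuration_space :: 'a::euclidean_space set measure)"
proof (cases "\<epsilon> > 0")
  case False
  have "0 \<le> boundary_dist X" for X :: "'a set" by (simp add: boundary_dist_def infdist_nonneg)
  then have "\<not> boundary_dist X < \<epsilon>" for X :: "'a set" using False by (meson not_less order_trans)
  then have "near_boundary \<epsilon> = ({} :: 'a set set)" by simp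
  then show ?thesis by (simp only: sets.empty_sets)
next
  case True
  define r where "r n = \<epsilon> * (real n / (real n + 1))" for n
  have r: "0 \<le> r n" "r n < \<epsilon>" for n using True by (auto simp: r_def field_simps)
  have cofinal: "\<exists>n. a \<le> r n" if "a < \<epsilon>" for a
  proof -
    obtain n :: nat where "\<epsilon> / (\<epsilon> - a) \<le> real n" using real_arch_simple by blast
    then show ?thesis using that True by (intro exI[of _ n]) (simp add: r_def divide_simps, simp add: algebra_simps)
  qed
  have cov: "cball 0 s \<subseteq> infinite_cluster X \<longleftrightarrow> cball 0 s \<subseteq> boolean_model X"
    if "X \<in> Omega0" "0 \<le> s" for X :: "'a set" and s
    using cball_subset_cluster_iff[OF that] .
  define U where "U X \<longleftrightarrow> (\<exists>n. \<not> cball (0::'a) (r n) \<subseteq> boolean_model X) \<or>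
     (\<forall>n. cball (0::'a) (real n) \<subseteq> boolean_model X)" for X
  have iff: "boundary_dist X < \<epsilon> \<longleftrightarrow> U X"
    if X: "X \<in> Omega0" for X :: "'a set"
  proof (cases "infinite_cluster X = UNIV")
    case univ: True
    then have "boundary_dist X < \<epsilon>" using True by (simp add: boundary_dist_def infdist_def)
    moreover have "\<forall>n. cball 0 (real n) \<subseteq> boolean_model X" using infinite_cluster_eq_UNIV_iff[OF X] univ by simp
    ultimately show ?thesis by (simp add: U_def)
  next
    case False
    then have "\<not> (\<forall>n. cball 0 (real n) \<subseteq> boolean_model X)" using infinite_cluster_eq_UNIV_iff[OF X] by simp
    moreover have "boundary_dist X < \<epsilon> \<longleftrightarrow> (\<exists>n. \<not> cball 0 (r n) \<subseteq> infinite_cluster X)"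
      unfolding distance_less_iff[OF False]
    proof
      assume "\<exists>z. z \<notin> infinite_cluster X \<and> norm z < \<epsilon>"
      then obtain z where z: "z \<notin> infinite_cluster X" "norm z < \<epsilon>" by blast
      obtain n where "norm z \<le> r n" using cofinal[OF z(2)] by blast
      then have "z \<in> cball 0 (r n)" by simp
      then show "\<exists>n. \<not> cball 0 (r n) \<subseteq> infinite_cluster X" using z(1) by blast
    next
      assume "\<exists>n. \<not> cball 0 (r n) \<subseteq> infinite_cluster X"
      then obtain n and z :: 'a where "z \<notin> infinite_cluster X" "z \<in> cball 0 (r n)" by blast
      then show "\<exists>z. z \<notin> infinite_cluster X \<and> norm z < \<epsilon>" using r(2)[of n] by (intro exI[of _ z]) auto
    qed
    then have "boundary_dist X < \<epsilon> \<longleftrightarrow> (\<exists>n. \<not> cball 0 (r n) \<subseteq> boolean_model X)"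
      using cov[OF X r(1)] by simp
    ultimately show ?thesis unfolding U_def by blast
  qed
  have "config_pred U"
    unfolding U_def by (intro pred_intros_countable pred_intros_logic pred_covers) auto
  then have "Omega0 \<inter> {X \<in> configurations. U X} \<in> sets (configuration_space :: 'a set measure)"
    by (intro sets.Int Omega0_measurable pred_configI)
  also have "Omega0 \<inter> {X \<in> configurations. U X} = near_boundary \<epsilon>"
    using iff by (auto simp: Omega0_def)
  finally show ?thesis .
qed

section \<open>Independence and stationarity\<close>

definition region :: "'a::euclidean_space set \<Rightarrow> 'a set measure" where
  "region D = sigma configurations (voids D)"

lemma space_region [simp]: "space (region D) = configurations"
  unfolding region_def by (rule space_measure_of[OF voids_subset_Pow])

lemma sets_region: "sets (region D) = sigma_sets configurations (voids D)"
  unfolding region_def by (rule sets_measure_of[OF voids_subset_Pow])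

lemma region_mono: "D \<subseteq> E \<Longrightarrow> A \<in> sets (region D) \<Longrightarrow> A \<in> sets (region E)"
  unfolding sets_region using sigma_sets_mono'[OF voids_mono] by blast

lemma region_configuration: "A \<in> sets (region D) \<Longrightarrow> A \<in> sets configuration_space"
  unfolding sets_region using void_sigma_subset by blast

lemma void_in_region: "B \<in> sets borel \<Longrightarrow> bounded B \<Longrightarrow> B \<subseteq> D \<Longrightarrow> void B \<in> sets (region D)"
  unfolding sets_region by (intro sigma_sets.Basic voidsI)

lemma hits_in_region:
  assumes "B \<in> sets borel" "bounded B" "B \<subseteq> D"
  shows "{X \<in> configurations. X \<inter> B \<noteq> {}} \<in> sets (region D)"
proof -
  have "{X \<in> configurations. X \<inter> B \<noteq> {}} = space (region D) - void B" by (auto simp: void_def)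
  then show ?thesis using void_in_region[OF assms] by (simp only: sets.compl_sets)
qed

lemma card_in_region:
  "B \<in> sets borel \<Longrightarrow> bounded B \<Longrightarrow> B \<subseteq> D \<Longrightarrow>
    {X \<in> configurations. card (X \<inter> B) = n} \<in> sets (region D)"
  unfolding sets_region by (rule card_event_in_void_sigma)

lemma delete_in_region:
  assumes D: "D \<in> sets borel" and G: "G \<in> sets configuration_space"
  shows "{X \<in> configurations. X - D \<in> G} \<in> sets (region (- D))"
proof -
  have "(\<lambda>X. X - D) \<in> measurable (region (- D)) configuration_space"
  proof (rule measurable_sigma_sets[OF sets_configuration_space voids_subset_Pow])
    show "(\<lambda>X. X - D) \<in> space (region (- D)) \<rightarrow> configurations" by (auto intro: config_subset)
    fix Y assume "Y \<in> voids (UNIV :: 'a set)"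
    then obtain B where B: "B \<in> sets borel" "bounded B" "Y = void B" by (auto simp: voids_def)
    have "(\<lambda>X. X - D) -` Y \<inter> space (region (- D)) = void (B - D)"
      unfolding B(3) void_def by (auto intro: config_subset)
    also have "\<dots> \<in> sets (region (- D))"
      using B D by (intro void_in_region bounded_diff) auto
    finally show "(\<lambda>X. X - D) -` Y \<inter> space (region (- D)) \<in> sets (region (- D))" .
  qed
  from measurable_sets[OF this G] show ?thesis
    by (simp add: vimage_def Int_def conj_commute)
qed

definition shift :: "'a::euclidean_space \<Rightarrow> 'a set \<Rightarrow> 'a set" where
  "shift v X = (\<lambda>x. x - v) ` X"

lemma shift_Int: "shift v X \<inter> B = (\<lambda>x. x - v) ` (X \<inter> (\<lambda>x. x - v) -` B)"
  by (auto simp: shift_def)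

lemma bounded_vimage_translation:
  fixes B :: "'a::real_normed_vector set"
  assumes "bounded B" shows "bounded ((\<lambda>x. x - v) -` B)"
proof -
  have "(\<lambda>x. x - v) -` B = (\<lambda>x. v + x) ` B" by (force simp: image_iff)
  then show ?thesis using bounded_translation[OF assms, of v] by simp
qed

lemma shift_config: "X \<in> configurations \<Longrightarrow> shift v X \<in> configurations"
  unfolding configurations_def using bounded_vimage_translation by (auto simp: shift_Int)

lemma vimage_shift_void: "shift v -` void B \<inter> configurations = void ((\<lambda>x. x - v) -` B)"
proof -
  have "X \<in> configurations \<Longrightarrow> shift v X \<in> void B \<longleftrightarrow> X \<inter> (\<lambda>x. x - v) -` B = {}" for X
    by (simp add: void_def shift_config shift_Int)
  then show ?thesis by (auto simp: void_def)
qed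

lemma borel_vimage_translation:
  fixes B :: "'a::euclidean_space set"
  assumes "B \<in> sets borel" shows "(\<lambda>x. x - v) -` B \<in> sets borel"
proof -
  have "(\<lambda>x::'a. x - v) \<in> borel_measurable borel" by measurable
  from measurable_sets[OF this assms] show ?thesis by simp
qed

lemma shift_measurable: "shift v \<in> measurable configuration_space configuration_space"
proof (rule measurable_sigma_sets[OF sets_configuration_space voids_subset_Pow])
  show "shift v \<in> space configuration_space \<rightarrow> configurations" by (simp add: shift_config)
  fix Y assume "Y \<in> voids (UNIV :: 'a set)"
  then obtain B where B: "B \<in> sets borel" "bounded B" "Y = void B" by (auto simp: voids_def)
  show "shift v -` Y \<inter> space configuration_space \<in> sets configuration_space"
    unfolding B(3) space_configuration_space vimage_shift_void sets_configuration_space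
    using B by (intro sigma_sets.Basic voidsI borel_vimage_translation bounded_vimage_translation) auto
qed

lemma measure_vimage_translation:
  fixes B :: "'a::euclidean_space set"
  assumes "B \<in> sets borel"
  shows "measure lborel ((\<lambda>x. x - v) -` B) = measure lborel B"
proof -
  have "(\<lambda>x. x - v) -` B = (+) v ` B" by (force simp: image_iff)
  then have "measure lborel ((\<lambda>x. x - v) -` B) = measure lebesgue ((+) v ` B)"
    using borel_vimage_translation[OF assms, of v] by (simp add: measure_completion)
  also have "\<dots> = measure lborel B" using assms by (simp add: measure_translation measure_completion)
  finally show ?thesis .
qed

locale poisson_process = prob_space P for P :: "'a::euclidean_space set measure" +
  fixes \<zeta> :: real
  assumes law: "poisson_process_law \<zeta> P" and intensity_pos: "0 < \<zeta>"
begin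

lemma space_P [simp]: "space P = configurations"
  using law by (simp add: poisson_process_law_def)

lemma sets_P: "sets P = sets configuration_space"
  using law by (simp add: poisson_process_law_def)

lemma region_event: "A \<in> sets (region D) \<Longrightarrow> A \<in> events"
  using region_configuration sets_P by blast

lemma pred_event: "config_pred Q \<Longrightarrow> {X \<in> configurations. Q X} \<in> events"
  using pred_configI sets_P by blast

lemma prob_card:
  "B \<in> sets borel \<Longrightarrow> bounded B \<Longrightarrow> prob {X \<in> configurations. card (X \<inter> B) = n} =
     (\<zeta> * measure lborel B) ^ n / fact n * exp (- (\<zeta> * measure lborel B))"
  using law by (simp add: poisson_process_law_def)

lemma prob_void:
  "B \<in> sets borel \<Longrightarrow> bounded B \<Longrightarrow> prob (void B) = exp (- (\<zeta> * measure lborel B))"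
  using prob_card[of B 0] by (simp add: void_eq_card)

lemma prob_void_Int:
  assumes "B \<in> sets borel" "bounded B" "C \<in> sets borel" "bounded C" "B \<inter> C = {}"
  shows "prob (void B \<inter> void C) = prob (void B) * prob (void C)"
proof -
  have "measure lborel (B \<union> C) = measure lborel B + measure lborel C"
    using emeasure_bounded_finite[OF assms(2)] emeasure_bounded_finite[OF assms(4)] assms
    by (intro measure_Union) auto
  then show ?thesis
    using assms by (simp add: void_Int prob_void exp_add[symmetric] algebra_simps)
qed

text \<open>
The void probabilities factorize over disjoint sets, and the void events are intersection-stable
generators.
\<close>

lemma prob_region_Int:
  assumes A: "A \<in> sets (region D)" and B: "B \<in> sets (region E)" and DE: "D \<inter> E = {}"
  shows "prob (A \<inter> B) = prob A * prob B"
proof -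
  have "indep_set (voids D) (voids E)"
  proof (rule indep_setI)
    show "voids D \<subseteq> events" "voids E \<subseteq> events"
      using region_event unfolding sets_region by (blast intro: sigma_sets.Basic)+
    fix a b assume "a \<in> voids D" "b \<in> voids E"
    then obtain B C where *: "B \<in> sets borel" "bounded B" "B \<subseteq> D" "a = void B"
      "C \<in> sets borel" "bounded C" "C \<subseteq> E" "b = void C" unfolding voids_def by blast
    then have "B \<inter> C = {}" using DE by blast
    then show "prob (a \<inter> b) = prob a * prob b" using * by (simp add: prob_void_Int)
  qed
  from indep_set_sigma_sets[OF this Int_stable_voids Int_stable_voids]
  have "indep_set (sets (region D)) (sets (region E))" by (simp add: sets_region)
  from indep_setD[OF this A B] show ?thesis .
qed

text \<open>
The void probabilities depend only on the volume and are therefore invariant under translations.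
\<close>

lemma prob_shift:
  assumes A: "A \<in> events"
  shows "{X \<in> configurations. shift v X \<in> A} \<in> events"
    "prob {X \<in> configurations. shift v X \<in> A} = prob A"
proof -
  have meas: "shift v \<in> measurable P P"
    using shift_measurable by (simp add: measurable_cong_sets[OF sets_P sets_P])
  have "distr P P (shift v) = P"
  proof (rule measure_eqI_generator_eq[OF Int_stable_voids voids_subset_Pow, where A = "\<lambda>_. configurations"])
    fix V assume "V \<in> voids (UNIV :: 'a set)"
    then obtain B where B: "B \<in> sets borel" "bounded B" "V = void B" by (auto simp: voids_def)
    have "V \<in> events" using void_in_region[OF B(1,2), of UNIV] B(3) region_event by simp
    then have "emeasure (distr P P (shift v)) V = emeasure P (void ((\<lambda>x. x - v) -` B))"
      using meas by (simp add: emeasure_distr B(3) vimage_shift_void)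
    also have "\<dots> = emeasure P V"
      unfolding emeasure_eq_measure B(3) using B
      by (simp add: prob_void borel_vimage_translation bounded_vimage_translation measure_vimage_translation)
    finally show "emeasure (distr P P (shift v)) V = emeasure P V" .
  next
    have "configurations = void ({} :: 'a set)" by (simp add: void_def)
    then show "range (\<lambda>_::nat. configurations) \<subseteq> voids (UNIV :: 'a set)"
      using voidsI[of "{}" "UNIV :: 'a set"] by auto
  next
    interpret D: prob_space "distr P P (shift v)" by (rule prob_space_distr[OF meas])
    show "emeasure (distr P P (shift v)) configurations \<noteq> \<infinity>"
      using D.emeasure_finite[of configurations] by simp
  qed (simp_all add: sets_P sets_configuration_space)
  moreover have "measure (distr P P (shift v)) A = prob (shift v -` A \<inter> space P)"
    by (rule measure_distr[OF meas A])
  moreover have "shift v -` A \<inter> space P = {X \<in> configurations. shift v X \<in> A}" by auto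
  ultimately show "{X \<in> configurations. shift v X \<in> A} \<in> events"
    "prob {X \<in> configurations. shift v X \<in> A} = prob A"
    using measurable_sets[OF meas A] by auto
qed

lemma prob_hits:
  assumes "B \<in> sets borel" "bounded B"
  shows "prob {X \<in> configurations. X \<inter> B \<noteq> {}} = 1 - exp (- (\<zeta> * measure lborel B))"
proof -
  have "{X \<in> configurations. X \<inter> B \<noteq> {}} = space P - void B" by (auto simp: void_def)
  then show ?thesis
    using prob_compl[of "void B"] void_in_region[OF assms, of UNIV] region_event prob_void[OF assms] by simp
qed

definition hit_prob :: "real \<Rightarrow> real" where
  "hit_prob r = 1 - exp (- (\<zeta> * measure lborel (ball (0::'a) r)))"

lemma hit_prob_pos: "0 < r \<Longrightarrow> 0 < hit_prob r"
  using content_ball_pos[of r "0::'a"] intensity_pos by (simp add: hit_prob_def)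

lemma hit_prob_less_1: "hit_prob r < 1"
  by (simp add: hit_prob_def)

lemma prob_hits_ball:
  assumes "0 < r" shows "prob {X \<in> configurations. X \<inter> ball c r \<noteq> {}} = hit_prob r"
proof -
  have "measure lborel (ball c r) = measure lborel (ball (0::'a) r)"
    using assms content_ball_conv_unit_ball[of r c] content_ball_conv_unit_ball[of r "0::'a"] by simp
  then show ?thesis using prob_hits[of "ball c r"] by (simp add: hit_prob_def)
qed

lemma hits_disjoint_balls:
  assumes "finite N" "0 < \<rho>" "\<And>c d. c \<in> N \<Longrightarrow> d \<in> N \<Longrightarrow> c \<noteq> d \<Longrightarrow> ball c \<rho> \<inter> ball d \<rho> = {}"
  shows "{X \<in> configurations. \<forall>c\<in>N. X \<inter> ball c \<rho> \<noteq> {}} \<in> sets (region (\<Union>c\<in>N. ball c \<rho>)) \<and>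
    prob {X \<in> configurations. \<forall>c\<in>N. X \<inter> ball c \<rho> \<noteq> {}} = hit_prob \<rho> ^ card N"
  using assms
proof (induction N rule: finite_induct)
  case empty
  have "configurations \<in> sets (region ({} :: 'a set))" using sets.top[of "region ({} :: 'a set)"] by simp
  then show ?case using prob_space by simp
next
  case (insert c N)
  let ?A = "{X \<in> configurations. \<forall>c\<in>N. X \<inter> ball c \<rho> \<noteq> {}}"
  let ?B = "{X \<in> configurations. X \<inter> ball c \<rho> \<noteq> {}}"
  have eq: "{X \<in> configurations. \<forall>d\<in>insert c N. X \<inter> ball d \<rho> \<noteq> {}} = ?A \<inter> ?B" by auto
  have A: "?A \<in> sets (region (\<Union>c\<in>N. ball c \<rho>))" "prob ?A = hit_prob \<rho> ^ card N"
    using insert.IH insert.prems by auto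
  have B: "?B \<in> sets (region (ball c \<rho>))" by (intro hits_in_region) auto
  have "ball d \<rho> \<inter> ball c \<rho> = {}" if "d \<in> N" for d
    using insert.prems(2)[of d c] insert.hyps that by auto
  then have "(\<Union>c\<in>N. ball c \<rho>) \<inter> ball c \<rho> = {}" by blast
  then have "prob (?A \<inter> ?B) = prob ?A * prob ?B" by (rule prob_region_Int[OF A(1) B])
  also have "\<dots> = hit_prob \<rho> ^ card (insert c N)"
    unfolding A(2) prob_hits_ball[OF insert.prems(1)] card_insert_disjoint[OF insert.hyps] power_Suc
    by (rule mult.commute)
  finally have "prob (?A \<inter> ?B) = hit_prob \<rho> ^ card (insert c N)" .
  moreover have "?A \<inter> ?B \<in> sets (region (\<Union>c\<in>insert c N. ball c \<rho>))"
    by (intro sets.Int region_mono[OF _ A(1)] region_mono[OF _ B]) auto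
  ultimately show ?case unfolding eq by (intro conjI)
qed

lemma expected_card:
  assumes B: "B \<in> sets borel" "bounded B"
  shows "(\<integral>\<^sup>+ X. ennreal (real (card (X \<inter> B))) \<partial>P) = ennreal (\<zeta> * measure lborel B)" (is "?I = _")
proof -
  define l where "l = \<zeta> * measure lborel B"
  have l: "0 \<le> l" using intensity_pos by (simp add: l_def)
  define E where "E n = {X \<in> configurations. card (X \<inter> B) = n}" for n
  have E: "E n \<in> events" for n
    unfolding E_def by (rule region_event[OF card_in_region[OF B subset_UNIV]])
  have "?I =
    (\<integral>\<^sup>+ X. (\<Sum>n. ennreal (real n) * indicator (E n) X) \<partial>P)"
  proof (rule nn_integral_cong)
    fix X assume "X \<in> space P"
    then have "(\<lambda>n. ennreal (real n) * indicator (E n) X) =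
      (\<lambda>n. if n = card (X \<inter> B) then ennreal (real n) else 0)"
      by (auto simp: E_def fun_eq_iff)
    then show "ennreal (real (card (X \<inter> B))) = (\<Sum>n. ennreal (real n) * indicator (E n) X)"
      using sums_unique[OF sums_single[of "card (X \<inter> B)" "\<lambda>n. ennreal (real n)"]] by simp
  qed
  also have "\<dots> = (\<Sum>n. ennreal (real n) * emeasure P (E n))"
    using E by (subst nn_integral_suminf) (auto simp: nn_integral_cmult_indicator)
  also have "\<dots> = (\<Sum>n. ennreal (real n * (l ^ n / fact n * exp (- l))))"
    unfolding emeasure_eq_measure E_def prob_card[OF B] l_def
    by (intro suminf_cong ennreal_mult'[symmetric]) simp
  also have "\<dots> = ennreal l"
  proof -
    define f where "f n = real n * (l ^ n / fact n * exp (- l))" for n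
    have "(\<lambda>n. l ^ n / fact n) sums exp l" using exp_converges[of l] by (simp add: divide_inverse mult.commute)
    then have "(\<lambda>n. l * exp (- l) * (l ^ n / fact n)) sums (l * exp (- l) * exp l)" by (rule sums_mult)
    also have "(\<lambda>n. l * exp (- l) * (l ^ n / fact n)) = (\<lambda>n. f (Suc n))"
      by (rule ext) (simp add: f_def field_simps del: of_nat_Suc)
    also have "l * exp (- l) * exp l = l" by (simp add: exp_minus)
    finally have "f sums l" using sums_Suc[of f l] by (simp add: f_def)
    moreover have "0 \<le> f n" for n using l by (simp add: f_def)
    ultimately have "(\<Sum>n. ennreal (f n)) = ennreal l"
      by (simp add: suminf_ennreal2 sums_summable sums_unique[symmetric])
    then show ?thesis by (simp add: f_def)
  qed
  finally show ?thesis by (simp add: l_def)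
qed

end

section \<open>Dense filling of a region\<close>

text \<open>
The centres of the net are points of \<open>W\<close> itself, so that small disjoint balls around them fit into
\<open>W\<close>.
\<close>

lemma finite_net_of_open_set:
  fixes W :: "'a::euclidean_space set"
  assumes W: "open W" "bounded W" and \<eta>: "0 < \<eta>"
  obtains N \<rho> where "finite N" "0 < \<rho>" "\<rho> \<le> \<eta> / 2" "\<forall>c\<in>N. ball c \<rho> \<subseteq> W"
    "\<forall>c\<in>N. \<forall>d\<in>N. c \<noteq> d \<longrightarrow> ball c \<rho> \<inter> ball d \<rho> = {}" "W \<subseteq> (\<Union>c\<in>N. ball c (\<eta> / 2))"
proof -
  have comp: "compact (closure W)" using W(2) by (simp add: compact_closure)
  have "closure W \<subseteq> (\<Union>c\<in>W. ball c (\<eta> / 2))"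
  proof
    fix u assume "u \<in> closure W"
    then obtain c where "c \<in> W" "dist c u < \<eta> / 2"
      using \<eta> closure_approachable[of u W] by (meson half_gt_zero)
    then show "u \<in> (\<Union>c\<in>W. ball c (\<eta> / 2))" by auto
  qed
  then obtain N where N: "N \<subseteq> W" "finite N" "closure W \<subseteq> (\<Union>c\<in>N. ball c (\<eta> / 2))"
    using compactE_image[OF comp, of W "\<lambda>c. ball c (\<eta> / 2)"] by (metis open_ball)
  have "uniform_discrete N" using uniform_discrete_finite_iff[of N] N(2) by simp
  then obtain s where s: "s > 0" "\<And>x y. x \<in> N \<Longrightarrow> y \<in> N \<Longrightarrow> dist x y < s \<Longrightarrow> x = y"
    unfolding uniform_discrete_def by blast
  have "\<forall>c\<in>N. \<exists>e>0. ball c e \<subseteq> W" using N(1) W(1) open_contains_ball by blast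
  then obtain e where e: "\<And>c. c \<in> N \<Longrightarrow> e c > 0 \<and> ball c (e c) \<subseteq> W" by metis
  (* Small enough to separate the centres, to stay within eta, and to stay inside W. *)
  define \<rho> where "\<rho> = Min (insert (min (s / 2) (\<eta> / 2)) (e ` N))"
  have fin: "finite (insert (min (s / 2) (\<eta> / 2)) (e ` N))" using N(2) by simp
  have pos: "0 < \<rho>" unfolding \<rho>_def using fin e s(1) \<eta> by (subst Min_gr_iff) auto
  have le: "\<rho> \<le> min (s / 2) (\<eta> / 2)" "\<And>c. c \<in> N \<Longrightarrow> \<rho> \<le> e c"
    unfolding \<rho>_def by (rule Min_le[OF fin], simp)+
  have sub: "\<forall>c\<in>N. ball c \<rho> \<subseteq> W" using le(2) e by (meson order_trans subset_ball)
  have disj: "\<forall>c\<in>N. \<forall>d\<in>N. c \<noteq> d \<longrightarrow> ball c \<rho> \<inter> ball d \<rho> = {}"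
  proof (intro ballI impI)
    fix c d assume cd: "c \<in> N" "d \<in> N" "c \<noteq> d"
    show "ball c \<rho> \<inter> ball d \<rho> = {}"
    proof (rule ccontr)
      assume "ball c \<rho> \<inter> ball d \<rho> \<noteq> {}"
      then obtain w where w: "w \<in> ball c \<rho>" "w \<in> ball d \<rho>" by blast
      have "dist c d < s"
        using w le(1) dist_triangle_less_add[of c w "s/2" d "s/2"] by (simp add: dist_commute)
      then show False using s(2) cd by blast
    qed
  qed
  show ?thesis
  proof (rule that[OF N(2) pos _ sub disj])
    show "\<rho> \<le> \<eta> / 2" using le(1) by simp
    show "W \<subseteq> (\<Union>c\<in>N. ball c (\<eta> / 2))" using N(3) closure_subset by blast
  qed
qed

lemma linked_if_dense:
  fixes W :: "'a::euclidean_space set"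
  assumes W: "connected W" and dense: "\<And>u. u \<in> W \<Longrightarrow> \<exists>p\<in>X \<inter> W. dist u p < 1 / 2"
    and xy: "x \<in> X \<inter> W" "y \<in> X \<inter> W"
  shows "linked (X \<inter> W) x y"
proof (rule linked_if_connected[OF W _ xy])
  show "W \<subseteq> boolean_model (X \<inter> W)"
  proof
    fix u assume "u \<in> W"
    then obtain p where "p \<in> X \<inter> W" "dist u p < 1 / 2" using dense by blast
    then show "u \<in> boolean_model (X \<inter> W)" unfolding boolean_model_def
      by (intro UN_I[of p]) (auto simp: dist_commute)
  qed
  have "x \<in> ball x (1 / 2) \<inter> W" "y \<in> ball y (1 / 2) \<inter> W" using xy by auto
  then show "ball x (1 / 2) \<inter> W \<noteq> {}" "ball y (1 / 2) \<inter> W \<noteq> {}" by blast+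
qed

lemma point_on_radius:
  fixes x :: "'a::real_normed_vector"
  assumes "x \<noteq> 0" "0 \<le> t"
  shows "norm ((t / norm x) *\<^sub>R x) = t" "dist ((t / norm x) *\<^sub>R x) x = \<bar>norm x - t\<bar>"
proof -
  show "norm ((t / norm x) *\<^sub>R x) = t" using assms by simp
  have "(t / norm x) *\<^sub>R x - x = (t / norm x - 1) *\<^sub>R x" by (simp add: scaleR_diff_left)
  then have "dist ((t / norm x) *\<^sub>R x) x = \<bar>t / norm x - 1\<bar> * norm x" by (simp add: dist_norm)
  also have "\<dots> = \<bar>(t / norm x - 1) * norm x\<bar>" by (simp add: abs_mult)
  also have "(t / norm x - 1) * norm x = t - norm x" using assms by (simp add: left_diff_distrib)
  finally show "dist ((t / norm x) *\<^sub>R x) x = \<bar>norm x - t\<bar>" by (simp add: abs_minus_commute)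
qed

text \<open>
The point at radius \<open>t\<close> on the ray through \<open>x\<close> lies in the annulus at distance less than \<open>1 - \<eta>\<close> from
\<open>x\<close>, and \<open>T\<close> has a point at distance less than \<open>\<eta>\<close> from it.
\<close>

lemma dense_adjacent:
  fixes x :: "'a::real_normed_vector"
  assumes R: "0 \<le> h" "h < R" and \<eta>: "0 < \<eta>" "\<eta> \<le> 1 / 2" and x: "R \<le> norm x" "norm x < R + 1 - \<eta>"
    and dense: "\<And>u. h < norm u \<Longrightarrow> norm u < R \<Longrightarrow> \<exists>p\<in>T. dist u p < \<eta>"
  shows "\<exists>p\<in>T. dist x p < 1"
proof -
  (* Any radius strictly between this maximum and R would do. *)
  define t where "t = (max h (norm x - (1 - \<eta>)) + R) / 2"
  have t: "h < t" "t < R" "norm x - (1 - \<eta>) < t" using R x by (auto simp: t_def)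
  have x0: "x \<noteq> 0" using R x by auto
  define u where "u = (t / norm x) *\<^sub>R x"
  have u: "norm u = t" "dist u x = norm x - t"
    unfolding u_def using point_on_radius[OF x0, of t] t R x by auto
  obtain p where p: "p \<in> T" "dist u p < \<eta>" using dense[of u] u t by auto
  have "dist x p \<le> dist u x + dist u p" using dist_triangle[of x p u] by (simp add: dist_commute)
  also have "\<dots> < 1" using u t p by linarith
  finally show ?thesis using p by blast
qed

context poisson_process
begin

lemma ex_prob_pos:
  assumes "A \<in> events" "0 < prob A" "\<And>n. B n \<in> events" "A \<subseteq> (\<Union>n::nat. B n)"
  shows "\<exists>n. 0 < prob (B n)"
proof (rule ccontr)
  assume "\<not> ?thesis"
  then have "prob (B n) = 0" for n by (metis measure_nonneg order_less_le)
  then have "emeasure P (B n) = 0" for n by (simp add: emeasure_eq_measure)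
  then have "emeasure P (\<Union>n. B n) = 0" using assms(3) by (intro emeasure_UN_eq_0) auto
  moreover have "emeasure P A \<le> emeasure P (\<Union>n. B n)" using assms by (intro emeasure_mono) auto
  ultimately have "emeasure P A = 0" by simp
  then show False using assms(2) by (simp add: emeasure_eq_measure)
qed

text \<open>
A filling by at least one point in each of finitely many disjoint balls has positive probability.
\<close>

lemma fill_event:
  assumes W: "open W" "bounded W" and \<eta>: "0 < \<eta>"
  obtains F where "F \<in> sets (region W)" "0 < prob F"
    "\<And>X u. X \<in> F \<Longrightarrow> u \<in> W \<Longrightarrow> \<exists>p\<in>X \<inter> W. dist u p < \<eta>"
proof -
  obtain N \<rho> where N: "finite N" "0 < \<rho>" "\<rho> \<le> \<eta> / 2" "\<forall>c\<in>N. ball c \<rho> \<subseteq> W"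
    "\<forall>c\<in>N. \<forall>d\<in>N. c \<noteq> d \<longrightarrow> ball c \<rho> \<inter> ball d \<rho> = {}" "W \<subseteq> (\<Union>c\<in>N. ball c (\<eta> / 2))"
    by (rule finite_net_of_open_set[OF W \<eta>])
  define F where "F = {X \<in> configurations. \<forall>c\<in>N. X \<inter> ball c \<rho> \<noteq> {}}"
  have F: "F \<in> sets (region (\<Union>c\<in>N. ball c \<rho>))" "0 < prob F"
    unfolding F_def using hits_disjoint_balls[OF N(1,2)] N(5) hit_prob_pos[OF N(2)] by simp_all
  have "F \<in> sets (region W)" by (rule region_mono[OF _ F(1)]) (use N(4) in blast)
  moreover have "\<exists>p\<in>X \<inter> W. dist u p < \<eta>" if X: "X \<in> F" and u: "u \<in> W" for X u
  proof -
    obtain c where c: "c \<in> N" "u \<in> ball c (\<eta> / 2)" using N(6) u by blast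
    then obtain p where p: "p \<in> X" "p \<in> ball c \<rho>" using X unfolding F_def by blast
    have "dist u p < \<eta>"
      using c(2) p(2) N(3) dist_triangle_less_add[of u c "\<eta>/2" p "\<eta>/2"] by (simp add: dist_commute)
    then show ?thesis using p N(4) c(1) by blast
  qed
  ultimately show ?thesis using that F(2) by blast
qed

end

section \<open>Translates\<close>

lemma shift_uminus [simp]: "shift (- v) (shift v A) = A"
  by (simp add: shift_def image_image)

lemma linked_shift1: "linked A x y \<Longrightarrow> linked (shift v A) (x - v) (y - v)"
proof (induction rule: linked_induct)
  case refl
  then show ?case by (simp add: shift_def)
next
  case (step y z)
  have "y \<in> A" using step linked_in by blast
  then have "linked (shift v A) (y - v) (z - v)"
    using step by (intro linked_step) (auto simp: shift_def dist_norm)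
  then show ?case using step linked_trans by blast
qed

lemma linked_shift: "linked (shift v A) (x - v) (y - v) \<longleftrightarrow> linked A x y"
  using linked_shift1[of A x y v] linked_shift1[of "shift v A" "x - v" "y - v" "- v"] by auto

lemma linked_shift_iff: "linked (shift v A) x y \<longleftrightarrow> linked A (x + v) (y + v)"
  using linked_shift[of v A "x + v" "y + v"] by simp

lemma percolates_shift: "percolates (shift v A) x \<longleftrightarrow> percolates A (x + v)"
proof -
  have "{y. linked A (x + v) y} = (\<lambda>y. y + v) ` {y. linked (shift v A) x y}"
  proof (intro set_eqI iffI)
    fix y assume "y \<in> {y. linked A (x + v) y}"
    then have "y - v \<in> {y. linked (shift v A) x y}" by (simp add: linked_shift_iff)
    then show "y \<in> (\<lambda>y. y + v) ` {y. linked (shift v A) x y}" by (intro image_eqI[of _ _ "y - v"]) auto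
  qed (auto simp: linked_shift_iff)
  then show ?thesis unfolding percolates_def by (simp add: finite_image_iff)
qed

lemma shift_Diff_ball: "shift v A - ball 0 R = shift v (A - ball v R)"
  by (auto simp: shift_def dist_norm norm_minus_commute)

lemma shift_Int_ball: "shift v A \<inter> ball 0 R = shift v (A \<inter> ball v R)"
  by (auto simp: shift_def dist_norm norm_minus_commute)

text \<open>
Here \<open>r\<close> is the reach of the points in the ball: all points within this radius are adjacent to
them, so that the three clusters are joined through the ball.
\<close>

definition trifurcation :: "real \<Rightarrow> real \<Rightarrow> 'a::euclidean_space set \<Rightarrow> 'a \<Rightarrow> bool" where
  "trifurcation R r X v \<longleftrightarrow>
     (\<forall>x\<in>X \<inter> ball v R. \<forall>y\<in>X \<inter> ball v R. linked (X \<inter> ball v R) x y) \<and>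
     (\<forall>x\<in>X - ball v R. dist v x < r \<longrightarrow> (\<exists>p\<in>X \<inter> ball v R. dist x p < 1)) \<and>
     three_clusters (X - ball v R) (ball v r)"

lemma trifurcation_shift:
  assumes "trifurcation R r (shift v X) 0"
  shows "trifurcation R r X v"
  unfolding trifurcation_def
proof (intro conjI ballI impI)
  let ?O = "X - ball v R" let ?I = "X \<inter> ball v R"
  have a: "\<And>x y. x \<in> shift v ?I \<Longrightarrow> y \<in> shift v ?I \<Longrightarrow> linked (shift v ?I) x y"
    "\<And>x. x \<in> shift v ?O \<Longrightarrow> norm x < r \<Longrightarrow> \<exists>p\<in>shift v ?I. dist x p < 1"
    "three_clusters (shift v ?O) (ball 0 r)"
    using assms unfolding trifurcation_def shift_Diff_ball shift_Int_ball by auto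
  show "linked ?I x y" if "x \<in> ?I" "y \<in> ?I" for x y
    using a(1)[of "x - v" "y - v"] that unfolding linked_shift by (auto simp: shift_def)
  show "\<exists>p\<in>?I. dist x p < 1" if "x \<in> ?O" "dist v x < r" for x
  proof -
    have "x - v \<in> shift v ?O" using that(1) unfolding shift_def by blast
    moreover have "norm (x - v) < r" using that(2) by (simp add: dist_norm norm_minus_commute)
    ultimately obtain p where "p \<in> shift v ?I" "dist (x - v) p < 1" using a(2) by blast
    then obtain q where "q \<in> ?I" "dist (x - v) (q - v) < 1" unfolding shift_def by blast
    then show ?thesis by (intro bexI[of _ q]) (simp_all add: dist_norm)
  qed
  obtain x y z where xyz: "x \<in> ball 0 r" "y \<in> ball 0 r" "z \<in> ball 0 r"
    "percolates (shift v ?O) x" "percolates (shift v ?O) y" "percolates (shift v ?O) z"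
    "\<not> linked (shift v ?O) x y" "\<not> linked (shift v ?O) y z" "\<not> linked (shift v ?O) x z"
    using a(3) unfolding three_clusters_def by blast
  have "x + v \<in> ball v r" "y + v \<in> ball v r" "z + v \<in> ball v r" using xyz(1-3) by (auto simp: dist_norm)
  then show "three_clusters ?O (ball v r)"
    using xyz(4-9) unfolding three_clusters_def linked_shift_iff percolates_shift by blast
qed

section \<open>A lattice of balls\<close>

definition lattice :: "real \<Rightarrow> nat \<Rightarrow> 'a::euclidean_space set" where
  "lattice s n = (\<lambda>f. \<Sum>b\<in>Basis. (s * real (f b)) *\<^sub>R b) ` (PiE Basis (\<lambda>_. {..<n}))"

lemma inner_lattice_point:
  "c \<in> Basis \<Longrightarrow> (\<Sum>b\<in>Basis. (s * real (f b)) *\<^sub>R b) \<bullet> (c::'a::euclidean_space) = s * real (f c)"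
  by (simp add: inner_sum_left inner_Basis if_distrib cong: if_cong)

lemma card_lattice:
  assumes "s > 0"
  shows "finite (lattice s n :: 'a::euclidean_space set)" "card (lattice s n :: 'a set) = n ^ DIM('a)"
proof -
  have "inj_on (\<lambda>f. \<Sum>b\<in>Basis. (s * real (f b)) *\<^sub>R (b::'a)) (PiE Basis (\<lambda>_. {..<n}))"
  proof (rule inj_onI)
    fix f g :: "'a \<Rightarrow> nat"
    assume fg: "f \<in> PiE Basis (\<lambda>_. {..<n})" "g \<in> PiE Basis (\<lambda>_. {..<n})"
      and eq: "(\<Sum>b\<in>Basis. (s * real (f b)) *\<^sub>R (b::'a)) = (\<Sum>b\<in>Basis. (s * real (g b)) *\<^sub>R b)"
    show "f = g"
    proof (rule PiE_ext[OF fg])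
      fix c :: 'a assume c: "c \<in> Basis"
      have "s * real (f c) = s * real (g c)"
        using arg_cong[OF eq, of "\<lambda>x. x \<bullet> c"] unfolding inner_lattice_point[OF c] .
      then show "f c = g c" using assms by simp
    qed
  qed
  then show "card (lattice s n :: 'a set) = n ^ DIM('a)"
    unfolding lattice_def by (simp add: card_image card_PiE)
  show "finite (lattice s n :: 'a set)" unfolding lattice_def by (intro finite_imageI finite_PiE) auto
qed

lemma lattice_balls_disjoint:
  fixes v w :: "'a::euclidean_space"
  assumes R: "0 < R" and vw: "v \<in> lattice (2 * R) n" "w \<in> lattice (2 * R) n" "v \<noteq> w"
  shows "ball v R \<inter> ball w R = {}"
proof (rule ccontr)
  assume "ball v R \<inter> ball w R \<noteq> {}"
  then obtain z where "z \<in> ball v R" "z \<in> ball w R" by blast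
  then have d: "dist v w < 2 * R" using dist_triangle_less_add[of v z R w R] by (simp add: dist_commute)
  obtain f where f: "v = (\<Sum>b\<in>Basis. (2 * R * real (f b)) *\<^sub>R b)" using vw(1) unfolding lattice_def by blast
  obtain g where g: "w = (\<Sum>b\<in>Basis. (2 * R * real (g b)) *\<^sub>R b)" using vw(2) unfolding lattice_def by blast
  have "f c = g c" if c: "c \<in> Basis" for c
  proof (rule ccontr)
    assume "f c \<noteq> g c"
    then have "1 \<le> \<bar>real (f c) - real (g c)\<bar>" by (cases "f c < g c") auto
    then have "2 * R * 1 \<le> 2 * R * \<bar>real (f c) - real (g c)\<bar>" using R by (intro mult_left_mono) auto
    also have "\<dots> = \<bar>(v - w) \<bullet> c\<bar>"
      unfolding f g inner_diff_left inner_lattice_point[OF c] using R by (simp add: abs_mult flip: right_diff_distrib)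
    also have "\<dots> \<le> norm (v - w)" by (rule Basis_le_norm[OF c])
    finally show False using d by (simp add: dist_norm)
  qed
  then have "v = w" unfolding f g by simp
  then show False using vw(3) by simp
qed

text \<open>
The smallest box that contains the balls of radius \<open>R\<close> around the points of \<open>lattice (2 * R) n\<close>,
widened by \<open>a\<close> on each side.
\<close>

definition big_box :: "real \<Rightarrow> real \<Rightarrow> nat \<Rightarrow> 'a::euclidean_space set" where
  "big_box R a n = cbox (\<Sum>b\<in>Basis. (- R - a) *\<^sub>R b) (\<Sum>b\<in>Basis. (2 * R * real n - R + a) *\<^sub>R b)"

lemma mem_big_box:
  "x \<in> big_box R a n \<longleftrightarrow> (\<forall>c\<in>Basis. - R - a \<le> x \<bullet> c \<and> x \<bullet> c \<le> 2 * R * real n - R + a)"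
  by (simp add: big_box_def mem_box inner_sum_left inner_Basis if_distrib cong: if_cong)

lemma measure_big_box:
  assumes "0 \<le> R" "0 \<le> a"
  shows "measure lborel (big_box R a n :: 'a::euclidean_space set) = (2 * R * real n + 2 * a) ^ DIM('a)"
proof -
  have "0 \<le> 2 * R * real n" using assms by simp
  then have "\<forall>c\<in>Basis. (\<Sum>b\<in>Basis. (- R - a) *\<^sub>R b) \<bullet> (c::'a) \<le> (\<Sum>b\<in>Basis. (2 * R * real n - R + a) *\<^sub>R b) \<bullet> c"
    using assms by (simp add: inner_sum_left inner_Basis if_distrib cong: if_cong)
  then show ?thesis unfolding big_box_def
    by (subst content_cbox') (auto simp: box_ne_empty inner_sum_left inner_Basis if_distrib cong: if_cong)
qed

lemma lattice_ball_subset_big_box: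
  fixes v :: "'a::euclidean_space"
  assumes R: "0 < R" and v: "v \<in> lattice (2 * R) n"
  shows "ball v R \<subseteq> big_box R 0 n"
proof
  fix x assume x: "x \<in> ball v R"
  obtain f where f: "f \<in> PiE Basis (\<lambda>_. {..<n})" "v = (\<Sum>b\<in>Basis. (2 * R * real (f b)) *\<^sub>R b)"
    using v unfolding lattice_def by blast
  show "x \<in> big_box R 0 n" unfolding mem_big_box
  proof
    fix c :: 'a assume c: "c \<in> Basis"
    have "\<bar>(x - v) \<bullet> c\<bar> \<le> norm (x - v)" by (rule Basis_le_norm[OF c])
    also have "\<dots> < R" using x by (simp add: dist_norm norm_minus_commute)
    finally have 1: "\<bar>x \<bullet> c - 2 * R * real (f c)\<bar> < R"
      by (simp add: inner_diff_left f(2) inner_lattice_point[OF c])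
    have "f c < n" using f(1) c by (auto simp: PiE_def Pi_def)
    then have "real (f c) \<le> real n - 1" by linarith
    then have "2 * R * real (f c) \<le> 2 * R * (real n - 1)" using R by (intro mult_left_mono) auto
    also have "\<dots> = 2 * R * real n - 2 * R" by (simp add: right_diff_distrib)
    finally have 2: "2 * R * real (f c) \<le> 2 * R * real n - 2 * R" .
    have 3: "0 \<le> 2 * R * real (f c)" using R by simp
    show "- R - 0 \<le> x \<bullet> c \<and> x \<bullet> c \<le> 2 * R * real n - R + 0"
      using 1 2 3 unfolding abs_less_iff by linarith
  qed
qed

lemma big_box_neighbour:
  fixes u w :: "'a::euclidean_space"
  assumes "u \<in> big_box R 0 n" "dist u w < 1"
  shows "w \<in> big_box R 1 n"
  unfolding mem_big_box
proof
  fix c :: 'a assume c: "c \<in> Basis"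
  have "\<bar>(u - w) \<bullet> c\<bar> \<le> norm (u - w)" by (rule Basis_le_norm[OF c])
  then have "\<bar>u \<bullet> c - w \<bullet> c\<bar> < 1" using assms(2) by (simp add: dist_norm inner_diff_left)
  moreover have "- R - 0 \<le> u \<bullet> c" "u \<bullet> c \<le> 2 * R * real n - R + 0" using assms(1) c unfolding mem_big_box by blast+
  ultimately show "- R - 1 \<le> w \<bullet> c \<and> w \<bullet> c \<le> 2 * R * real n - R + 1" by linarith
qed

lemma big_box_mono: "0 \<le> a \<Longrightarrow> big_box R 0 n \<subseteq> big_box R a n"
  by (force simp: mem_big_box)

section \<open>At most two unbounded clusters\<close>

context poisson_process
begin

text \<open>
The left-hand side is the expected number of lattice points at which a translate of \<open>A\<close> occurs, the
right-hand side is the expected number of Poisson points in the boundary layer of the box.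
\<close>

lemma trifurcation_density_bound:
  assumes A: "A \<in> events" and tri: "\<And>X. X \<in> A \<Longrightarrow> trifurcation R r X 0" and R: "0 < R"
  shows "real n ^ DIM('a) * prob A \<le> \<zeta> * ((2 * R * real n + 2) ^ DIM('a) - (2 * R * real n) ^ DIM('a))"
proof -
  let ?I = "lattice (2 * R) n :: 'a set"
  let ?Q = "big_box R 0 n :: 'a set" and ?Q' = "big_box R 1 n :: 'a set"
  define Av where "Av v = {X \<in> configurations. shift v X \<in> A}" for v
  have Av: "Av v \<in> events" "prob (Av v) = prob A" for v
    unfolding Av_def using prob_shift[OF A] by auto
  have I: "finite ?I" "card ?I = n ^ DIM('a)" using card_lattice[of "2 * R" n, where 'a = 'a] R by auto
  have bb: "bounded ?Q" "bounded ?Q'" "?Q \<in> sets borel" "?Q' \<in> sets borel"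
    unfolding big_box_def by (auto intro: bounded_cbox)
  have count: "(\<Sum>v\<in>?I. indicator (Av v) X) \<le> ennreal (real (card (X \<inter> (?Q' - ?Q))))"
    if X: "X \<in> configurations" for X
  proof -
    define J where "J = {v \<in> ?I. X \<in> Av v}"
    have T: "trifurcation R r X v" if "v \<in> J" for v
      using that tri trifurcation_shift unfolding J_def Av_def by blast
    have "card J \<le> card (X \<inter> (?Q' - ?Q))"
    proof (rule card_trifurcation_balls_le[OF X, where R = R and r = r])
      show "finite J" using I(1) by (simp add: J_def)
      show "ball v R \<inter> ball w R = {}" if "v \<in> J" "w \<in> J" "v \<noteq> w" for v w
        using lattice_balls_disjoint[OF R] that unfolding J_def by blast
      show "ball v R \<subseteq> ?Q" if "v \<in> J" for v
        using lattice_ball_subset_big_box[OF R] that unfolding J_def by blast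
      show "w \<in> ?Q'" if "u \<in> ?Q" "dist u w < 1" for u w using big_box_neighbour that .
      show "linked (X \<inter> ball v R) x y" if "v \<in> J" "x \<in> X \<inter> ball v R" "y \<in> X \<inter> ball v R" for v x y
        using T[OF that(1)] that(2,3) unfolding trifurcation_def by blast
      show "\<exists>p\<in>X \<inter> ball v R. dist x p < 1" if "v \<in> J" "x \<in> X - ball v R" "dist v x < r" for v x
        using T[OF that(1)] that(2,3) unfolding trifurcation_def by blast
      show "three_clusters (X - ball v R) (ball v r)" if "v \<in> J" for v
        using T[OF that(1)] unfolding trifurcation_def by blast
    qed (rule bb)+
    moreover have "(\<Sum>v\<in>?I. indicator (Av v) X) = (of_nat (card J) :: ennreal)"
    proof -
      have "(\<Sum>v\<in>?I. indicator (Av v) X) = (\<Sum>v\<in>?I. if X \<in> Av v then 1 else (0::ennreal))"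
        by (intro sum.cong) (auto simp: indicator_def)
      also have "\<dots> = of_nat (card J)" unfolding J_def using I(1) by (simp add: sum.If_cases Int_def)
      finally show ?thesis .
    qed
    ultimately show ?thesis by (simp add: ennreal_of_nat_eq_real_of_nat)
  qed
  have "ennreal (real n ^ DIM('a) * prob A) = (\<Sum>v\<in>?I. emeasure P (Av v))"
    by (simp add: emeasure_eq_measure Av I ennreal_mult' flip: ennreal_of_nat_eq_real_of_nat)
      (simp add: ennreal_of_nat_eq_real_of_nat flip: ennreal_power)
  also have "\<dots> = (\<integral>\<^sup>+ X. (\<Sum>v\<in>?I. indicator (Av v) X) \<partial>P)"
    using Av by (subst nn_integral_sum) auto
  also have "\<dots> \<le> (\<integral>\<^sup>+ X. ennreal (real (card (X \<inter> (?Q' - ?Q)))) \<partial>P)"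
    by (rule nn_integral_mono) (simp add: count)
  also have "\<dots> = ennreal (\<zeta> * measure lborel (?Q' - ?Q))"
    using bb by (intro expected_card) (auto intro: bounded_diff)
  also have "measure lborel (?Q' - ?Q) = (2 * R * real n + 2) ^ DIM('a) - (2 * R * real n) ^ DIM('a)"
  proof -
    have "measure lborel (?Q' - ?Q) = measure lborel ?Q' - measure lborel ?Q"
      using bb emeasure_bounded_finite[OF bb(2)] big_box_mono[of 1 R n, where 'a = 'a]
      by (intro measure_Diff) auto
    then show ?thesis using R by (simp add: measure_big_box)
  qed
  finally have *: "ennreal (real n ^ DIM('a) * prob A) \<le>
    ennreal (\<zeta> * ((2 * R * real n + 2) ^ DIM('a) - (2 * R * real n) ^ DIM('a)))" .
  have "(2 * R * real n) ^ DIM('a) \<le> (2 * R * real n + 2) ^ DIM('a)" using R by (intro power_mono) auto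
  then have "0 \<le> \<zeta> * ((2 * R * real n + 2) ^ DIM('a) - (2 * R * real n) ^ DIM('a))"
    using intensity_pos by (intro mult_nonneg_nonneg) auto
  with * show ?thesis by (simp add: ennreal_le_iff)
qed

text \<open>
Divide the previous bound by \<open>n^d\<close>: volume beats surface.
\<close>

lemma trifurcations_null:
  assumes A: "A \<in> events" and tri: "\<And>X. X \<in> A \<Longrightarrow> trifurcation R r X 0" and R: "0 < R"
  shows "prob A = 0"
proof -
  let ?d = "DIM('a)"
  have "prob A \<le> \<zeta> * ((2 * R + 2 / real n) ^ ?d - (2 * R) ^ ?d)" if n: "1 \<le> n" for n
  proof -
    have n0: "0 < real n ^ ?d" using n by simp
    have e: "2 * R * real n + 2 = (2 * R + 2 / real n) * real n" using n by (simp add: distrib_right)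
    have "real n ^ ?d * prob A \<le> real n ^ ?d * (\<zeta> * ((2 * R + 2 / real n) ^ ?d - (2 * R) ^ ?d))"
      using trifurcation_density_bound[OF A tri R, of n] unfolding e power_mult_distrib
      by (simp add: algebra_simps)
    then show ?thesis using n0 by simp
  qed
  moreover have "(\<lambda>n. \<zeta> * ((2 * R + 2 / real n) ^ ?d - (2 * R) ^ ?d)) \<longlonglongrightarrow> \<zeta> * ((2 * R + 0) ^ ?d - (2 * R) ^ ?d)"
    by (intro tendsto_intros lim_const_over_n)
  ultimately have "prob A \<le> \<zeta> * ((2 * R + 0) ^ ?d - (2 * R) ^ ?d)"
    by (intro LIMSEQ_le_const) auto
  then show ?thesis using measure_nonneg[of P A] by simp
qed

text \<open>
Three infinite clusters meet some ball of radius \<open>R\<close>.  Without the points in the ball there are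
still three infinite clusters, and they come within the radius \<open>R + 1 - \<eta>\<close> for some \<open>\<eta> > 0\<close>.  This
event is independent of the event that the ball is filled densely, and the intersection of both
consists of trifurcations.
\<close>

lemma three_clusters_null: "prob {X \<in> configurations. three_clusters X UNIV} = 0"
proof (rule ccontr)
  assume "prob {X \<in> configurations. three_clusters X UNIV} \<noteq> 0"
  then have pos: "0 < prob {X \<in> configurations. three_clusters X UNIV}"
    using measure_nonneg order_less_le by metis
  (* The index k encodes the radius and the margin 1 / (j + 2), so that a single countable
     union covers all cases. *)
  define rad where "rad k = real (fst (prod_decode k)) + 1" for k
  define gap where "gap k = 1 / real (snd (prod_decode k) + 2)" for k
  define G where "G k = {X \<in> configurations. three_clusters X
    (ball (0::'a) (rad k + 1 - gap k))}" for k
  have G: "G k \<in> sets configuration_space" for k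
    unfolding G_def by (intro pred_configI pred_three_clusters) simp
  define H where "H k = {X \<in> configurations. X - ball 0 (rad k) \<in> G k}" for k
  have H: "H k \<in> sets (region (- ball 0 (rad k)))" for k
    unfolding H_def by (intro delete_in_region G) simp
  have "\<exists>k. 0 < prob (H k)"
  proof (rule ex_prob_pos[OF _ pos])
    show "{X \<in> configurations. three_clusters X (UNIV :: 'a set)} \<in> events"
      by (intro pred_event pred_three_clusters) simp
    show "H k \<in> events" for k using H region_event by blast
    show "{X \<in> configurations. three_clusters X UNIV} \<subseteq> (\<Union>k. H k)"
    proof
      fix X :: "'a set" assume "X \<in> {X \<in> configurations. three_clusters X UNIV}"
      then obtain x y z where X: "X \<in> configurations" and p: "percolates X x" "percolates X y" "percolates X z"
        and n: "\<not> linked X x y" "\<not> linked X y z" "\<not> linked X x z"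
        unfolding three_clusters_def by blast
      obtain m :: nat where "max (norm x) (max (norm y) (norm z)) \<le> real m" using real_arch_simple by blast
      then have m: "x \<in> ball 0 (real m + 1)" "y \<in> ball 0 (real m + 1)" "z \<in> ball 0 (real m + 1)" by auto
      let ?r = "real m + 1" let ?O = "X - ball 0 ?r"
      obtain x' where x': "percolates ?O x'" "norm x' < ?r + 1" "linked X x x'"
        by (rule percolates_outside_ball[OF X p(1) m(1)])
      obtain y' where y': "percolates ?O y'" "norm y' < ?r + 1" "linked X y y'"
        by (rule percolates_outside_ball[OF X p(2) m(2)])
      obtain z' where z': "percolates ?O z'" "norm z' < ?r + 1" "linked X z z'"
        by (rule percolates_outside_ball[OF X p(3) m(3)])
      have "\<not> linked X x' y'" "\<not> linked X y' z'" "\<not> linked X x' z'"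
        using x'(3) y'(3) z'(3) n by (meson linked_sym linked_trans)+
      then have n': "\<not> linked ?O x' y'" "\<not> linked ?O y' z'"
        "\<not> linked ?O x' z'"
        using linked_mono by blast+
      define g where "g = ?r + 1 - max (norm x') (max (norm y') (norm z'))"
      have "0 < g" using x' y' z' by (simp add: g_def)
      then obtain j :: nat where j: "inverse (real (Suc j)) < g" using reals_Archimedean by blast
      have "1 / real (j + 2) \<le> inverse (real (Suc j))" by (simp add: field_simps)
      then have "1 / real (j + 2) < g" using j by linarith
      then have b: "x' \<in> ball 0 (?r + 1 - 1 / real (j + 2))" "y' \<in> ball 0 (?r + 1 - 1 / real (j + 2))"
        "z' \<in> ball 0 (?r + 1 - 1 / real (j + 2))" unfolding g_def by auto
      have "three_clusters ?O (ball 0 (?r + 1 - 1 / real (j + 2)))"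
        unfolding three_clusters_def using b x'(1) y'(1) z'(1) n' by blast
      then have "X \<in> H (prod_encode (m, j))"
        unfolding H_def G_def rad_def gap_def using X by (auto intro: config_subset)
      then show "X \<in> (\<Union>k. H k)" by blast
    qed
  qed
  then obtain k where k: "0 < prob (H k)" by blast
  define R where "R = rad k"
  define \<eta> where "\<eta> = gap k"
  have R: "0 < R" by (simp add: R_def rad_def)
  have \<eta>: "0 < \<eta>" "\<eta> \<le> 1 / 2" by (simp_all add: \<eta>_def gap_def field_simps)
  obtain F where F: "F \<in> sets (region (ball 0 R))" "0 < prob F"
    "\<And>X u. X \<in> F \<Longrightarrow> u \<in> ball 0 R \<Longrightarrow> \<exists>p\<in>X \<inter> ball 0 R. dist u p < \<eta>"
    using fill_event[OF open_ball bounded_ball \<eta>(1), of 0 R] by blast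
  have "prob (F \<inter> H k) = prob F * prob (H k)"
    using prob_region_Int[OF F(1) H[of k, folded R_def]] by blast
  then have "0 < prob (F \<inter> H k)" using F(2) k by simp
  moreover have "prob (F \<inter> H k) = 0"
  proof (rule trifurcations_null[OF _ _ R, where r = "R + 1 - \<eta>"])
    show "F \<inter> H k \<in> events" using region_event[OF F(1)] region_event[OF H] by blast
    fix X assume X: "X \<in> F \<inter> H k"
    have d: "\<exists>p\<in>X \<inter> ball 0 R. dist u p < \<eta>" if "u \<in> ball 0 R" for u using F(3) X that by blast
    show "trifurcation R (R + 1 - \<eta>) X 0" unfolding trifurcation_def
    proof (intro conjI ballI impI)
      fix x y assume xy: "x \<in> X \<inter> ball 0 R" "y \<in> X \<inter> ball 0 R"
      have "\<exists>p\<in>X \<inter> ball 0 R. dist u p < 1 / 2" if "u \<in> ball 0 R" for u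
        using d[OF that] \<eta>(2) by (meson order_less_le_trans)
      then show "linked (X \<inter> ball 0 R) x y"
        by (intro linked_if_dense[OF convex_connected[OF convex_ball] _ xy])
    next
      fix x assume x: "x \<in> X - ball 0 R" "dist 0 x < R + 1 - \<eta>"
      show "\<exists>p\<in>X \<inter> ball 0 R. dist x p < 1"
        by (rule dense_adjacent[of 0 R \<eta> x]) (use R \<eta> x d in auto)
    next
      show "three_clusters (X - ball 0 R) (ball 0 (R + 1 - \<eta>))"
        using X unfolding H_def G_def R_def \<eta>_def by simp
    qed
  qed
  ultimately show False by simp
qed

end

section \<open>The lower bound\<close>

abbreviation clusters_reach :: "'a::real_normed_vector set \<Rightarrow> real \<Rightarrow> bool" where
  "clusters_reach A r \<equiv> (\<exists>x. percolates A x) \<and>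
     (\<forall>x. percolates A x \<longrightarrow> (\<exists>y\<in>ball 0 r. linked A x y))"

definition thin_shell :: "real \<Rightarrow> 'a::euclidean_space set" where
  "thin_shell \<epsilon> = ball 0 (1 / 2) - cball 0 (1 / 2 - \<epsilon>)"

lemma power_diff_bounds:
  fixes x y :: real
  assumes "0 \<le> y" "y \<le> x" "x \<le> 1"
  shows "x ^ d - y ^ d \<le> real d * (x - y)" "0 < d \<Longrightarrow> x ^ (d - 1) * (x - y) \<le> x ^ d - y ^ d"
proof -
  show "x ^ d - y ^ d \<le> real d * (x - y)"
  proof (induction d)
    case (Suc d)
    have "x ^ Suc d - y ^ Suc d = x * (x ^ d - y ^ d) + (x - y) * y ^ d" by (simp add: algebra_simps)
    also have "\<dots> \<le> 1 * (x ^ d - y ^ d) + (x - y) * 1"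
      using assms power_mono[of y x d] power_le_one[of y d]
      by (intro add_mono mult_right_mono mult_left_mono) auto
    also have "\<dots> \<le> real (Suc d) * (x - y)" using Suc by (simp add: algebra_simps)
    finally show ?case .
  qed simp
  show "x ^ (d - 1) * (x - y) \<le> x ^ d - y ^ d" if "0 < d"
  proof -
    have "y ^ (d - 1) * y \<le> x ^ (d - 1) * y"
      using assms by (intro mult_right_mono power_mono) auto
    moreover have "z ^ d = z ^ (d - 1) * z" for z :: real
      using that by (metis power_minus_mult)
    ultimately show ?thesis by (simp add: right_diff_distrib)
  qed
qed

lemma thin_shell_sets: "thin_shell \<epsilon> \<in> sets borel" "bounded (thin_shell \<epsilon>)"
  unfolding thin_shell_def by (auto intro: bounded_diff)

lemma measure_thin_shell:
  assumes "0 < \<epsilon>" "\<epsilon> \<le> 1 / 2"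
  shows "measure lborel (thin_shell \<epsilon> :: 'a::euclidean_space set) =
    unit_ball_vol (DIM('a)) * ((1 / 2) ^ DIM('a) - (1 / 2 - \<epsilon>) ^ DIM('a))"
proof -
  have "cball 0 (1 / 2 - \<epsilon>) \<subseteq> (ball 0 (1 / 2) :: 'a set)" using assms by auto
  then have "measure lborel (thin_shell \<epsilon> :: 'a set) =
      measure lborel (ball (0::'a) (1 / 2)) - measure lborel (cball (0::'a) (1 / 2 - \<epsilon>))"
    unfolding thin_shell_def using emeasure_bounded_finite[of "ball (0::'a) (1 / 2)"]
    by (intro measure_Diff) auto
  then show ?thesis using assms by (simp add: content_ball content_cball right_diff_distrib)
qed

text \<open>
The point \<open>y\<close> in the thin shell is linked to the annulus, and the annulus is linked to all infinite
clusters outside the ball of radius \<open>R\<close>.  Hence \<open>y\<close> belongs to the only infinite cluster, and its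
ball covers the origin.  All other points have norm greater than \<open>3/4\<close>, so that they do not cover
the point \<open>z\<close> of norm \<open>1/2 - |y|\<close> opposite to \<open>y\<close>.
\<close>

lemma Omega0_if_lone_point:
  fixes X :: "'a::euclidean_space set"
  assumes dim: "2 \<le> DIM('a)" and X: "X \<in> configurations"
    and R: "2 \<le> R" and \<eta>: "0 < \<eta>" "\<eta> \<le> 1 / 4" and \<epsilon>: "0 < \<epsilon>" "\<epsilon> \<le> 1 / 4"
    and dense: "\<And>u. 3 / 4 < norm u \<Longrightarrow> norm u < R \<Longrightarrow>
      \<exists>p\<in>X \<inter> {x. 3 / 4 < norm x \<and> norm x < R}. dist u p < \<eta>"
    and lone: "card (X \<inter> thin_shell \<epsilon>) = 1" "X \<inter> (cball 0 (3 / 4) - thin_shell \<epsilon>) = {}"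
    and ex: "\<exists>x. percolates (X - ball 0 R) x"
    and near: "\<And>x. percolates (X - ball 0 R) x \<Longrightarrow>
      \<exists>y. norm y < R + 1 - \<eta> \<and> linked (X - ball 0 R) x y"
  shows "X \<in> Omega0" "0 < boundary_dist X" "boundary_dist X < \<epsilon>"
proof -
  define W where "W = {x :: 'a. 3 / 4 < norm x \<and> norm x < R}"
  have W: "connected W"
    using connected_annulus(1)[OF dim, of "3 / 4" "0 :: 'a" R] by (simp add: W_def)
  obtain y where y': "X \<inter> thin_shell \<epsilon> = {y}" using lone(1) by (auto simp: card_1_singleton_iff)
  then have y: "y \<in> X" "y \<in> thin_shell \<epsilon>" by auto
  have ny: "1 / 2 - \<epsilon> < norm y" "norm y < 1 / 2" "y \<noteq> 0" using y(2) \<epsilon> by (auto simp: thin_shell_def)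
  have far: "p = y \<or> 3 / 4 < norm p" if "p \<in> X" for p
  proof (cases "norm p \<le> 3 / 4")
    case True
    then have "p \<in> thin_shell \<epsilon>" using lone(2) that by auto
    then show ?thesis using y' that by blast
  qed auto
  have WW: "linked X p q" if pq: "p \<in> X \<inter> W" "q \<in> X \<inter> W" for p q
  proof -
    have "\<exists>p\<in>X \<inter> W. dist u p < 1 / 2" if "u \<in> W" for u
    proof -
      obtain p where "p \<in> X \<inter> W" "dist u p < \<eta>" using dense[of u] \<open>u \<in> W\<close> unfolding W_def by blast
      then show ?thesis using \<eta>(2) by (intro bexI[of _ p]) auto
    qed
    from linked_if_dense[OF W this pq] show ?thesis by (rule linked_mono) auto
  qed
  obtain p where p: "p \<in> X \<inter> W" "linked X y p"
  proof -
    (* As |y| > 1/4, this point is closer than 5/8 to y, and the mesh eta adds at most 1/4. *)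
    define u where "u = ((7 / 8) / norm y) *\<^sub>R y"
    have u: "norm u = 7 / 8" "dist u y = \<bar>norm y - 7 / 8\<bar>"
      unfolding u_def using point_on_radius[OF ny(3), of "7/8"] by auto
    obtain p where p: "p \<in> X \<inter> W" "dist u p < \<eta>" using dense[of u] u R unfolding W_def by auto
    have "dist y p \<le> dist u y + dist u p" using dist_triangle[of y p u] by (simp add: dist_commute)
    also have "\<dots> < 1" using u p(2) ny \<eta> \<epsilon> by linarith
    finally have "linked X y p" using y(1) p(1) by (intro linked_step) auto
    then show ?thesis using that p(1) by blast
  qed
  have to_y: "linked X q y" if q: "q \<in> X \<inter> ball 0 R" for q
  proof (cases "q = y")
    case True
    then show ?thesis using y(1) by simp
  next
    case False
    then have "q \<in> X \<inter> W" using far[of q] q by (auto simp: W_def)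
    then have "linked X q p" using WW p(1) by blast
    then show ?thesis using linked_sym[OF p(2)] by (rule linked_trans)
  qed
  have perc: "percolates X y" "\<And>x. percolates X x \<Longrightarrow> linked X x y"
  proof (atomize (full), intro conjI allI impI)
    have conn: "linked X q q'" if "q \<in> X \<inter> ball 0 R" "q' \<in> X \<inter> ball 0 R" for q q'
      using to_y[OF that(1)] linked_sym[OF to_y[OF that(2)]] by (rule linked_trans)
    have t: "y \<in> X \<inter> ball 0 R" using y(1) ny R by auto
    have adj: "\<exists>p\<in>X \<inter> ball 0 R. dist v p < 1" if v: "v \<in> X - ball 0 R" "norm v < R + 1 - \<eta>" for v
    proof (rule dense_adjacent[of "3/4" R \<eta> v])
      fix u :: 'a assume "3 / 4 < norm u" "norm u < R"
      from dense[OF this] show "\<exists>p\<in>X \<inter> ball 0 R. dist u p < \<eta>" by auto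
    qed (use R \<eta> v in auto)
    show "percolates X y" by (rule unique_cluster_after_filling(1)[OF conn t adj ex near])
    show "linked X x y" if "percolates X x" for x
      by (rule unique_cluster_after_filling(2)[OF conn t adj ex near that])
  qed
  have yb: "y \<in> ball 0 (1 / 2)" using ny by simp
  have "linked X x x'" if "percolates X x" "percolates X x'" for x x'
    using perc(2)[OF that(1)] linked_sym[OF perc(2)[OF that(2)]] by (rule linked_trans)
  then show O: "X \<in> Omega0" unfolding Omega0_iff using X perc(1) yb by blast
  define t where "t = 1 / 2 - norm y"
  (* The ball around y is open, so that this point of its boundary is not covered. *)
  define z where "z = - ((t / norm y) *\<^sub>R y)"
  have t: "0 < t" "t < \<epsilon>" using ny by (auto simp: t_def)
  have nz: "norm z = t" unfolding z_def using point_on_radius(1)[OF ny(3), of t] t by simp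
  have "z \<notin> boolean_model X"
  proof
    assume "z \<in> boolean_model X"
    then obtain q where q: "q \<in> X" "dist q z < 1 / 2" unfolding boolean_model_def by auto
    show False
    proof (cases "q = y")
      case True
      have "y - z = (1 + t / norm y) *\<^sub>R y" by (simp add: z_def scaleR_add_left)
      then have "dist y z = \<bar>1 + t / norm y\<bar> * norm y" by (simp add: dist_norm)
      also have "\<dots> = (1 + t / norm y) * norm y" using t by simp
      also have "\<dots> = norm y + t" using ny(3) by (simp add: distrib_right)
      finally show False using q True by (simp add: t_def)
    next
      case False
      then have "3 / 4 < norm q" using far q by blast
      moreover have "norm q \<le> dist q z + norm z" using norm_triangle_sub[of q z] by (simp add: dist_norm)
      ultimately show False using q nz t \<epsilon> by linarith
    qed
  qed
  moreover obtain x where "infinite_cluster X = cluster_hull X x" using Omega0_cluster[OF O] by blast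
  ultimately have z: "z \<notin> infinite_cluster X" using cluster_hull_subset by blast
  then have ne: "infinite_cluster X \<noteq> UNIV" by blast
  show "0 < boundary_dist X" by (rule boundary_dist_pos[OF O ne])
  show "boundary_dist X < \<epsilon>" unfolding distance_less_iff[OF ne] using z nz t by blast
qed

context poisson_process
begin

text \<open>
Otherwise \<open>\<zeta>\<close> would be one of the intensities over which the supremum in the definition of the
critical intensity is taken.
\<close>

lemma percolation_possible:
  assumes super: "critical_intensity TYPE('a) < ennreal \<zeta>"
  shows "0 < prob {X \<in> configurations. \<exists>x. percolates X x}" (is "0 < prob ?A")
proof (rule ccontr)
  assume "\<not> ?thesis"
  then have 0: "prob ?A = 0"
    using measure_nonneg order_less_le by metis
  have eq: "?A = {X \<in> configurations. perc_in X UNIV}"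
    by (simp add: perc_in_def)
  have ev: "?A \<in> events"
    unfolding eq by (rule pred_event[OF pred_perc_in[OF open_UNIV]])
  have "AE X in P. unbounded_components X = {}"
  proof (rule AE_I)
    show "{X \<in> space P. unbounded_components X \<noteq> {}} \<subseteq> ?A"
      by (auto simp: unbounded_components_eq)
    show "emeasure P ?A = 0" using 0 by (simp add: emeasure_eq_measure)
  qed (rule ev)
  then have "ennreal \<zeta> \<le> critical_intensity TYPE('a)"
    unfolding critical_intensity_def using law intensity_pos by (intro Sup_upper) blast
  then show False using super by simp
qed

lemma at_most_two_clusters:
  assumes "percolates X x" "\<not> three_clusters X UNIV"
  obtains y where "percolates X y" "\<And>w. percolates X w \<Longrightarrow> linked X w x \<or> linked X w y"
proof (cases "\<forall>w. percolates X w \<longrightarrow> linked X w x")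
  case True
  then show ?thesis using that assms(1) by blast
next
  case False
  then obtain y where y: "percolates X y" "\<not> linked X y x" by blast
  have "linked X w x \<or> linked X w y" if "percolates X w" for w
    using assms y that unfolding three_clusters_def by (metis UNIV_I linked_sym)
  then show ?thesis using that y by blast
qed

text \<open>
A ball that meets each of the at most two infinite clusters is removed.  An infinite cluster of the
remaining configuration was linked to the ball, so that it contains a point at distance less than 1
from the ball; by local finiteness this holds with some room \<open>\<eta>\<close> to spare.
\<close>

lemma clusters_near_ball_possible:
  assumes super: "critical_intensity TYPE('a) < ennreal \<zeta>"
  obtains R \<eta> :: real and H where "2 \<le> R" "0 < \<eta>" "\<eta> \<le> 1 / 4" "H \<in> sets (region (- ball 0 R))" "0 < prob H"
    "\<And>X. X \<in> H \<Longrightarrow> X \<in> configurations \<and> clusters_reach (X - ball 0 R) (R + 1 - \<eta>)"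
proof -
  (* The index k encodes a pair. The offsets ensure that the radius is at least 2 and the gap
     at most 1/4. *)
  define rad where "rad k = real (fst (prod_decode k)) + 2" for k
  define gap where "gap k = 1 / real (snd (prod_decode k) + 4)" for k
  define G where "G k = {X \<in> configurations. perc_in X UNIV \<and>
    (\<forall>x. percolates X x \<longrightarrow> (\<exists>y\<in>ball (0::'a) (rad k + 1 - gap k). linked X x y))}" for k
  define H where "H k = {X \<in> configurations. X - ball 0 (rad k) \<in> G k}" for k
  have G: "G k \<in> sets configuration_space" for k
    unfolding G_def by (intro pred_configI pred_intros_logic pred_perc_in pred_percolating_near) auto
  have H: "H k \<in> sets (region (- ball 0 (rad k)))" for k
    unfolding H_def by (intro delete_in_region G) simp
  define A where "A = {X \<in> configurations. \<exists>x::'a. percolates X x}"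
  define B where "B = {X \<in> configurations. three_clusters X (UNIV :: 'a set)}"
  have A_eq: "A = {X \<in> configurations. perc_in X UNIV}" by (simp add: A_def perc_in_def)
  have A: "A \<in> events" unfolding A_eq by (rule pred_event[OF pred_perc_in[OF open_UNIV]])
  have B: "B \<in> events" unfolding B_def by (intro pred_event pred_three_clusters) simp
  have "prob (A - B) = prob A"
    using measure_Diff_null_set[of A P B] A B three_clusters_null
    by (simp add: B_def null_sets_def emeasure_eq_measure)
  then have pos: "0 < prob (A - B)" using percolation_possible[OF super] by (simp add: A_def)
  have "\<exists>k. 0 < prob (H k)"
  proof (rule ex_prob_pos[OF _ pos])
    show "A - B \<in> events" using A B by auto
    show "H k \<in> events" for k using H region_event by blast
    show "A - B \<subseteq> (\<Union>k. H k)"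
    proof
      fix X assume "X \<in> A - B"
      then obtain x where X: "X \<in> configurations" and x: "percolates X x" and n3: "\<not> three_clusters X UNIV"
        unfolding A_def B_def by blast
      obtain y where y: "percolates X y" "\<And>w. percolates X w \<Longrightarrow> linked X w x \<or> linked X w y"
        by (rule at_most_two_clusters[OF x n3]) blast
      obtain m :: nat where "max (norm x) (norm y) \<le> real m" using real_arch_simple by blast
      then have m: "x \<in> ball 0 (real m + 2)" "y \<in> ball 0 (real m + 2)" by auto
      define R where "R = real m + 2"
      define K where "K = insert 1 ((\<lambda>u. R + 1 - norm u) ` (X \<inter> ball 0 (R + 1)))"
      have finK: "finite K" unfolding K_def using finite_config_Int[OF X bounded_ball] by simp
      have "0 < Min K" using finK by (subst Min_gr_iff) (auto simp: K_def)
      then obtain j :: nat where "inverse (real (Suc j)) < Min K" using reals_Archimedean by blast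
      moreover have "1 / real (j + 4) \<le> inverse (real (Suc j))" by (simp add: field_simps)
      ultimately have j: "1 / real (j + 4) < Min K" by linarith
      have gap_ok: "norm u < R + 1 - 1 / real (j + 4)" if "u \<in> X" "norm u < R + 1" for u
      proof -
        have "Min K \<le> R + 1 - norm u" using finK that by (intro Min_le) (auto simp: K_def)
        then show ?thesis using j by linarith
      qed
      obtain x' where x': "percolates (X - ball 0 R) x'"
        using percolates_outside_ball[OF X x m(1)] unfolding R_def by blast
      have near: "\<exists>u\<in>ball 0 (R + 1 - 1 / real (j + 4)). linked (X - ball 0 R) w u"
        if w: "percolates (X - ball 0 R) w" for w
      proof -
        have "percolates X w" using percolates_mono[OF w] by blast
        then obtain q where q: "linked X w q" "q \<in> ball 0 R" using y(2) m unfolding R_def by blast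
        have wb: "w \<notin> ball 0 R" using percolates_in[OF w] by blast
        obtain u where u: "linked (X - ball 0 R) w u" "norm u < R + 1"
          by (rule linked_outside_touches[OF q(1) wb q(2)])
        have "u \<in> X" using linked_in[OF u(1)] by blast
        then have "u \<in> ball 0 (R + 1 - 1 / real (j + 4))" using gap_ok u(2) by simp
        then show ?thesis using u(1) by blast
      qed
      have "X \<in> H (prod_encode (m, j))"
        unfolding H_def G_def rad_def gap_def perc_in_def using X x' near config_subset[OF X, of "X - ball 0 R"]
        by (auto simp: R_def)
      then show "X \<in> (\<Union>k. H k)" by blast
    qed
  qed
  then obtain k where k: "0 < prob (H k)" by blast
  show ?thesis
  proof (rule that[OF _ _ _ H k])
    show "2 \<le> rad k" "0 < gap k" "gap k \<le> 1 / 4" by (simp_all add: rad_def gap_def field_simps)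
    fix X assume "X \<in> H k"
    then show "X \<in> configurations \<and> clusters_reach (X - ball 0 (rad k)) (rad k + 1 - gap k)"
      unfolding H_def G_def perc_in_def by blast
  qed
qed

lemma near_boundary_event: "near_boundary \<epsilon> \<in> events"
  using near_boundary_measurable sets_P by blast

lemma Omega0_event: "Omega0 \<in> events"
  using Omega0_measurable sets_P by blast

text \<open>
The value 0 is excluded because negative moments do not see it: \<open>0 powr x = 0\<close>.
\<close>

lemma near_boundary_pos_event: "near_boundary_pos \<epsilon> \<in> events"
proof -
  let ?s = "\<lambda>n. inverse (real (Suc n))"
  have "near_boundary (?s n) \<in> events" for n
    by (rule near_boundary_event)
  then have "near_boundary \<epsilon> - (\<Inter>n. near_boundary (?s n)) \<in> events"
    using near_boundary_event by blast
  also have "near_boundary \<epsilon> - (\<Inter>n. near_boundary (?s n)) =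
    near_boundary_pos \<epsilon>"
  proof -
    have key: "(\<forall>n. \<delta> < ?s n) \<longleftrightarrow> \<delta> \<le> 0" for \<delta> :: real
    proof
      assume "\<forall>n. \<delta> < ?s n"
      then show "\<delta> \<le> 0" using reals_Archimedean[of \<delta>] by (meson less_asym not_le)
    next
      assume "\<delta> \<le> 0"
      moreover have "0 < ?s n" for n by simp
      ultimately show "\<forall>n. \<delta> < ?s n" by (meson le_less_trans)
    qed
    have "near_boundary \<epsilon> - (\<Inter>n. near_boundary (?s n)) =
      {X \<in> Omega0. boundary_dist X < \<epsilon> \<and> \<not> (\<forall>n. boundary_dist X < ?s n)}" by blast
    also have "\<dots> = near_boundary_pos \<epsilon>"
      unfolding key not_le by blast
    finally show ?thesis .
  qed
  finally show ?thesis .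
qed

lemma small_distance_lower_bound:
  assumes dim: "2 \<le> DIM('a)" and super: "critical_intensity TYPE('a) < ennreal \<zeta>"
  obtains c where "0 < c"
    "\<And>\<epsilon>. 0 < \<epsilon> \<Longrightarrow> \<epsilon> \<le> 1 / 4 \<Longrightarrow> c * \<epsilon> \<le> prob (near_boundary_pos \<epsilon>)"
proof -
  obtain R \<eta> H where R: "2 \<le> R" and \<eta>: "0 < \<eta>" "\<eta> \<le> 1 / 4"
    and H: "H \<in> sets (region (- ball 0 R))" "0 < prob H"
    and HD: "\<And>X. X \<in> H \<Longrightarrow> X \<in> configurations \<and> clusters_reach (X - ball 0 R) (R + 1 - \<eta>)"
    by (rule clusters_near_ball_possible[OF super]) blast
  define W where "W = {x :: 'a. 3 / 4 < norm x \<and> norm x < R}"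
  have Weq: "W = ball 0 R - cball 0 (3 / 4)" by (auto simp: W_def)
  have Wo: "open W" "bounded W" unfolding Weq by (auto intro: bounded_diff)
  obtain F where F: "F \<in> sets (region W)" "0 < prob F"
    "\<And>X u. X \<in> F \<Longrightarrow> u \<in> W \<Longrightarrow> \<exists>p\<in>X \<inter> W. dist u p < \<eta>"
    by (rule fill_event[OF Wo \<eta>(1)]) blast
  let ?d = "DIM('a)"
  let ?m = "measure lborel (cball (0::'a) (3 / 4))"
  define c where "c = \<zeta> * (unit_ball_vol ?d * (1 / 2) ^ (?d - 1)) * exp (- (\<zeta> * ?m)) * prob F * prob H"
  have V: "0 < unit_ball_vol (real ?d)" by simp
  have c: "0 < c" unfolding c_def using intensity_pos V F(2) H(2) by simp
  have "c * \<epsilon> \<le> prob (near_boundary_pos \<epsilon>)" if \<epsilon>: "0 < \<epsilon>" "\<epsilon> \<le> 1 / 4" for \<epsilon>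
  proof -
    let ?S = "thin_shell \<epsilon> :: 'a set"
    have S: "?S \<in> sets borel" "bounded ?S" "?S \<subseteq> cball 0 (3 / 4)"
      using thin_shell_sets[of \<epsilon>] by (auto simp: thin_shell_def)
    define E1 where "E1 = {X \<in> configurations. card (X \<inter> ?S) = 1}"
    define E2 where "E2 = void (cball 0 (3 / 4) - ?S)"
    have E1: "E1 \<in> sets (region ?S)" unfolding E1_def by (rule card_in_region[OF S(1,2)]) simp
    have E2: "E2 \<in> sets (region (cball 0 (3 / 4) - ?S))" unfolding E2_def
      using S by (intro void_in_region) (auto intro: bounded_diff)
    have p12: "prob (E1 \<inter> E2) = prob E1 * prob E2" by (rule prob_region_Int[OF E1 E2]) blast
    have E12: "E1 \<inter> E2 \<in> sets (region (cball 0 (3 / 4)))"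
      by (intro sets.Int region_mono[OF _ E1] region_mono[OF _ E2]) (use S in auto)
    have pF: "prob (E1 \<inter> E2 \<inter> F) = prob (E1 \<inter> E2) * prob F"
      by (rule prob_region_Int[OF E12 F(1)]) (auto simp: Weq)
    have E12F: "E1 \<inter> E2 \<inter> F \<in> sets (region (ball 0 R))"
      by (intro sets.Int[of "E1 \<inter> E2"] region_mono[OF _ E12] region_mono[OF _ F(1)]) (use R in \<open>auto simp: Weq\<close>)
    have pH: "prob (E1 \<inter> E2 \<inter> F \<inter> H) = prob (E1 \<inter> E2 \<inter> F) * prob H"
      by (rule prob_region_Int[OF E12F H(1)]) blast
    (* The two exponential factors combine to one that does not depend on epsilon. *)
    have "measure lborel ?S + measure lborel (cball 0 (3 / 4) - ?S) = ?m"
    proof -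
      have "measure lborel (cball 0 (3 / 4) - ?S) = ?m - measure lborel ?S"
        using S emeasure_bounded_finite[OF bounded_cball, of "0::'a" "3/4"] by (intro measure_Diff) auto
      then show ?thesis by simp
    qed
    then have p: "prob E1 * prob E2 = \<zeta> * measure lborel ?S * exp (- (\<zeta> * ?m))"
      unfolding E1_def E2_def using S
      by (simp add: prob_card prob_void bounded_diff exp_add[symmetric] algebra_simps flip: distrib_left)
    have a: "unit_ball_vol ?d * (1 / 2) ^ (?d - 1) * \<epsilon> \<le> measure lborel ?S"
    proof -
      have "(1 / 2) ^ (?d - 1) * (1 / 2 - (1 / 2 - \<epsilon>)) \<le> (1 / 2) ^ ?d - (1 / 2 - \<epsilon>) ^ ?d"
        using \<epsilon> by (intro power_diff_bounds(2)) auto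
      then show ?thesis unfolding mult.assoc
        using measure_thin_shell[of \<epsilon>, where 'a = 'a] \<epsilon> V by (simp add: mult_left_mono)
    qed
    have "c * \<epsilon> = \<zeta> * (unit_ball_vol ?d * (1 / 2) ^ (?d - 1) * \<epsilon>) * exp (- (\<zeta> * ?m)) * prob F * prob H"
      by (simp add: c_def)
    also have "\<dots> \<le> \<zeta> * measure lborel ?S * exp (- (\<zeta> * ?m)) * prob F * prob H"
      using a intensity_pos by (intro mult_right_mono mult_left_mono) auto
    also have "\<dots> = prob (E1 \<inter> E2 \<inter> F \<inter> H)" unfolding pH pF p12 p ..
    also have "\<dots> \<le> prob (near_boundary_pos \<epsilon>)"
    proof (rule finite_measure_mono[OF _ near_boundary_pos_event])
      show "E1 \<inter> E2 \<inter> F \<inter> H \<subseteq> near_boundary_pos \<epsilon>"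
      proof
        fix X assume X: "X \<in> E1 \<inter> E2 \<inter> F \<inter> H"
        have h: "X \<in> configurations" "\<exists>x. percolates (X - ball 0 R) x"
          "\<forall>x. percolates (X - ball 0 R) x \<longrightarrow> (\<exists>y\<in>ball 0 (R + 1 - \<eta>). linked (X - ball 0 R) x y)"
          using HD[of X] X by simp_all
        have h3: "\<exists>y. norm y < R + 1 - \<eta> \<and> linked (X - ball 0 R) x y"
          if px: "percolates (X - ball 0 R) x" for x
        proof -
          obtain y where "y \<in> ball 0 (R + 1 - \<eta>)" "linked (X - ball 0 R) x y" using h(3) px by blast
          then show ?thesis by (intro exI[of _ y]) simp
        qed
        have d: "\<exists>p\<in>X \<inter> {x. 3 / 4 < norm x \<and> norm x < R}. dist u p < \<eta>"
          if "3 / 4 < norm u" "norm u < R" for u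
          using F(3)[of X u] X that unfolding W_def by blast
        have l: "card (X \<inter> ?S) = 1" "X \<inter> (cball 0 (3 / 4) - ?S) = {}"
          using X by (auto simp: E1_def E2_def void_def)
        show "X \<in> near_boundary_pos \<epsilon>"
          using Omega0_if_lone_point[OF dim h(1) R \<eta> \<epsilon> d l h(2) h3] by simp
      qed
    qed
    finally show ?thesis .
  qed
  then show ?thesis using that c by blast
qed

section \<open>The upper bound\<close>

text \<open>
A covered lattice requires a Poisson point in each of the disjoint balls around its \<open>n^d\<close> points.
\<close>

lemma full_cover_null: "prob {X \<in> configurations. \<forall>n. cball 0 (real n) \<subseteq> boolean_model X} = 0"
proof -
  let ?N = "{X \<in> configurations. \<forall>n. cball (0::'a) (real n) \<subseteq> boolean_model X}"
  have "prob ?N \<le> hit_prob (1 / 2) ^ n" for n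
  proof -
    let ?L = "lattice (2 * (1 / 2)) n :: 'a set"
    have L: "finite ?L" "card ?L = n ^ DIM('a)" by (rule card_lattice, simp)+
    let ?E = "{X \<in> configurations. \<forall>c\<in>?L. X \<inter> ball c (1 / 2) \<noteq> {}}"
    have E: "?E \<in> sets (region (\<Union>c\<in>?L. ball c (1 / 2))) \<and> prob ?E = hit_prob (1 / 2) ^ card ?L"
      by (rule hits_disjoint_balls[OF L(1)]) (use lattice_balls_disjoint[of "1/2"] in auto)
    have "prob ?N \<le> prob ?E"
    proof (rule finite_measure_mono)
      show "?E \<in> events" using E region_event by blast
      show "?N \<subseteq> ?E"
      proof (intro subsetI CollectI conjI ballI)
        fix X and c :: 'a assume X: "X \<in> ?N"
        obtain n where "norm c \<le> real n" using real_arch_simple by blast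
        then have "c \<in> cball 0 (real n)" by simp
        then have "c \<in> boolean_model X" using X by blast
        then obtain y where "y \<in> X" "c \<in> ball y (1 / 2)" unfolding boolean_model_def by blast
        then have "y \<in> X \<inter> ball c (1 / 2)" by (simp add: dist_commute)
        then show "X \<inter> ball c (1 / 2) \<noteq> {}" by blast
      qed auto
    qed
    also have "\<dots> = hit_prob (1 / 2) ^ (n ^ DIM('a))" using E L by simp
    also have "\<dots> \<le> hit_prob (1 / 2) ^ n"
      using hit_prob_pos[of "1/2"] hit_prob_less_1[of "1/2"] self_le_power[of n "DIM('a)"]
      by (cases "n = 0") (auto intro!: power_decreasing power_le_one)
    finally show ?thesis .
  qed
  moreover have "(\<lambda>n. hit_prob (1 / 2) ^ n) \<longlonglongrightarrow> 0"
    using hit_prob_pos[of "1/2"] hit_prob_less_1[of "1/2"] by (intro LIMSEQ_realpow_zero) auto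
  ultimately have "prob ?N \<le> 0" by (intro LIMSEQ_le_const) auto
  then show ?thesis using measure_nonneg[of P ?N] by simp
qed

lemma small_distance_upper_bound:
  assumes \<epsilon>: "0 < \<epsilon>" "\<epsilon> \<le> 1 / 2"
  shows "prob (near_boundary \<epsilon>) \<le> \<zeta> * unit_ball_vol (DIM('a)) * real DIM('a) * \<epsilon>"
proof -
  let ?S = "thin_shell \<epsilon> :: 'a set"
  let ?N = "{X \<in> configurations. \<forall>n. cball (0::'a) (real n) \<subseteq> boolean_model X}"
  let ?E = "{X \<in> configurations. X \<inter> ?S \<noteq> {}}"
  have N: "?N \<in> events" by (intro pred_event pred_intros_countable pred_covers) auto
  have E: "?E \<in> events" using hits_in_region[OF thin_shell_sets subset_UNIV] region_event by blast
  have "near_boundary \<epsilon> \<subseteq> ?E \<union> ?N"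
  proof
    fix X :: "'a set" assume X: "X \<in> near_boundary \<epsilon>"
    then have O: "X \<in> Omega0" "X \<in> configurations" by (auto simp: Omega0_def)
    show "X \<in> ?E \<union> ?N"
    proof (cases "infinite_cluster X = UNIV")
      case True
      then show ?thesis using infinite_cluster_eq_UNIV_iff[OF O(1)] O(2) by blast
    next
      case False
      then show ?thesis using point_near_boundary[OF O(1) False, of \<epsilon>] X O(2)
        unfolding thin_shell_def by blast
    qed
  qed
  then have "prob (near_boundary \<epsilon>) \<le> prob (?E \<union> ?N)"
    using E N by (intro finite_measure_mono) auto
  also have "\<dots> \<le> prob ?E + prob ?N" using E N by (intro measure_Un_le)
  also have "\<dots> = 1 - exp (- (\<zeta> * measure lborel ?S))"
    using full_cover_null prob_hits[OF thin_shell_sets] by simp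
  also have "\<dots> \<le> \<zeta> * measure lborel ?S" using exp_ge_add_one_self[of "- (\<zeta> * measure lborel ?S)"] by linarith
  also have "\<dots> \<le> \<zeta> * (unit_ball_vol (DIM('a)) * (real DIM('a) * \<epsilon>))"
  proof -
    have "(1 / 2) ^ DIM('a) - (1 / 2 - \<epsilon>) ^ DIM('a) \<le> real DIM('a) * (1 / 2 - (1 / 2 - \<epsilon>))"
      using \<epsilon> by (intro power_diff_bounds(1)) auto
    then show ?thesis using measure_thin_shell[of \<epsilon>, where 'a = 'a] \<epsilon> intensity_pos
      by (simp add: mult_left_mono)
  qed
  finally show ?thesis by (simp add: mult.assoc)
qed

end

section \<open>Negative moments\<close>

lemma dyadic_level:
  fixes x :: real
  assumes "0 < x" "x < e"
  shows "\<exists>n. e / 2 ^ Suc n \<le> x \<and> x < e / 2 ^ n"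
proof -
  obtain m where m: "e / x < 2 ^ m" using real_arch_pow[of 2 "e / x"] by auto
  define k where "k = (LEAST k. e / 2 ^ k \<le> x)"
  have "e / 2 ^ m \<le> x" using m assms by (simp add: field_simps)
  then have k: "e / 2 ^ k \<le> x" unfolding k_def by (rule LeastI)
  then have "k \<noteq> 0" using assms by (intro notI) simp
  then obtain n where n: "k = Suc n" using not0_implies_Suc by blast
  have "\<not> e / 2 ^ n \<le> x" using not_less_Least[of n "\<lambda>k. e / 2 ^ k \<le> x"] n unfolding k_def by simp
  then show ?thesis using k n by auto
qed

text \<open>
The powers of 2 below \<open>y\<close> sum up to at most twice the largest of them.
\<close>

lemma sum_dyadic_below:
  fixes y :: real
  assumes "0 \<le> y"
  shows "(\<Sum>n<N. if 2 ^ n < y then 2 ^ n else 0) \<le> 2 * y"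
proof (induction N)
  case (Suc N)
  show ?case
  proof (cases "2 ^ N < y")
    case True
    have "(\<Sum>n<Suc N. if 2 ^ n < y then 2 ^ n else 0) \<le> (\<Sum>n<Suc N. 2 ^ n :: real)"
      by (intro sum_mono) auto
    also have "\<dots> = 2 ^ Suc N - 1" using geometric_sum[of "2::real" "Suc N"] by simp
    also have "\<dots> \<le> 2 * y" using True by simp
    finally show ?thesis .
  qed (use Suc in simp)
qed (use assms in simp)

text \<open>
On the dyadic level \<open>e / 2 ^ Suc n \<le> f x < e / 2 ^ n\<close> the integrand is of order \<open>2 ^ (n * \<kappa>)\<close>, and the
level has probability of order \<open>2 ^ - n\<close>.  For \<open>\<kappa> < 1\<close> the resulting series is geometric.
\<close>

lemma (in prob_space) nn_integral_negative_moment_finite: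
  fixes f :: "'a \<Rightarrow> real"
  assumes f [measurable]: "f \<in> borel_measurable M" and nonneg: "\<And>x. x \<in> space M \<Longrightarrow> 0 \<le> f x"
    and C: "0 \<le> C" "0 < e0" "\<And>e. 0 < e \<Longrightarrow> e < e0 \<Longrightarrow> prob {x \<in> space M. f x < e} \<le> C * e"
    and \<kappa>: "0 < \<kappa>" "\<kappa> < 1"
  shows "(\<integral>\<^sup>+ x. ennreal (f x powr - \<kappa>) \<partial>M) < \<infinity>" (is "?I < _")
proof -
  define e where "e = e0 / 2"
  have e: "0 < e" "e < e0" using C by (auto simp: e_def)
  define L where "L n = {x \<in> space M. f x < e / 2 ^ n}" for n :: nat
  have L [measurable]: "L n \<in> events" for n unfolding L_def by measurable
  define a where "a n = (e / 2 ^ Suc n) powr - \<kappa>" for n :: nat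
  have a: "0 \<le> a n" for n by (simp add: a_def)
  have le: "ennreal (f x powr - \<kappa>) \<le> ennreal (e powr - \<kappa>) + (\<Sum>n. ennreal (a n) * indicator (L n) x)"
    if x: "x \<in> space M" for x
  proof (cases "f x = 0 \<or> e \<le> f x")
    case True
    then have "f x powr - \<kappa> \<le> e powr - \<kappa>"
    proof
      assume "e \<le> f x"
      then show ?thesis using e \<kappa> by (intro powr_mono2') auto
    qed simp
    then have "ennreal (f x powr - \<kappa>) \<le> ennreal (e powr - \<kappa>)" by (rule ennreal_leI)
    then show ?thesis by (rule order_trans) simp
  next
    case False
    then have "0 < f x" "f x < e" using nonneg[OF x] by auto
    then obtain n where n: "e / 2 ^ Suc n \<le> f x" "f x < e / 2 ^ n" using dyadic_level by blast
    have "f x powr - \<kappa> \<le> a n" unfolding a_def using n(1) e \<kappa> by (intro powr_mono2') auto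
    then have "ennreal (f x powr - \<kappa>) \<le> ennreal (a n) * indicator (L n) x"
      using n(2) x by (simp add: L_def ennreal_leI)
    also have "\<dots> \<le> (\<Sum>n. ennreal (a n) * indicator (L n) x)"
    proof -
      define g where "g n = ennreal (a n) * indicator (L n) x" for n
      have "sum g {n} \<le> suminf g" by (rule sum_le_suminf) auto
      then have "g n \<le> suminf g" by simp
      then show ?thesis unfolding g_def .
    qed
    finally show ?thesis by (rule order_trans) simp
  qed
  have "?I \<le>
      (\<integral>\<^sup>+ x. ennreal (e powr - \<kappa>) + (\<Sum>n. ennreal (a n) * indicator (L n) x) \<partial>M)"
    by (rule nn_integral_mono[OF le])
  also have "\<dots> = ennreal (e powr - \<kappa>) + (\<Sum>n. ennreal (a n) * emeasure M (L n))"
    by (subst nn_integral_add) (simp_all add: emeasure_space_1 nn_integral_suminf nn_integral_cmult_indicator)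
  also have "(\<Sum>n. ennreal (a n) * emeasure M (L n)) \<le> (\<Sum>n. ennreal ((e / 2) powr - \<kappa> * (C * e) * (2 powr \<kappa> / 2) ^ n))"
  proof (intro suminf_le allI summableI)
    fix n
    have pos: "0 < e / 2 ^ n" using e by simp
    have "e / 2 ^ n \<le> e" using e by (simp add: field_simps)
    then have "prob (L n) \<le> C * (e / 2 ^ n)" unfolding L_def using pos e by (intro C(3)) auto
    then have le: "a n * prob (L n) \<le> a n * (C * (e / 2 ^ n))" using a by (rule mult_left_mono)
    have "a n = (e / 2) powr - \<kappa> * (2 powr \<kappa>) ^ n"
    proof -
      have E: "e / 2 ^ Suc n = e / 2 * (2 powr - real n)" by (simp add: powr_minus powr_realpow field_simps)
      have "a n = (e / 2) powr - \<kappa> * (2 powr - real n) powr - \<kappa>"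
        unfolding a_def E by (rule powr_mult)
      also have "(2 powr - real n) powr - \<kappa> = (2 powr \<kappa>) powr (real n)" by (simp add: powr_powr mult.commute)
      also have "\<dots> = (2 powr \<kappa>) ^ n" by (simp add: powr_realpow)
      finally show ?thesis .
    qed
    then have "a n * (C * (e / 2 ^ n)) = (e / 2) powr - \<kappa> * (C * e) * (2 powr \<kappa> / 2) ^ n"
      by (simp add: power_divide)
    with le have "a n * prob (L n) \<le> (e / 2) powr - \<kappa> * (C * e) * (2 powr \<kappa> / 2) ^ n" by simp
    then show "ennreal (a n) * emeasure M (L n) \<le> ennreal ((e / 2) powr - \<kappa> * (C * e) * (2 powr \<kappa> / 2) ^ n)"
      unfolding emeasure_eq_measure ennreal_mult'[OF a, symmetric] by (rule ennreal_leI)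
  qed
  also have "(\<Sum>n. ennreal ((e / 2) powr - \<kappa> * (C * e) * (2 powr \<kappa> / 2) ^ n)) =
    ennreal (\<Sum>n. (e / 2) powr - \<kappa> * (C * e) * (2 powr \<kappa> / 2) ^ n)"
  proof (rule suminf_ennreal2)
    show "0 \<le> (e / 2) powr - \<kappa> * (C * e) * (2 powr \<kappa> / 2) ^ n" for n using C e by simp
    have "2 powr \<kappa> < 2 powr (1 :: real)" using \<kappa> by (intro powr_less_mono) auto
    then show "summable (\<lambda>n. (e / 2) powr - \<kappa> * (C * e) * (2 powr \<kappa> / 2) ^ n)"
      by (intro summable_mult summable_geometric) simp
  qed
  also have "ennreal (e powr - \<kappa>) + ennreal (\<Sum>n. (e / 2) powr - \<kappa> * (C * e) * (2 powr \<kappa> / 2) ^ n) < top"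
    by simp
  finally show ?thesis by simp
qed

text \<open>
For \<open>f x < 1\<close> the integrand is at least \<open>1 / f x\<close>, which dominates half of the sum of those values
\<open>2 ^ n / e\<close> for which \<open>f x < e / 2 ^ n\<close>.  Each term contributes at least \<open>c / 2\<close> to the integral.
\<close>

lemma (in prob_space) nn_integral_negative_moment_infinite:
  fixes f :: "'a \<Rightarrow> real"
  assumes f [measurable]: "f \<in> borel_measurable M"
    and c: "0 < c" "0 < e0" "\<And>e. 0 < e \<Longrightarrow> e < e0 \<Longrightarrow> c * e \<le> prob {x \<in> space M. 0 < f x \<and> f x < e}"
    and \<kappa>: "1 \<le> \<kappa>"
  shows "(\<integral>\<^sup>+ x. ennreal (f x powr - \<kappa>) \<partial>M) = \<infinity>" (is "?I = _")
proof -
  define e where "e = min (e0 / 2) 1"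
  have e: "0 < e" "e < e0" "e \<le> 1" using c by (auto simp: e_def)
  define L where "L n = {x \<in> space M. 0 < f x \<and> f x < e / 2 ^ n}" for n :: nat
  have L [measurable]: "L n \<in> events" for n unfolding L_def by measurable
  have le: "(\<Sum>n<N. ennreal (2 ^ n / (2 * e)) * indicator (L n) x) \<le> ennreal (f x powr - \<kappa>)"
    if x: "x \<in> space M" for x N
  proof (cases "0 < f x \<and> f x < e")
    case False
    have "indicator (L n) x = (0::ennreal)" for n
    proof -
      have "e / 2 ^ n \<le> e" using e by (simp add: field_simps)
      then show ?thesis using False by (auto simp: L_def)
    qed
    then show ?thesis by simp
  next
    case True
    have "(\<Sum>n<N. ennreal (2 ^ n / (2 * e)) * indicator (L n) x) =
        (\<Sum>n<N. ennreal (1 / (2 * e) * (if 2 ^ n < e / f x then 2 ^ n else 0)))"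
      using True x by (intro sum.cong) (auto simp: L_def field_simps)
    also have "\<dots> = ennreal (1 / (2 * e) * (\<Sum>n<N. if 2 ^ n < e / f x then 2 ^ n else 0))"
      unfolding sum_distrib_left using e by (intro sum_ennreal) auto
    also have "\<dots> \<le> ennreal (1 / (2 * e) * (2 * (e / f x)))"
      using True e by (intro ennreal_leI mult_left_mono sum_dyadic_below) auto
    also have "1 / (2 * e) * (2 * (e / f x)) = f x powr - 1"
      using True e by (simp add: powr_minus_divide)
    also have "ennreal (f x powr - 1) \<le> ennreal (f x powr - \<kappa>)"
      using True e \<kappa> by (intro ennreal_leI powr_mono') auto
    finally show ?thesis .
  qed
  have "ennreal (real N * (c / 2)) \<le> ?I" for N
  proof -
    have term_le: "c / 2 \<le> 2 ^ n / (2 * e) * prob (L n)" for n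
    proof -
      have pos: "0 < e / 2 ^ n" using e by simp
      have "e / 2 ^ n \<le> e" using e by (simp add: field_simps)
      then have "c * (e / 2 ^ n) \<le> prob (L n)" unfolding L_def using pos e by (intro c(3)) auto
      then have "2 ^ n / (2 * e) * (c * (e / 2 ^ n)) \<le> 2 ^ n / (2 * e) * prob (L n)"
        using e by (intro mult_left_mono) auto
      then show ?thesis using e by simp
    qed
    have "ennreal (real N * (c / 2)) = (\<Sum>n<N. ennreal (c / 2))"
      using c by (subst sum_ennreal) auto
    also have "\<dots> \<le> (\<Sum>n<N. ennreal (2 ^ n / (2 * e)) * emeasure M (L n))"
      using term_le e by (intro sum_mono) (simp add: emeasure_eq_measure ennreal_leI flip: ennreal_mult')
    also have "\<dots> = (\<integral>\<^sup>+ x. (\<Sum>n<N. ennreal (2 ^ n / (2 * e)) * indicator (L n) x) \<partial>M)"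
      by (subst nn_integral_sum) (auto simp: nn_integral_cmult_indicator)
    also have "\<dots> \<le> ?I" by (rule nn_integral_mono[OF le])
    finally show ?thesis .
  qed
  then have *: "\<And>N. ennreal (real N * (c / 2)) \<le> ?I" .
  show ?thesis
  proof (rule ccontr)
    assume "?I \<noteq> \<infinity>"
    then obtain r where r: "0 \<le> r" "?I = ennreal r"
      by (cases ?I) auto
    obtain N :: nat where "r / (c / 2) < real N" using reals_Archimedean2 by blast
    then have "r < real N * (c / 2)" using c by (simp add: field_simps)
    moreover have "real N * (c / 2) \<le> r" using *[of N] r by (simp add: ennreal_le_iff)
    ultimately show False by simp
  qed
qed

theorem lemma5p1:
  fixes \<zeta> :: real and P :: "'a::euclidean_space set measure"
  assumes dim: "DIM('a) \<ge> 2"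
    and intensity: "0 < \<zeta>"
    and poisson: "poisson_process_law \<zeta> P"
    and supercritical: "critical_intensity TYPE('a) < ennreal \<zeta>"
  shows "(\<forall>\<omega> \<in> (Omega0 :: 'a set set).
            boundary_dist \<omega> = infdist 0 (frontier (infinite_cluster \<omega>))) \<and>
         (\<exists>c C \<epsilon>0 :: real. 0 < c \<and> 0 < C \<and> 0 < \<epsilon>0 \<and>
            (\<forall>\<epsilon>. 0 < \<epsilon> \<and> \<epsilon> < \<epsilon>0 \<longrightarrow>
               c * \<epsilon> \<le> measure (P0 P) {\<omega> \<in> Omega0. boundary_dist \<omega> < \<epsilon>} \<and>
               measure (P0 P) {\<omega> \<in> Omega0. boundary_dist \<omega> < \<epsilon>} \<le> C * \<epsilon>)) \<and>
         (\<forall>\<kappa> :: real. 0 < \<kappa> \<longrightarrow>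
            ((\<integral>\<^sup>+ \<omega>. ennreal (boundary_dist \<omega> powr (- \<kappa>)) \<partial>P0 P) < \<infinity> \<longleftrightarrow> \<kappa> \<in> {0<..<1}))"
proof -
  interpret prob_space P using poisson by (simp add: poisson_process_law_def)
  interpret poisson_process P \<zeta> by unfold_locales (rule poisson intensity)+
  obtain c0 where c0: "0 < c0"
    "\<And>\<epsilon>. 0 < \<epsilon> \<Longrightarrow> \<epsilon> \<le> 1 / 4 \<Longrightarrow> c0 * \<epsilon> \<le> prob (near_boundary_pos \<epsilon>)"
    by (rule small_distance_lower_bound[OF dim supercritical]) blast
  define C0 where "C0 = \<zeta> * unit_ball_vol (DIM('a)) * real DIM('a)"
  have C0: "0 < C0" unfolding C0_def using intensity by simp
  have "0 < c0 * (1 / 4)" using c0(1) by simp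
  also have "\<dots> \<le> prob (near_boundary_pos (1 / 4))" by (rule c0(2)) auto
  also have "\<dots> \<le> prob Omega0" by (rule finite_measure_mono[OF _ Omega0_event]) blast
  finally have p0: "0 < prob Omega0" .
  have e0: "emeasure P Omega0 \<noteq> 0" "emeasure P Omega0 \<noteq> \<infinity>" using p0 by (auto simp: emeasure_eq_measure)
  have P0: "measure (P0 P) A = prob A / prob Omega0" if "A \<in> events" "A \<subseteq> Omega0" for A
    unfolding P0_def measure_uniform_measure[OF e0 that(1)] using that(2) by (simp add: Int_absorb1)
  interpret Q: prob_space "P0 P" unfolding P0_def by (rule prob_space_uniform_measure[OF e0])
  have lower: "c0 / prob Omega0 * \<epsilon> \<le> measure (P0 P) (near_boundary_pos \<epsilon>)"
    if "0 < \<epsilon>" "\<epsilon> < 1 / 4" for \<epsilon>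
  proof -
    have "measure (P0 P) (near_boundary_pos \<epsilon>) =
      prob (near_boundary_pos \<epsilon>) / prob Omega0"
      by (rule P0[OF near_boundary_pos_event]) blast
    then show ?thesis using c0(2)[of \<epsilon>] that p0 by (simp add: divide_right_mono)
  qed
  have upper: "measure (P0 P) (near_boundary \<epsilon>) \<le> C0 / prob Omega0 * \<epsilon>"
    if "0 < \<epsilon>" "\<epsilon> < 1 / 4" for \<epsilon>
  proof -
    have "measure (P0 P) (near_boundary \<epsilon>) = prob (near_boundary \<epsilon>) / prob Omega0"
      by (rule P0[OF near_boundary_event]) blast
    then show ?thesis using small_distance_upper_bound[of \<epsilon>] that p0 unfolding C0_def
      by (simp add: divide_right_mono)
  qed
  have setsP0: "sets (P0 P) = events" "space (P0 P) = configurations" by (simp_all add: P0_def)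
  have lower': "c0 / prob Omega0 * \<epsilon> \<le> measure (P0 P) (near_boundary \<epsilon>)"
    if "0 < \<epsilon>" "\<epsilon> < 1 / 4" for \<epsilon>
  proof -
    have "measure (P0 P) (near_boundary_pos \<epsilon>) \<le>
        measure (P0 P) (near_boundary \<epsilon>)"
      by (rule Q.finite_measure_mono) (auto simp: setsP0 near_boundary_event)
    then show ?thesis using lower[OF that] by linarith
  qed
  (* Outside Omega0 the cluster is an arbitrary choice; a constant there makes the distance a
     measurable function without changing any integral. *)
  define f where "f X = (if X \<in> Omega0 then boundary_dist X else 1)" for X :: "'a set"
  have Osub: "X \<in> configurations" if "X \<in> Omega0" for X :: "'a set" using that by (simp add: Omega0_def)
  have f: "f \<in> borel_measurable (P0 P)"
    unfolding borel_measurable_iff_less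
  proof
    fix a :: real
    have "{X \<in> space (P0 P). f X < a} = near_boundary a \<union>
        (if 1 < a then space P - Omega0 else {})"
      using Osub by (auto simp: f_def setsP0)
    moreover have "space P - Omega0 \<in> events" using Omega0_event by (rule sets.compl_sets)
    ultimately show "{X \<in> space (P0 P). f X < a} \<in> sets (P0 P)"
      unfolding setsP0(1) using near_boundary_event[of a] by (cases "1 < a") (simp_all only: if_True if_False sets.Un sets.empty_sets)
  qed
  have AE0: "AE X in P0 P. X \<in> Omega0"
    unfolding P0_def by (rule AE_uniform_measureI[OF Omega0_event]) simp
  have int_eq: "(\<integral>\<^sup>+ X. ennreal (boundary_dist X powr (- \<kappa>)) \<partial>P0 P) = (\<integral>\<^sup>+ X. ennreal (f X powr (- \<kappa>)) \<partial>P0 P)" for \<kappa>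
    by (rule nn_integral_cong_AE) (use AE0 in \<open>auto simp: f_def\<close>)
  have fset: "{X \<in> space (P0 P). f X < e} = near_boundary e"
    "{X \<in> space (P0 P). 0 < f X \<and> f X < e} = near_boundary_pos e"
    if "e < 1 / 4" for e
    using that Osub by (auto simp: f_def setsP0)
  have fin: "(\<integral>\<^sup>+ X. ennreal (f X powr (- \<kappa>)) \<partial>P0 P) < \<infinity>" if "0 < \<kappa>" "\<kappa> < 1" for \<kappa>
  proof (rule Q.nn_integral_negative_moment_finite[OF f _ _ _ _ that, where C = "C0 / prob Omega0" and ?e0.0 = "1 / 4"])
    show "0 \<le> f X" for X by (simp add: f_def boundary_dist_def infdist_nonneg)
    show "0 \<le> C0 / prob Omega0" using C0 p0 by simp
    show "Q.prob {X \<in> space (P0 P). f X < e} \<le> C0 / prob Omega0 * e" if "0 < e" "e < 1 / 4" for e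
      unfolding fset(1)[OF that(2)] by (rule upper[OF that])
  qed simp
  have inf: "(\<integral>\<^sup>+ X. ennreal (f X powr (- \<kappa>)) \<partial>P0 P) = \<infinity>" if "1 \<le> \<kappa>" for \<kappa>
  proof (rule Q.nn_integral_negative_moment_infinite[OF f _ _ _ that, where c = "c0 / prob Omega0" and ?e0.0 = "1 / 4"])
    show "0 < c0 / prob Omega0" using c0 p0 by simp
    show "c0 / prob Omega0 * e \<le> Q.prob {X \<in> space (P0 P). 0 < f X \<and> f X < e}" if "0 < e" "e < 1 / 4" for e
      unfolding fset(2)[OF that(2)] by (rule lower[OF that])
  qed simp
  show ?thesis
  proof (intro conjI ballI allI impI)
    show "boundary_dist X = infdist 0 (frontier (infinite_cluster X))" if "X \<in> Omega0" for X :: "'a set"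
      by (rule Omega0_boundary_dist_frontier[OF that])
    show "\<exists>c C \<epsilon>0 :: real. 0 < c \<and> 0 < C \<and> 0 < \<epsilon>0 \<and>
            (\<forall>\<epsilon>. 0 < \<epsilon> \<and> \<epsilon> < \<epsilon>0 \<longrightarrow>
               c * \<epsilon> \<le> measure (P0 P) (near_boundary \<epsilon>) \<and>
               measure (P0 P) (near_boundary \<epsilon>) \<le> C * \<epsilon>)"
      using c0(1) C0 p0 lower' upper
      by (intro exI[of _ "c0 / prob Omega0"] exI[of _ "C0 / prob Omega0"] exI[of _ "1 / 4"]) auto
    show "(\<integral>\<^sup>+ X. ennreal (boundary_dist X powr (- \<kappa>)) \<partial>P0 P) < \<infinity> \<longleftrightarrow> \<kappa> \<in> {0<..<1}" if "0 < \<kappa>" for \<kappa>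
      unfolding int_eq using that fin[of \<kappa>] inf[of \<kappa>] by (cases "\<kappa> < 1") auto
  qed
qed

end
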